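(* Let $m\ge 2$, let $\{a_1,\dots,a_m\}$ be an alphabet with letter probabilities $p_1,\dots,p_m>0$, $\sum_{j=1}^m p_j=1$, and let $h=-\sum_{j=1}^m p_j\ln p_j$. For a motif $T$ let $X_{n,T}$ be the number of occurrences of $T$ in an $m$-ary trie constructed over $n$ independent strings from this alphabet. There are functions $\delta_T,\widehat\delta_T$ (for each motif $T$ of size at least $2$) and $\delta_{T,\widetilde T},\widehat\delta_{T,\widetilde T}$ (for each pair of nonoverlapping motifs $T,\widetilde T$ of sizes at least $2$), all oscillating (possibly $0$), such that the following hold as $n\to\infty$. (a) For every motif $T$ of size $\tau\ge2$ with shape functional $\mathbf{Q}(T)$, $$\begin{aligned}\mathrm{Var}[X_{n,T}]=\Biggl[&\frac{\mathbf{Q}(T)}{\tau(\tau-1)h}-\frac{2\mathbf{Q}(T)^2}{h}\Biggl(\frac{2^{-2\tau}}{2\tau(2\tau-1)}\binom{2\tau}{\tau}+\frac1{(\tau!)^2}\sum_{j=0}^\infty(-1)^j\frac{\sum_{k=1}^m p_k^{j+\tau}}{1-\sum_{k=1}^m p_k^{j+\tau}}\cdot\frac{(j+2\tau-2)!}{j!}\Biggr)\\&+\delta_T(n)-\Bigl(\frac{\mathbf{Q}(T)}{\tau(\tau-1)h}+\widehat\delta_T(n)\Bigr)^2\Biggr]n+o(n),\end{aligned}$$ where $\delta_T$ and $\widehat\delta_T$ are possibly fluctuating with average value zero when the set of probabilities is periodic, and are $0$ otherwise. In the periodic case the $o(n)$ estimate can be improved to $O(n^{1-\varepsilon})$ for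 some $0<\varepsilon<1$. (b) If $T$ and $\widetilde T$ are two nonoverlapping motifs of sizes $\tau\ge 2$ and $\widetilde\tau\ge2$ (not necessarily equal), then $$\begin{aligned}\mathrm{Cov}[X_{n,T},X_{n,\widetilde T}]=\Biggl[&-\frac{2\mathbf{Q}(T)\mathbf{Q}(\widetilde T)}{\tau!\,\widetilde\tau!\,h}\Biggl(2^{-\tau-\widetilde\tau}(\tau+\widetilde\tau-2)!\\&\quad+2^{-1}\sum_{j=0}^\infty(-1)^j\Bigl(\frac{\sum_{k=1}^m p_k^{\tau+j}}{1-\sum_{k=1}^m p_k^{\tau+j}}+\frac{\sum_{k=1}^m p_k^{\widetilde\tau+j}}{1-\sum_{k=1}^m p_k^{\widetilde\tau+j}}\Bigr)\frac{(\tau+\widetilde\tau+j-2)!}{j!}\Biggr)\\&+\frac12\bigl(\delta_{T,\widetilde T}(n)-\delta_T(n)-\delta_{\widetilde T}(n)\bigr)-\frac{\mathbf{Q}(T)\mathbf{Q}(\widetilde T)}{\tau(\tau-1)\widetilde\tau(\widetilde\tau-1)h^2}\\&+\frac1{2h}\Bigl(\frac{\mathbf{Q}(T)}{\tau(\tau-1)}\bigl(\widehat\delta_T(n)-\widehat\delta_{T,\widetilde T}(n)\bigr)+\frac{\mathbf{Q}(\widetilde T)}{\widetilde\tau(\widetilde\tau-1)}\bigl(\widehat\delta_{\widetilde T}(n)-\widehat\delta_{T,\widetilde T}(n)\bigr)\Bigr)\\&-\bigl(\widehat\delta_{T,\widetilde T}(n)^2-\widehat\delta_T(n)^2-\widehat\delta_{\widetilde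 T}(n)^2\bigr)\Biggr]n+o(n),\end{aligned}$$ where $\delta_T,\widehat\delta_T$ (and likewise $\delta_{\widetilde T},\widehat\delta_{\widetilde T}$) are the same functions as in (a).
   Context: Source and strings. $\mathcal{A}=\{a_1,\dots,a_m\}$, and $\mathcal{A}^*$ is the set of all finite words over $\mathcal{A}$ (including the empty word). The strings $S_1,S_2,\dots$ are independent infinite words, and the successive letters of each are i.i.d., equal to $a_j$ with probability $p_j$ (memoryless source). For a finite word $w=a_{i_1}\cdots a_{i_\ell}$ put $\mathbb{P}(w)=p_{i_1}\cdots p_{i_\ell}$. Tries. The $m$-ary trie on $n$ distinct strings is defined recursively: it is empty if $n=0$; it is a single external node holding the string if $n=1$; if $n>1$ it has an internal root with $m$ ordered subtrees, the $j$th being the trie built on the strings starting with $a_j$ (branching at level $\ell$ uses the $(\ell+1)$st letter). For $n\ge2$ its shape is determined by the set $\{W_1,\dots,W_n\}$, where $W_i$ is the shortest prefix of $S_i$ that is not a prefix of any other $S_j$. Motifs. A motif (trie shape) of size $\tau\ge2$ is a set $T=\{W_1,\dots,W_\tau\}$ of $\tau$ nonempty finite words such that, for each $i$, $W_i$ is not a prefix of any other $W_j$, and deleting the last letter of $W_i$ gives a prefix of at least one other $W_j$. An occurrence of $T$ (on the fringe) in the trie on $S_1,\dots,S_n$ is a word $w\in\mathcal{A}^*$ such that exactly $\tau$ of the strings have prefix $w$ and the trie on these $\tau$ strings, after deleting the prefix $w$, has shape $T$. $X_{n,T}$ is the number of such $w$. Nonoverlapping. Two motifs are nonoverlapping if neither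 appears as a subtree of the other, where $T$ appears as a subtree of $\widetilde T$ if for some $w\in\mathcal{A}^*$ the set of words $W$ with $wW\in\widetilde T$ equals $T$. Shape functional. $\mathbf{Q}(T)$ is the probability that the trie on $\tau$ random strings has shape $T$; explicitly $\mathbf{Q}(T)=\tau!\prod_{j=1}^\tau\mathbb{P}(W_j)$. Periodicity. The probabilities are periodic if $\ln p_j/\ln p_k$ is rational for all $1\le j,k\le m$, and aperiodic otherwise. Oscillating functions. An oscillating (fluctuating) function is a function $x\mapsto P(\ln x)$ on $(0,\infty)$ with $P:\mathbb{R}\to\mathbb{R}$ continuous and periodic (possibly identically zero); it has average value zero if the integral of $P$ over a period is $0$. All oscillating functions in the claim are identically zero in the aperiodic case. *)

theory Defs
  imports "HOL-Probability.Probability" "HOL-Library.Stream" "HOL-Library.Landau_Symbols"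
begin

text \<open>
  The alphabet is a finite type \<open>'a\<close>, so \<open>m = CARD('a)\<close>; a family of letter probabilities is a
  function \<open>p :: 'a \<Rightarrow> real\<close>. Infinite words are streams, and \<open>stake (length w) s = w\<close> says that the
  finite word \<open>w\<close> is a prefix of \<open>s\<close>.
\<close>

section \<open>Tries and their shapes\<close>

text \<open>
  An external node stores what remains of its string after the letters consumed on the path to it.
\<close>

datatype 'a trie = Empty | External "'a stream" | Internal "'a \<Rightarrow> 'a trie"

inductive is_trie :: "'a stream set \<Rightarrow> 'a trie \<Rightarrow> bool" where
  is_trie_Empty: "is_trie {} Empty"
| is_trie_External: "is_trie {s} (External s)"
| is_trie_Internal: "finite A \<Longrightarrow> card A > 1 \<Longrightarrow> (\<And>a. is_trie {s. a ## s \<in> A} (t a))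
    \<Longrightarrow> is_trie A (Internal t)"

primrec external_words :: "'a trie \<Rightarrow> 'a list set" where
  "external_words Empty = {}"
| "external_words (External s) = {[]}"
| "external_words (Internal t) = (\<Union>a. (#) a ` external_words (t a))"

text \<open>
  The shape of the trie on a set of strings: the set of words \<open>u\<close> that are, for some string \<open>s\<close>,
  the shortest prefix of \<open>s\<close> which is not a prefix of any other string.
\<close>

definition trie_shape :: "'a stream set \<Rightarrow> 'a list set" where
  "trie_shape A = {u. \<exists>s\<in>A. stake (length u) s = u
      \<and> (\<forall>s'\<in>A - {s}. stake (length u) s' \<noteq> u)
      \<and> (\<forall>l<length u. \<exists>s'\<in>A - {s}. stake l s' = stake l s)}"

lemma trie_shape_Nil_iff: "[] \<in> trie_shape A \<longleftrightarrow> (\<exists>s. A = {s})"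
  by (auto simp: trie_shape_def)

lemma trie_shape_Cons_iff:
  assumes "A \<noteq> {}" "\<nexists>s. A = {s}"
  shows "a # u \<in> trie_shape A \<longleftrightarrow> u \<in> trie_shape {s. a ## s \<in> A}"
proof
  assume "a # u \<in> trie_shape A"
  then obtain s where s: "s \<in> A" "stake (Suc (length u)) s = a # u"
    "\<And>s'. s' \<in> A - {s} \<Longrightarrow> stake (Suc (length u)) s' \<noteq> a # u"
    "\<And>l. l < Suc (length u) \<Longrightarrow> \<exists>s'\<in>A - {s}. stake l s' = stake l s"
    unfolding trie_shape_def by auto
  have eq: "s = a ## stl s" using s(2) by (cases s) auto
  have "\<exists>s'\<in>{s. a ## s \<in> A} - {stl s}. stake l s' = stake l (stl s)" if l: "l < length u" for l
  proof -
    obtain s' where s': "s' \<in> A" "s' \<noteq> s" "stake (Suc l) s' = stake (Suc l) s"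
      using s(4)[of "Suc l"] l by auto
    have "s' = a ## stl s'" using s'(3) eq by (metis list.inject stake.simps(2) stream.sel(1) stream.collapse)
    with s' eq show ?thesis
      by (intro bexI[of _ "stl s'"]) auto
  qed
  moreover have "stake (length u) s' \<noteq> u" if "a ## s' \<in> A" "s' \<noteq> stl s" for s'
    using s(3)[of "a ## s'"] that eq by (metis DiffI singletonD stake.simps(2) stream.sel)
  ultimately show "u \<in> trie_shape {s. a ## s \<in> A}"
    unfolding trie_shape_def using s(1,2) eq
    by (intro CollectI bexI[of _ "stl s"]) auto
next
  assume "u \<in> trie_shape {s. a ## s \<in> A}"
  then obtain s where s: "a ## s \<in> A" "stake (length u) s = u"
    "\<And>s'. a ## s' \<in> A \<Longrightarrow> s' \<noteq> s \<Longrightarrow> stake (length u) s' \<noteq> u"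
    "\<And>l. l < length u \<Longrightarrow> \<exists>s'. a ## s' \<in> A \<and> s' \<noteq> s \<and> stake l s' = stake l s"
    unfolding trie_shape_def by blast
  have "stake (Suc (length u)) s' \<noteq> a # u" if "s' \<in> A" "s' \<noteq> a ## s" for s'
    using s(3)[of "stl s'"] that by (cases s') auto
  moreover have "\<exists>s'\<in>A - {a ## s}. stake l s' = stake l (a ## s)" if l: "l < Suc (length u)" for l
  proof (cases l)
    case 0
    then show ?thesis using assms s(1) by auto
  next
    case (Suc k)
    then obtain s' where "a ## s' \<in> A" "s' \<noteq> s" "stake k s' = stake k s"
      using s(4)[of k] l by auto
    with Suc show ?thesis by (intro bexI[of _ "a ## s'"]) auto
  qed
  ultimately show "a # u \<in> trie_shape A"
    unfolding trie_shape_def using s(1,2)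
    by (intro CollectI bexI[of _ "a ## s"]) auto
qed

lemma external_words_eq_trie_shape:
  assumes "is_trie A t"
  shows "external_words t = trie_shape A"
  using assms
proof (induction rule: is_trie.induct)
  case is_trie_Empty
  show ?case by (simp add: trie_shape_def)
next
  case (is_trie_External s)
  have "u \<in> trie_shape {s} \<longleftrightarrow> u = []" for u
    by (cases u) (auto simp: trie_shape_def)
  then show ?case by auto
next
  case (is_trie_Internal A t)
  have ne: "A \<noteq> {}" "\<nexists>s. A = {s}" using is_trie_Internal.hyps by auto
  have "u \<in> external_words (Internal t) \<longleftrightarrow> u \<in> trie_shape A" for u
    using ne is_trie_Internal.IH
    by (cases u) (auto simp: trie_shape_Nil_iff trie_shape_Cons_iff[OF ne])
  then show ?case by blast
qed

lemma stake_separates: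
  assumes "finite A"
  shows "\<exists>d. inj_on (stake d) A"
proof -
  have mono: "stake k s = stake k s'" if "stake l s = stake l s'" "k \<le> l"
    for k l and s s' :: "'a stream"
  proof -
    have "take k (stake l s) = take k (stake l s')" using that(1) by simp
    then show ?thesis using that(2) by (simp add: take_stake min_def)
  qed
  have "\<exists>d. stake d s \<noteq> stake d s'" if ne: "s \<noteq> s'" for s s' :: "'a stream"
  proof -
    obtain i where "s !! i \<noteq> s' !! i" using ne smap_alt[of id s s'] unfolding stream.map_id id_apply by blast
    then have "stake (Suc i) s ! i \<noteq> stake (Suc i) s' ! i" by (simp add: stake_nth del: stake.simps)
    then show ?thesis by (intro exI[of _ "Suc i"]) auto
  qed
  then obtain d where d: "stake (d s s') s \<noteq> stake (d s s') s'" if "s \<noteq> s'" for s s' :: "'a stream"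
    by metis
  define D where "D = Max ((\<lambda>(s, s'). d s s') ` (A \<times> A))"
  have "d s s' \<le> D" if "s \<in> A" "s' \<in> A" for s s'
    unfolding D_def using assms that by (intro Max_ge) auto
  then have "s = s'" if "s \<in> A" "s' \<in> A" "stake D s = stake D s'" for s s'
    using d[of s s'] mono[OF that(3)] that by blast
  then have "inj_on (stake D) A" by (rule inj_onI)
  then show ?thesis ..
qed

lemma is_trie_exists:
  assumes "finite A"
  shows "\<exists>t. is_trie A t"
proof -
  obtain d where "inj_on (stake d) A" using stake_separates[OF assms] by blast
  then show ?thesis using assms
  proof (induction d arbitrary: A)
    case 0
    then have "s = s'" if "s \<in> A" "s' \<in> A" for s s'
      using inj_onD[OF 0(1)] that by simp
    then have "A = {} \<or> (\<exists>s. A = {s})" by blast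
    then show ?case by (blast intro: is_trie.intros)
  next
    case (Suc d)
    show ?case
    proof (cases "card A > 1")
      case True
      have "\<exists>t. is_trie {s. a ## s \<in> A} t" for a
      proof (rule Suc.IH)
        show "inj_on (stake d) {s. a ## s \<in> A}"
        proof (rule inj_onI)
          fix s s' assume "s \<in> {s. a ## s \<in> A}" "s' \<in> {s. a ## s \<in> A}" "stake d s = stake d s'"
          then have "a ## s = a ## s'" by (intro inj_onD[OF Suc.prems(1)]) simp_all
          then show "s = s'" by simp
        qed
        have "{s. a ## s \<in> A} \<subseteq> stl ` A"
        proof
          fix s assume "s \<in> {s. a ## s \<in> A}"
          then have "stl (a ## s) \<in> stl ` A" by blast
          then show "s \<in> stl ` A" by simp
        qed
        then show "finite {s. a ## s \<in> A}" using Suc.prems(2) by (meson finite_imageI finite_subset)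
      qed
      then obtain t where "is_trie {s. a ## s \<in> A} (t a)" for a by metis
      then have "is_trie A (Internal t)" using True Suc.prems(2) by (intro is_trie_Internal)
      then show ?thesis ..
    next
      case False
      then have "card A = 0 \<or> card A = 1" by linarith
      with Suc.prems(2) have "A = {} \<or> (\<exists>s. A = {s})" by (auto simp: card_1_singleton_iff)
      then show ?thesis by (blast intro: is_trie.intros)
    qed
  qed
qed

section \<open>Motifs\<close>

definition motif :: "nat \<Rightarrow> 'a list set \<Rightarrow> bool" where
  "motif \<tau> T \<longleftrightarrow> finite T \<and> card T = \<tau> \<and> \<tau> \<ge> 2 \<and>
     (\<forall>W\<in>T. W \<noteq> [] \<and> (\<forall>W'\<in>T - {W}. \<not> prefix W W') \<and> (\<exists>W'\<in>T - {W}. prefix (butlast W) W'))"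

definition appears_as_subtree :: "'a list set \<Rightarrow> 'a list set \<Rightarrow> bool" where
  "appears_as_subtree T T' \<longleftrightarrow> (\<exists>w. {W. w @ W \<in> T'} = T)"

definition nonoverlapping :: "'a list set \<Rightarrow> 'a list set \<Rightarrow> bool" where
  "nonoverlapping T T' \<longleftrightarrow> \<not> appears_as_subtree T T' \<and> \<not> appears_as_subtree T' T"

definition occurrence :: "'a list set \<Rightarrow> (nat \<Rightarrow> 'a stream) \<Rightarrow> nat \<Rightarrow> 'a list \<Rightarrow> bool" where
  "occurrence T s n w \<longleftrightarrow>
     (let I = {i. i < n \<and> stake (length w) (s i) = w}
      in card I = card T \<and> trie_shape ((\<lambda>i. sdrop (length w) (s i)) ` I) = T)"

text \<open>The random variable \<open>X\<^bsub>n,T\<^esub>\<close>; the strings are numbered from \<open>0\<close>.\<close>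

definition motif_count ::
    "(nat \<Rightarrow> 'w \<Rightarrow> 'a stream) \<Rightarrow> 'a list set \<Rightarrow> nat \<Rightarrow> 'w \<Rightarrow> real" where
  "motif_count S T n \<omega> = real (card {w. occurrence T (\<lambda>i. S i \<omega>) n w})"

definition shape_functional ::
    "'w measure \<Rightarrow> (nat \<Rightarrow> 'w \<Rightarrow> 'a stream) \<Rightarrow> 'a list set \<Rightarrow> real" where
  "shape_functional M S T =
     measure M {\<omega> \<in> space M. trie_shape ((\<lambda>i. S i \<omega>) ` {..<card T}) = T}"

section \<open>The random strings\<close>

definition memoryless_source ::
    "'w measure \<Rightarrow> (nat \<Rightarrow> 'w \<Rightarrow> 'a stream) \<Rightarrow> ('a \<Rightarrow> real) \<Rightarrow> bool" where
  "memoryless_source M S p \<longleftrightarrow> prob_space M \<and>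
     prob_space.indep_vars M (\<lambda>_. count_space UNIV) (\<lambda>(i, k) \<omega>. S i \<omega> !! k) (UNIV :: (nat \<times> nat) set) \<and>
     (\<forall>i k a. measure M {\<omega> \<in> space M. S i \<omega> !! k = a} = p a)"

definition covariance :: "'w measure \<Rightarrow> ('w \<Rightarrow> real) \<Rightarrow> ('w \<Rightarrow> real) \<Rightarrow> real" where
  "covariance M X Y =
     integral\<^sup>L M (\<lambda>\<omega>. (X \<omega> - integral\<^sup>L M X) * (Y \<omega> - integral\<^sup>L M Y))"

definition source_entropy :: "('a::finite \<Rightarrow> real) \<Rightarrow> real" where
  "source_entropy p = - (\<Sum>a\<in>UNIV. p a * ln (p a))"

definition periodic_probs :: "('a \<Rightarrow> real) \<Rightarrow> bool" where
  "periodic_probs p \<longleftrightarrow> (\<forall>a b. ln (p a) / ln (p b) \<in> \<rat>)"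

definition power_ratio :: "('a::finite \<Rightarrow> real) \<Rightarrow> nat \<Rightarrow> real" where
  "power_ratio p s = (\<Sum>a\<in>UNIV. p a ^ s) / (1 - (\<Sum>a\<in>UNIV. p a ^ s))"

section \<open>Oscillating functions\<close>

definition oscillating :: "(real \<Rightarrow> real) \<Rightarrow> bool" where
  "oscillating f \<longleftrightarrow> (\<exists>P d. d > 0 \<and> continuous_on UNIV P \<and> (\<forall>x. P (x + d) = P x) \<and>
     (\<forall>x>0. f x = P (ln x)))"

definition oscillating_mean_zero :: "(real \<Rightarrow> real) \<Rightarrow> bool" where
  "oscillating_mean_zero f \<longleftrightarrow> (\<exists>P d. d > 0 \<and> continuous_on UNIV P \<and> (\<forall>x. P (x + d) = P x) \<and>
     (\<forall>x>0. f x = P (ln x)) \<and> integral {0..d} P = 0)"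

definition vanishing :: "(real \<Rightarrow> real) \<Rightarrow> bool" where
  "vanishing f \<longleftrightarrow> (\<forall>x>0. f x = 0)"

end

theory Submission
  imports Defs
begin

text \<open>
  An occurrence at a word \<open>w\<close> is an event about which strings pass through which nodes, so its
  probability is \<open>Q T\<close> times a binomial probability with success probability \<open>P w\<close>, and for two
  words neither of which is a prefix of the other the joint probability is a trinomial one. All
  asymptotics therefore concern \<^emph>\<open>word sums\<close>: sums of \<open>f (x * P w)\<close> over all words \<open>w\<close>.

  Word sums obey a renewal theorem. Splitting a word at its first letter gives
  \<open>F x = f x + (\<Sum>a. F (p a * x))\<close>, a renewal equation for \<open>F (exp x) / exp x\<close> with steps \<open>- ln (p a)\<close>, whose
  mean is the entropy \<open>h\<close>. In the aperiodic case the steps generate a dense group and \<open>F x / x\<close>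
  converges to \<open>weight f / h\<close>, where \<open>weight f\<close> is the integral of \<open>f t / t\<^sup>2\<close> over the positive reals
  (\<open>word_sum_aperiodic\<close>). In the periodic case the steps lie on a lattice and \<open>F x / x\<close> approaches a
  continuous periodic function of \<open>ln x\<close> with mean \<open>weight f / h\<close>, with a relative error that is a
  negative power of \<open>x\<close> (\<open>word_sum_periodic\<close>). Both follow from elementary maximum arguments for the
  renewal equation.

  For the covariance, replace the binomial probabilities by Poisson weights \<open>pois k t\<close> at
  \<open>t = n * P w\<close>. Two occurrences at comparable words exclude each other, except that an
  occurrence coincides with itself; such pairs contribute a word sum of the function \<open>spread T T'\<close>. At
  incomparable words the trinomial probability differs from the product of the binomial ones by a
  correction of relative order \<open>1 / n\<close>, which to leading order factorizes: it is the product of the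
  Euler derivatives of the two Poisson weights, divided by \<open>- n\<close>. Since the factors are summed over
  all words, the correction is of order \<open>n\<close> in total, hence
  \<open>Cov = F (spread T T') n - F (drift T) n * F (drift T') n / n + O(1)\<close> (\<open>covariance_approx\<close>), with
  \<open>drift T\<close> the Euler derivative scaled by \<open>Q T\<close>.

  The renewal theorem turns this into \<open>n\<close> times a continuous function of \<open>ln n\<close> that is constant or periodic. The constants are
  the weights of \<open>drift T\<close> and \<open>spread T T'\<close>; the alternating series in them arises from expanding
  \<open>(1 + P u) powi (- (r + 1))\<close> into a binomial series and summing the powers of \<open>P u\<close> over the nonempty
  words \<open>u\<close>, which gives \<open>power_ratio\<close>. The oscillating functions are the deviations of the periodic
  limits from their means. In the covariance formula \<open>\<delta>2\<close> enters linearly, so it can be solved for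
  once the other functions are given; it is solved for with \<open>\<delta>h2 = 0\<close>.
\<close>

section \<open>Sums over all words\<close>

definition word_prob :: "('a \<Rightarrow> real) \<Rightarrow> 'a list \<Rightarrow> real" where
  "word_prob p w = prod_list (map p w)"

definition word_sum :: "('a \<Rightarrow> real) \<Rightarrow> (real \<Rightarrow> real) \<Rightarrow> real \<Rightarrow> real" where
  "word_sum p f x = (\<Sum>\<^sub>\<infinity>w. f (x * word_prob p w))"

text \<open>
  The bound \<open>kappa\<close> behaves like \<open>t\<^sup>2\<close> near \<open>0\<close> and is bounded at infinity. This is just enough for word
  sums: only \<open>O(x)\<close> words have \<open>x * P w \<ge> 1\<close>, and below them the quadratic decay
  keeps the total at \<open>O(x)\<close>, whereas \<open>\<lambda>t. t\<close> is not summable, each level of words contributing \<open>x\<close>.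
\<close>

definition kappa :: "real \<Rightarrow> real" where
  "kappa t = t\<^sup>2 / (1 + t)\<^sup>2"

text \<open>
  Slow variation on the multiplicative scale passes to word sums and makes their limit functions
  Lipschitz continuous. The bound \<open>\<phi>\<close> is a parameter because word sums need \<open>kappa\<close>, while products with
  functions of linear growth need a faster decay.
\<close>

definition tame :: "(real \<Rightarrow> real) \<Rightarrow> real \<Rightarrow> (real \<Rightarrow> real) \<Rightarrow> bool" where
  "tame \<phi> C f \<longleftrightarrow> (\<forall>t>0. \<bar>f t\<bar> \<le> C * \<phi> t) \<and>
     (\<forall>t>0. \<forall>c. 1 \<le> c \<longrightarrow> c \<le> 2 \<longrightarrow> \<bar>f (c * t) - f t\<bar> \<le> C * (c - 1) * \<phi> t)"

lemma word_prob_Nil [simp]: "word_prob p [] = 1"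
  and word_prob_Cons [simp]: "word_prob p (a # w) = p a * word_prob p w"
  and word_prob_append [simp]: "word_prob p (u @ w) = word_prob p u * word_prob p w"
  by (simp_all add: word_prob_def)

lemma UNIV_list_eq: "(UNIV :: 'a list set) = insert [] (\<Union>a. (#) a ` UNIV)"
proof -
  have "w \<in> insert [] (\<Union>a. (#) a ` UNIV)" for w :: "'a list" by (cases w) auto
  then show ?thesis by blast
qed

lemma finite_short_words: "finite {w :: 'a::finite list. length w < k}"
  by (rule finite_subset[OF _ finite_lists_length_le[of UNIV k]]) auto

lemma sum_short_words_Suc:
  fixes g :: "'a::finite list \<Rightarrow> real"
  shows "(\<Sum>w | length w < Suc k. g w) = g [] + (\<Sum>a\<in>UNIV. \<Sum>w | length w < k. g (a # w))"
proof -
  have eq: "{w :: 'a list. length w < Suc k} = insert [] (\<Union>a. (#) a ` {w. length w < k})"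
  proof -
    have "w \<in> {w :: 'a list. length w < Suc k} \<longleftrightarrow> w \<in> insert [] (\<Union>a. (#) a ` {w. length w < k})" for w
      by (cases w) auto
    then show ?thesis by blast
  qed
  have "(\<Sum>w | length w < Suc k. g w) = g [] + (\<Sum>w\<in>(\<Union>a. (#) a ` {w. length w < k}). g w)"
    unfolding eq by (subst sum.insert) (auto simp: finite_short_words)
  also have "(\<Sum>w\<in>(\<Union>a. (#) a ` {w. length w < k}). g w) = (\<Sum>a\<in>UNIV. \<Sum>w\<in>(#) a ` {w. length w < k}. g w)"
    by (intro sum.UNION_disjoint) (auto simp: finite_short_words)
  also have "\<dots> = (\<Sum>a\<in>UNIV. \<Sum>w | length w < k. g (a # w))"
    by (simp add: sum.reindex)
  finally show ?thesis .
qed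

lemma infsum_diff:
  fixes f g :: "'b \<Rightarrow> real"
  assumes "f summable_on A" "g summable_on A"
  shows "(\<Sum>\<^sub>\<infinity>x\<in>A. f x - g x) = (\<Sum>\<^sub>\<infinity>x\<in>A. f x) - (\<Sum>\<^sub>\<infinity>x\<in>A. g x)"
    and summable_on_diff: "(\<lambda>x. f x - g x) summable_on A"
  using infsum_add[OF assms(1) summable_on_uminus[THEN iffD2, OF assms(2)]]
    summable_on_add[OF assms(1) summable_on_uminus[THEN iffD2, OF assms(2)]] by (simp_all add: infsum_uminus)

lemma kappa_nonneg: "kappa t \<ge> 0"
  by (simp add: kappa_def)

locale letter_probs =
  fixes p :: "'a::finite \<Rightarrow> real"
  assumes p_pos: "p a > 0"
    and p_sum: "(\<Sum>a\<in>UNIV. p a) = 1"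
    and alphabet: "CARD('a) \<ge> 2"
begin

abbreviation P :: "'a list \<Rightarrow> real" where "P \<equiv> word_prob p"
abbreviation F :: "(real \<Rightarrow> real) \<Rightarrow> real \<Rightarrow> real" where "F \<equiv> word_sum p"

definition gap :: real where
  "gap = (\<Sum>a\<in>UNIV. p a * (1 - p a))"

lemma p_less_1: "p a < 1"
proof -
  have "UNIV \<noteq> {a}" using alphabet by (metis card_1_singleton_iff not_numeral_le_zero One_nat_def numeral_le_one_iff semiring_norm(69))
  then obtain b where b: "b \<noteq> a" by auto
  have "p a + p b = (\<Sum>c\<in>{a,b}. p c)" using b by simp
  also have "\<dots> \<le> (\<Sum>c\<in>UNIV. p c)" by (intro sum_mono2) (auto intro: less_imp_le p_pos)
  finally show ?thesis using p_sum p_pos[of b] by simp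
qed

lemma gap_pos: "gap > 0"
  unfolding gap_def by (intro sum_pos) (auto simp: p_pos p_less_1)

lemma P_pos: "P w > 0"
  by (induction w) (auto simp: p_pos)

lemma P_le_1: "P w \<le> 1"
proof (induction w)
  case (Cons a w)
  then show ?case using mult_mono[of "p a" 1 "P w" 1] p_pos[of a] p_less_1[of a] P_pos[of w] by simp
qed simp

definition p_max :: real where "p_max = Max (range p)"

lemma p_le_p_max: "p a \<le> p_max"
  unfolding p_max_def by (intro Max_ge) auto

lemma p_max_less_1: "p_max < 1"
  unfolding p_max_def by (subst Max_less_iff) (auto simp: p_less_1)

lemma P_le_p_max: "w \<noteq> [] \<Longrightarrow> P w \<le> p_max"
proof (cases w)
  case (Cons a v)
  have "p a * P v \<le> p a * 1" using P_le_1[of v] p_pos[of a] by (intro mult_left_mono) auto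
  then show ?thesis using Cons p_le_p_max[of a] by simp
qed simp

text \<open>
  The function \<open>x\<^sup>2 / (1 + x)\<close> is a supersolution of the recursion for the word sum of \<open>gap * kappa\<close>. It is
  at most \<open>x\<close>, so word sums of functions bounded by \<open>kappa\<close> grow at most linearly.
\<close>

lemma kappa_partial_sums:
  assumes "x > 0"
  shows "gap * (\<Sum>w | length w < k. kappa (x * P w)) \<le> x\<^sup>2 / (1 + x)"
  using assms
proof (induction k arbitrary: x)
  case 0
  then show ?case by simp
next
  case (Suc k)
  \<comment> \<open>\<open>x\<^sup>2 / (1 + x)\<close> exceeds the sum of its values at the points \<open>p a * x\<close> by at least \<open>gap * kappa x\<close>.\<close>
  have step: "gap * kappa x + (\<Sum>a\<in>UNIV. (p a * x)\<^sup>2 / (1 + p a * x)) \<le> x\<^sup>2 / (1 + x)"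
  proof -
    have "p a * (1 - p a) * kappa x + (p a * x)\<^sup>2 / (1 + p a * x) \<le> p a * (x\<^sup>2 / (1 + x))" for a
    proof -
      have px: "0 < p a" "p a < 1" "0 < p a * x" "p a * x \<le> x"
        using p_pos[of a] p_less_1[of a] Suc.prems by auto
      have "p a * (x\<^sup>2 / (1 + x)) - (p a * x)\<^sup>2 / (1 + p a * x)
          = p a * (1 - p a) * (x\<^sup>2 / ((1 + x) * (1 + p a * x)))"
        using px(3) Suc.prems
        by (simp add: divide_simps add_pos_pos[THEN less_imp_neq, symmetric]) (simp add: algebra_simps power2_eq_square)
      moreover have "kappa x \<le> x\<^sup>2 / ((1 + x) * (1 + p a * x))"
        unfolding kappa_def power2_eq_square[of "1 + x"] using px Suc.prems
        by (intro divide_left_mono mult_left_mono mult_pos_pos add_pos_pos) auto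
      ultimately show ?thesis
        using px mult_left_mono[of "kappa x" "x\<^sup>2 / ((1 + x) * (1 + p a * x))" "p a * (1 - p a)"] by simp
    qed
    then have "(\<Sum>a\<in>UNIV. p a * (1 - p a) * kappa x + (p a * x)\<^sup>2 / (1 + p a * x)) \<le> (\<Sum>a\<in>UNIV. p a * (x\<^sup>2 / (1 + x)))"
      by (intro sum_mono)
    moreover have "(\<Sum>a\<in>UNIV. p a * (x\<^sup>2 / (1 + x))) = x\<^sup>2 / (1 + x)"
      unfolding sum_distrib_right[symmetric] by (simp add: p_sum)
    ultimately show ?thesis
      by (simp add: sum.distrib gap_def sum_distrib_right)
  qed
  have "gap * (\<Sum>w | length w < Suc k. kappa (x * P w))
      = gap * kappa x + (\<Sum>a\<in>UNIV. gap * (\<Sum>w | length w < k. kappa (p a * x * P w)))"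
    by (simp add: sum_short_words_Suc algebra_simps sum_distrib_left)
  also have "\<dots> \<le> gap * kappa x + (\<Sum>a\<in>UNIV. (p a * x)\<^sup>2 / (1 + p a * x))"
    using Suc p_pos by (intro add_left_mono sum_mono Suc.IH) auto
  also have "\<dots> \<le> x\<^sup>2 / (1 + x)" by (rule step)
  finally show ?case .
qed

lemma kappa_has_sum:
  assumes "x > 0"
  shows kappa_summable: "(\<lambda>w. kappa (x * P w)) summable_on UNIV"
    and kappa_sum_le: "(\<Sum>\<^sub>\<infinity>w. kappa (x * P w)) \<le> x\<^sup>2 / (1 + x) / gap"
proof -
  have le: "(\<Sum>w\<in>W. kappa (x * P w)) \<le> x\<^sup>2 / (1 + x) / gap" if "finite W" for W
  proof -
    have "W \<subseteq> {w. length w < Suc (Max (length ` W))}"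
      using that by (auto simp: less_Suc_eq_le)
    then have "(\<Sum>w\<in>W. kappa (x * P w)) \<le> (\<Sum>w | length w < Suc (Max (length ` W)). kappa (x * P w))"
      by (intro sum_mono2 finite_short_words) (auto simp: kappa_nonneg)
    also have "\<dots> \<le> x\<^sup>2 / (1 + x) / gap"
      using kappa_partial_sums[OF assms, of "Suc (Max (length ` W))"] gap_pos
      by (subst pos_le_divide_eq) (auto simp only: mult.commute)
    finally show ?thesis .
  qed
  show 1: "(\<lambda>w. kappa (x * P w)) summable_on UNIV"
    by (rule nonneg_bdd_above_summable_on) (auto simp: kappa_nonneg intro!: bdd_aboveI2 le)
  show "(\<Sum>\<^sub>\<infinity>w. kappa (x * P w)) \<le> x\<^sup>2 / (1 + x) / gap"
    using 1 le by (intro infsum_le_finite_sums) auto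
qed

lemma summable_of_kappa_bound:
  assumes "\<And>t. t > 0 \<Longrightarrow> \<bar>f t\<bar> \<le> C * kappa t" "x > 0"
  shows "(\<lambda>w. f (x * P w)) summable_on UNIV"
proof -
  have "(\<lambda>w. \<bar>f (x * P w)\<bar>) summable_on UNIV"
    by (rule summable_on_comparison_test[OF summable_on_cmult_right[OF kappa_summable[OF assms(2)], of C]])
       (use assms P_pos in auto)
  then show ?thesis using summable_on_iff_abs_summable_on_real by auto
qed

lemma word_sum_kappa_bound:
  assumes "\<And>t. t > 0 \<Longrightarrow> \<bar>f t\<bar> \<le> C * kappa t" "x > 0" "C \<ge> 0"
  shows "\<bar>F f x\<bar> \<le> C * (x\<^sup>2 / (1 + x) / gap)"
proof -
  have "\<bar>F f x\<bar> \<le> C * (\<Sum>\<^sub>\<infinity>w. kappa (x * P w))"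
    unfolding word_sum_def real_norm_def[symmetric]
    by (rule norm_infsum_le[OF has_sum_infsum has_sum_cmult_right[OF has_sum_infsum]])
       (use assms P_pos kappa_summable summable_of_kappa_bound[OF assms(1)] in auto)
  also have "\<dots> \<le> C * (x\<^sup>2 / (1 + x) / gap)"
    using kappa_sum_le assms by (intro mult_left_mono) auto
  finally show ?thesis .
qed

lemma word_sum_linear_bound:
  assumes "\<And>t. t > 0 \<Longrightarrow> \<bar>f t\<bar> \<le> C * kappa t" "x > 0" "C \<ge> 0"
  shows "\<bar>F f x\<bar> \<le> C / gap * x"
proof -
  have "x\<^sup>2 / (1 + x) \<le> x" using assms(2) by (simp add: divide_simps power2_eq_square algebra_simps)
  then have "C * (x\<^sup>2 / (1 + x) / gap) \<le> C * (x / gap)"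
    using gap_pos assms by (intro mult_left_mono divide_right_mono) auto
  then show ?thesis using word_sum_kappa_bound[OF assms] by simp
qed

lemma infsum_words_Cons:
  fixes g :: "'a list \<Rightarrow> real"
  assumes "g summable_on UNIV"
  shows "(\<Sum>\<^sub>\<infinity>w. g w) = g [] + (\<Sum>a\<in>UNIV. \<Sum>\<^sub>\<infinity>w. g (a # w))"
proof -
  have sub: "g summable_on A" for A using summable_on_subset[OF assms] by blast
  have "(\<Sum>\<^sub>\<infinity>w. g w) = infsum g (insert [] (\<Union>a. (#) a ` UNIV))"
    by (rule arg_cong[OF UNIV_list_eq, of "infsum g"])
  also have "\<dots> = g [] + infsum g (\<Union>a. (#) a ` UNIV)"
    by (subst infsum_insert) (auto intro: sub)
  also have "infsum g (\<Union>a. (#) a ` UNIV) = (\<Sum>a\<in>UNIV. infsum g ((#) a ` UNIV))"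
    by (subst sum_infsum) (auto intro: sub)
  also have "\<dots> = (\<Sum>a\<in>UNIV. \<Sum>\<^sub>\<infinity>w. g (a # w))"
    by (intro sum.cong refl) (subst infsum_reindex, auto simp: o_def)
  finally show ?thesis .
qed

lemma word_sum_renewal:
  assumes "\<And>t. t > 0 \<Longrightarrow> \<bar>f t\<bar> \<le> C * kappa t" "x > 0"
  shows "F f x = f x + (\<Sum>a\<in>UNIV. F f (p a * x))"
  unfolding word_sum_def using infsum_words_Cons[OF summable_of_kappa_bound[OF assms]]
  by (simp add: mult_ac)

lemma word_sum_log_lipschitz:
  assumes "tame kappa C f" "C \<ge> 0" "x > 0" "1 \<le> c" "c \<le> 2"
  shows "\<bar>F f (c * x) - F f x\<bar> \<le> C * (c - 1) / gap * x"
proof -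
  have b: "\<And>t. t > 0 \<Longrightarrow> \<bar>f t\<bar> \<le> C * kappa t" using assms(1) by (auto simp: tame_def)
  have s: "(\<lambda>w. f (x * P w)) summable_on UNIV" "(\<lambda>w. f (c * x * P w)) summable_on UNIV"
    using summable_of_kappa_bound[OF b] assms by auto
  have "F f (c * x) - F f x = (\<Sum>\<^sub>\<infinity>w. f (c * x * P w) - f (x * P w))"
    unfolding word_sum_def using infsum_diff[OF s(2,1)] by simp
  also have "\<bar>\<dots>\<bar> \<le> C * (c - 1) * (\<Sum>\<^sub>\<infinity>w. kappa (x * P w))"
    unfolding real_norm_def[symmetric]
    by (rule norm_infsum_le[OF has_sum_infsum has_sum_cmult_right[OF has_sum_infsum]])
       (use assms P_pos kappa_summable summable_on_diff[OF s(2,1)] in \<open>auto simp: tame_def mult.assoc\<close>)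
  also have "\<dots> \<le> C * (c - 1) * (x / gap)"
  proof -
    have "x\<^sup>2 / (1 + x) / gap \<le> x / gap"
      using assms(3) gap_pos by (intro divide_right_mono) (auto simp: divide_simps power2_eq_square algebra_simps)
    then have "(\<Sum>\<^sub>\<infinity>w. kappa (x * P w)) \<le> x / gap" using kappa_sum_le[OF assms(3)] by linarith
    then show ?thesis using assms by (intro mult_left_mono) auto
  qed
  finally show ?thesis by simp
qed

end

section \<open>The renewal equation on a logarithmic scale\<close>

text \<open>
  The integral of \<open>f t / t\<^sup>2\<close> over \<open>t > 0\<close>, after the substitution \<open>t = exp x\<close>. It is the Mellin
  transform of \<open>f\<close> at \<open>- 1\<close>.
\<close>

definition weight :: "(real \<Rightarrow> real) \<Rightarrow> real" where
  "weight f = (LINT x|lborel. exp (- x) * f (exp x))"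

lemma kappa_over_le:
  assumes "t > 0"
  shows "kappa t \<le> t\<^sup>2" "kappa t \<le> 1"
proof -
  have "1 \<le> (1 + t)\<^sup>2" using assms by (simp add: power2_eq_square algebra_simps)
  then show "kappa t \<le> t\<^sup>2" unfolding kappa_def
    using mult_left_mono[of 1 "(1 + t)\<^sup>2" "t\<^sup>2"] by (simp add: divide_simps)
  have "t\<^sup>2 \<le> (1 + t)\<^sup>2" using assms by (intro power_mono) auto
  then show "kappa t \<le> 1" unfolding kappa_def
    using assms by (intro divide_le_eq_1_pos[THEN iffD2]) auto
qed

lemma tame_nonneg: "tame kappa C f \<Longrightarrow> C \<ge> 0"
  using abs_ge_zero[of "f 1"] unfolding tame_def
  by (auto simp: kappa_def dest!: spec[of _ 1])

lemma abs_scaled_le: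
  assumes "tame kappa C f"
  shows "\<bar>exp (- x) * f (exp x)\<bar> \<le> C * exp (- \<bar>x\<bar>)"
proof -
  have C: "C \<ge> 0" by (rule tame_nonneg[OF assms])
  have "\<bar>exp (- x) * f (exp x)\<bar> \<le> exp (- x) * (C * kappa (exp x))"
    using assms by (simp add: tame_def abs_mult)
  moreover have "exp (- x) * kappa (exp x) \<le> exp (- \<bar>x\<bar>)"
  proof (cases "x \<ge> 0")
    case True
    then show ?thesis using kappa_over_le(2)[of "exp x"] by simp
  next
    case False
    have "exp (- x) * kappa (exp x) \<le> exp (- x) * (exp x)\<^sup>2"
      using kappa_over_le(1)[of "exp x"] by (intro mult_left_mono) auto
    also have "\<dots> = exp x" by (simp add: power2_eq_square exp_minus field_simps)
    finally show ?thesis using False by simp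
  qed
  then have "C * (exp (- x) * kappa (exp x)) \<le> C * exp (- \<bar>x\<bar>)" using C by (intro mult_left_mono)
  ultimately show ?thesis by (simp add: mult_ac)
qed

text \<open>
  A bounded solution of a renewal equation on the line cannot keep growing over steps of a fixed
  length \<open>l b\<close>: along a sequence on which the increments over \<open>l b\<close> approach their upper limit \<open>L\<close>,
  the averaging in the equation forces the increments at the shifted points to approach \<open>L\<close> as well,
  and the increments at \<open>x, x - l b, x - 2 * l b, \<dots>\<close> telescope, so that \<open>L > 0\<close> contradicts
  boundedness.
\<close>

lemma renewal_increment_le:
  fixes Z z :: "real \<Rightarrow> real" and q l :: "'a::finite \<Rightarrow> real"
  assumes q_pos: "\<And>a. q a > 0" and q_sum: "(\<Sum>a\<in>UNIV. q a) = 1"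
    and bounded: "\<And>x. \<bar>Z x\<bar> \<le> B"
    and renewal: "\<And>x. Z x = z x + (\<Sum>a\<in>UNIV. q a * Z (x - l a))"
    and z_lim: "(z \<longlongrightarrow> 0) at_top" and "e > 0"
  shows "eventually (\<lambda>x. Z x - Z (x - l b) \<le> e) at_top"
proof (rule ccontr)
  assume neg: "\<not> ?thesis"
  define D where "D x = Z x - Z (x - l b)" for x
  define \<zeta> where "\<zeta> x = z x - z (x - l b)" for x
  have shift: "filterlim (\<lambda>x. x - c) at_top at_top" for c :: real
    unfolding filterlim_at_top
  proof
    fix u :: real
    show "eventually (\<lambda>x. u \<le> x - c) at_top"
      using eventually_ge_at_top[of "u + c"] by eventually_elim simp
  qed
  have \<zeta>_lim: "(\<zeta> \<longlongrightarrow> 0) at_top"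
    unfolding \<zeta>_def using tendsto_diff[OF z_lim filterlim_compose[OF z_lim shift[of "l b"]]] by simp
  have D_eq: "D x = \<zeta> x + (\<Sum>a\<in>UNIV. q a * D (x - l a))" for x
  proof -
    have "D x = \<zeta> x + ((\<Sum>a\<in>UNIV. q a * Z (x - l a)) - (\<Sum>a\<in>UNIV. q a * Z (x - l b - l a)))"
      unfolding D_def \<zeta>_def by (subst renewal, subst renewal[of "x - l b"]) simp
    also have "(\<Sum>a\<in>UNIV. q a * Z (x - l a)) - (\<Sum>a\<in>UNIV. q a * Z (x - l b - l a)) = (\<Sum>a\<in>UNIV. q a * D (x - l a))"
      unfolding D_def sum_subtractf[symmetric] by (intro sum.cong refl) (simp add: algebra_simps)
    finally show ?thesis .
  qed
  have D_le: "D x \<le> 2 * B" "- (2 * B) \<le> D x" for x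
    unfolding D_def using bounded[of x] bounded[of "x - l b"] by linarith+
  define Ub where "Ub = {u. eventually (\<lambda>x. D x \<le> u) at_top}"
  have Ub_ge: "e \<le> u" if "u \<in> Ub" for u
  proof (rule ccontr)
    assume "\<not> e \<le> u"
    then have "eventually (\<lambda>x. D x \<le> e) at_top" using that unfolding Ub_def
      by (auto elim!: eventually_mono)
    with neg show False unfolding D_def by simp
  qed
  have Ub_ne: "2 * B \<in> Ub" unfolding Ub_def using D_le by simp
  have bdd: "bdd_below Ub" using Ub_ge by (intro bdd_belowI) auto
  define L where "L = Inf Ub"
  have L_ge: "e \<le> L" unfolding L_def using Ub_ge Ub_ne by (intro cInf_greatest) auto
  have upper: "eventually (\<lambda>x. D x \<le> L + \<epsilon>) at_top" if "\<epsilon> > 0" for \<epsilon>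
  proof -
    have "Inf Ub < L + \<epsilon>" using that L_def by simp
    then obtain u where "u \<in> Ub" "u < L + \<epsilon>" using cInf_less_iff[of Ub] bdd Ub_ne by auto
    then show ?thesis unfolding Ub_def by (auto elim!: eventually_mono)
  qed
  have "\<exists>x. x \<ge> real n \<and> D x > L - 1 / (real n + 1)" for n :: nat
  proof (rule ccontr)
    assume "\<not> ?thesis"
    then have "eventually (\<lambda>x. D x \<le> L - 1 / (real n + 1)) at_top"
      by (auto simp: eventually_at_top_linorder not_less)
    then have "L \<le> L - 1 / (real n + 1)" unfolding L_def Ub_def[symmetric]
      using cInf_lower[of _ Ub] bdd unfolding Ub_def by auto
    then show False by (simp add: field_simps)
  qed
  then obtain X where X: "\<And>n. X n \<ge> real n" "\<And>n. D (X n) > L - 1 / (real n + 1)" by metis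
  have X_lim: "filterlim X at_top sequentially"
    by (rule filterlim_at_top_mono[OF filterlim_real_sequentially]) (use X in auto)
  have step: "(\<lambda>n. D (Y n - l a)) \<longlonglongrightarrow> L"
    if Y: "filterlim Y at_top sequentially" and DY: "(\<lambda>n. D (Y n)) \<longlonglongrightarrow> L" for Y a
  proof (rule order_tendstoI)
    have up: "eventually (\<lambda>n. D (Y n - c) \<le> L + \<epsilon>) sequentially" if "\<epsilon> > 0" for c \<epsilon>
      using upper[OF that] filterlim_compose[OF shift[of c] Y] unfolding filterlim_iff by blast
    fix u
    show "eventually (\<lambda>n. D (Y n - l a) < u) sequentially" if "L < u"
      using up[of "(u - L) / 2" "l a"] that by (auto elim!: eventually_mono simp: field_simps)
    assume u: "u < L"
    define \<epsilon> where "\<epsilon> = q a * (L - u) / 4"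
    have \<epsilon>: "\<epsilon> > 0" unfolding \<epsilon>_def using u q_pos[of a] by simp
    have "eventually (\<lambda>n. \<forall>c\<in>UNIV. D (Y n - l c) \<le> L + \<epsilon>) sequentially"
      using up[OF \<epsilon>] by (intro eventually_ball_finite) auto
    moreover have "eventually (\<lambda>n. \<zeta> (Y n) < \<epsilon>) sequentially"
      using filterlim_compose[OF \<zeta>_lim Y] \<epsilon> by (rule order_tendstoD)
    moreover have "eventually (\<lambda>n. D (Y n) > L - \<epsilon>) sequentially"
      using DY \<epsilon> by (intro order_tendstoD) auto
    ultimately show "eventually (\<lambda>n. u < D (Y n - l a)) sequentially"
    proof eventually_elim
      case (elim n)
      have "(\<Sum>c\<in>UNIV - {a}. q c * D (Y n - l c)) \<le> (\<Sum>c\<in>UNIV - {a}. q c * (L + \<epsilon>))"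
        using elim q_pos by (intro sum_mono mult_left_mono) (auto intro: less_imp_le)
      also have "\<dots> = (1 - q a) * (L + \<epsilon>)"
        using q_sum by (simp add: sum_distrib_right[symmetric] sum_diff1)
      finally have "D (Y n) \<le> \<zeta> (Y n) + q a * D (Y n - l a) + (1 - q a) * (L + \<epsilon>)"
        by (subst D_eq) (simp add: sum.remove[of UNIV a])
      then have "L - \<epsilon> < \<epsilon> + q a * D (Y n - l a) + (1 - q a) * (L + \<epsilon>)" using elim by linarith
      then have "q a * D (Y n - l a) > q a * L - 3 * \<epsilon> + q a * \<epsilon>" by (simp add: algebra_simps)
      moreover have "q a * \<epsilon> > 0" using \<epsilon> q_pos by simp
      moreover have "4 * \<epsilon> = q a * L - q a * u" unfolding \<epsilon>_def by (simp add: right_diff_distrib)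
      ultimately have "q a * D (Y n - l a) > q a * u" using \<epsilon> by linarith
      then show ?case using q_pos[of a] by (simp add: mult_less_cancel_left_pos)
    qed
  qed
  have D0: "(\<lambda>n. D (X n)) \<longlonglongrightarrow> L"
  proof (rule order_tendstoI)
    fix u
    show "eventually (\<lambda>n. D (X n) < u) sequentially" if "L < u"
    proof -
      have "eventually (\<lambda>x. D x \<le> L + (u - L) / 2) at_top" using upper[of "(u - L) / 2"] that by simp
      then have "eventually (\<lambda>n. D (X n) \<le> L + (u - L) / 2) sequentially"
        using X_lim unfolding filterlim_iff by blast
      then show ?thesis using that by (auto elim!: eventually_mono simp: field_simps)
    qed
    assume "u < L"
    moreover have "(\<lambda>n. L - 1 / (real n + 1)) \<longlonglongrightarrow> L - 0"
      using LIMSEQ_inverse_real_of_nat by (intro tendsto_diff tendsto_const) (simp add: inverse_eq_divide add.commute)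
    ultimately have "eventually (\<lambda>n. u < L - 1 / (real n + 1)) sequentially"
      by (intro order_tendstoD) auto
    then show "eventually (\<lambda>n. u < D (X n)) sequentially"
      using X(2) by (auto elim!: eventually_mono intro: less_trans)
  qed
  have Dj: "filterlim (\<lambda>n. X n - real j * l b) at_top sequentially \<and> (\<lambda>n. D (X n - real j * l b)) \<longlonglongrightarrow> L" for j
  proof (induction j)
    case 0
    then show ?case using X_lim D0 by simp
  next
    case (Suc j)
    have "(\<lambda>n. D (X n - real j * l b - l b)) \<longlonglongrightarrow> L" using Suc by (intro step) auto
    moreover have "filterlim (\<lambda>n. X n - real (Suc j) * l b) at_top sequentially"
      by (rule filterlim_compose[OF shift X_lim])
    ultimately show ?case by (simp add: algebra_simps)
  qed
  obtain k :: nat where k: "real k * e > 2 * B"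
    using \<open>e > 0\<close> reals_Archimedean3 by blast
  have tele: "(\<Sum>j<k. D (X n - real j * l b)) = Z (X n) - Z (X n - real k * l b)" for n k
    by (induction k) (auto simp: D_def algebra_simps)
  have "(\<lambda>n. \<Sum>j<k. D (X n - real j * l b)) \<longlonglongrightarrow> (\<Sum>j<k. L)"
    using Dj by (intro tendsto_sum) auto
  then have "(\<lambda>n. Z (X n) - Z (X n - real k * l b)) \<longlonglongrightarrow> real k * L"
    by (simp add: tele)
  moreover have "Z (X n) - Z (X n - real k * l b) \<le> 2 * B" for n
    using bounded[of "X n"] bounded[of "X n - real k * l b"] by linarith
  ultimately have "real k * L \<le> 2 * B"
    by (intro LIMSEQ_le_const2) auto
  moreover have "real k * e \<le> real k * L" using L_ge by (intro mult_left_mono) auto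
  ultimately show False using k by linarith
qed

lemma renewal_increment_tendsto:
  fixes Z z :: "real \<Rightarrow> real" and q l :: "'a::finite \<Rightarrow> real"
  assumes q_pos: "\<And>a. q a > 0" and q_sum: "(\<Sum>a\<in>UNIV. q a) = 1"
    and bounded: "\<And>x. \<bar>Z x\<bar> \<le> B"
    and renewal: "\<And>x. Z x = z x + (\<Sum>a\<in>UNIV. q a * Z (x - l a))"
    and z_lim: "(z \<longlongrightarrow> 0) at_top"
  shows "((\<lambda>x. Z x - Z (x - l b)) \<longlongrightarrow> 0) at_top"
proof (rule tendstoI)
  fix e :: real assume "e > 0"
  then have e: "e / 2 > 0" by simp
  have "eventually (\<lambda>x. Z x - Z (x - l b) \<le> e / 2) at_top"
    by (rule renewal_increment_le[OF assms e])
  moreover have "eventually (\<lambda>x. - Z x - - Z (x - l b) \<le> e / 2) at_top"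
  proof (rule renewal_increment_le[where z = "\<lambda>x. - z x" and q = q and l = l and B = B, OF q_pos q_sum _ _ _ e])
    show "- Z x = - z x + (\<Sum>a\<in>UNIV. q a * - Z (x - l a))" for x
      by (subst renewal) (simp add: sum_negf)
    show "((\<lambda>x. - z x) \<longlongrightarrow> 0) at_top" using tendsto_minus[OF z_lim] by simp
  qed (simp add: bounded)
  ultimately show "eventually (\<lambda>x. dist (Z x - Z (x - l b)) 0 < e) at_top"
    by eventually_elim (use \<open>e > 0\<close> in \<open>simp add: dist_real_def abs_less_iff\<close>)
qed

lemma continuous_shifted_integral_diff:
  fixes Z :: "real \<Rightarrow> real"
  assumes Z: "continuous_on UNIV Z" and "l \<ge> 0" "y \<ge> 0"
  shows "integral {-y..y} Z - integral {-y..y} (\<lambda>s. Z (s - l))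
       = integral {-l..0} (\<lambda>t. Z (y + t)) - integral {-l..0} (\<lambda>t. Z (- y + t))"
proof -
  have int: "Z integrable_on {a..b}" for a b
    by (intro integrable_continuous_interval continuous_on_subset[OF Z]) auto
  have sh: "integral {a..b} (\<lambda>t. Z (c + t)) = integral {a + c..b + c} Z" for a b c
    using integral_shift_Icc_real[of a b Z c] by (simp add: o_def)
  have "integral {-y..y} (\<lambda>s. Z (s - l)) = integral {-y - l..y - l} Z"
    using sh[of "-y" y "-l"] by simp
  moreover have "integral {-y - l..- y} Z + integral {-y..y} Z = integral {-y - l..y} Z"
    "integral {-y - l..y - l} Z + integral {y - l..y} Z = integral {-y - l..y} Z"
    using assms int by (auto intro!: Henstock_Kurzweil_Integration.integral_combine)
  moreover have "integral {-l..0} (\<lambda>t. Z (y + t)) = integral {y - l..y} Z"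
    "integral {-l..0} (\<lambda>t. Z (- y + t)) = integral {- y - l..- y} Z"
    unfolding sh by (auto simp: algebra_simps intro!: arg_cong2[where f = integral])
  ultimately show ?thesis by linarith
qed

context letter_probs
begin

abbreviation l :: "'a \<Rightarrow> real" where "l a \<equiv> - ln (p a)"

text \<open>
  In terms of \<open>Z\<close> the recursion of word sums is a convolution equation with the probability
  weights \<open>p a\<close> at the steps \<open>l a\<close>.
\<close>

definition Z :: "(real \<Rightarrow> real) \<Rightarrow> real \<Rightarrow> real" where
  "Z f x = exp (- x) * F f (exp x)"

abbreviation z :: "(real \<Rightarrow> real) \<Rightarrow> real \<Rightarrow> real" where
  "z f x \<equiv> exp (- x) * f (exp x)"

lemma l_pos: "l a > 0"
  using p_pos[of a] p_less_1[of a] by simp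

lemma sum_p_l: "(\<Sum>a\<in>UNIV. p a * l a) = source_entropy p"
  by (simp add: source_entropy_def sum_negf)

lemma source_entropy_pos: "source_entropy p > 0"
  unfolding sum_p_l[symmetric] by (intro sum_pos mult_pos_pos l_pos p_pos) auto

context
  fixes f :: "real \<Rightarrow> real" and C :: real
  assumes tame: "tame kappa C f"
begin

lemma f_le: "t > 0 \<Longrightarrow> \<bar>f t\<bar> \<le> C * kappa t"
  using tame by (simp add: tame_def)

lemma C_nonneg: "C \<ge> 0"
  by (rule tame_nonneg[OF tame])

lemma Z_renewal: "Z f x = z f x + (\<Sum>a\<in>UNIV. p a * Z f (x - l a))"
proof -
  have "p a * Z f (x - l a) = exp (- x) * F f (p a * exp x)" for a
    using p_pos[of a] by (simp add: Z_def exp_add exp_minus mult_ac exp_diff field_simps)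
  then show ?thesis
    unfolding Z_def using word_sum_renewal[OF f_le, of "exp x"]
    by (simp add: algebra_simps sum_distrib_left)
qed

lemma Z_bounded: "\<bar>Z f x\<bar> \<le> C / gap"
proof -
  have "\<bar>Z f x\<bar> \<le> exp (- x) * (C / gap * exp x)"
    unfolding Z_def abs_mult using mult_left_mono[OF word_sum_linear_bound[OF f_le _ C_nonneg, of "exp x"], of "exp (- x)"]
    by simp
  then show ?thesis by (simp add: exp_minus field_simps)
qed

lemma Z_le_exp: "\<bar>Z f x\<bar> \<le> C / gap * exp x"
proof -
  have "\<bar>F f (exp x)\<bar> \<le> C * ((exp x)\<^sup>2 / (1 + exp x) / gap)"
    using word_sum_kappa_bound[OF f_le _ C_nonneg, of "exp x"] by simp
  also have "\<dots> \<le> C * ((exp x)\<^sup>2 / gap)"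
  proof (intro mult_left_mono divide_right_mono C_nonneg)
    show "(exp x)\<^sup>2 / (1 + exp x) \<le> (exp x)\<^sup>2"
      using divide_left_mono[of 1 "1 + exp x" "(exp x)\<^sup>2"] by (simp add: add_pos_pos)
  qed (use gap_pos in auto)
  finally have "exp (- x) * \<bar>F f (exp x)\<bar> \<le> exp (- x) * (C * ((exp x)\<^sup>2 / gap))"
    by (intro mult_left_mono) auto
  also have "\<dots> = C / gap * exp x" by (simp add: power2_eq_square exp_minus field_simps)
  finally show ?thesis by (simp add: Z_def abs_mult)
qed

lemma Z_lipschitz: "\<bar>Z f x - Z f y\<bar> \<le> 4 * C / gap * \<bar>x - y\<bar>"
proof -
  have main: "\<bar>Z f (x + \<delta>) - Z f x\<bar> \<le> 4 * C / gap * \<delta>" if "\<delta> \<ge> 0" for x \<delta>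
  proof (cases "\<delta> \<le> ln 2")
    case True
    define c where "c = exp \<delta>"
    have c: "1 \<le> c" "c \<le> 2" using that True unfolding c_def
      by (auto simp: ln_ge_iff)
    have inv: "1 - inverse c \<le> \<delta>" unfolding c_def exp_minus[symmetric] using exp_ge_add_one_self[of "- \<delta>"] by simp
    have "c - 1 = c * (1 - inverse c)" using c by (simp add: field_simps)
    also have "\<dots> \<le> 2 * \<delta>" using inv c that by (intro mult_mono) (auto simp: inverse_le_1_iff)
    finally have c1: "c - 1 \<le> 2 * \<delta>" .
    have "Z f (x + \<delta>) - Z f x = exp (- x) * (inverse c * (F f (c * exp x) - F f (exp x)) - (1 - inverse c) * F f (exp x))"
      unfolding Z_def c_def by (simp add: exp_add exp_minus exp_diff field_simps)
    also have "\<bar>\<dots>\<bar> \<le> exp (- x) * (1 * \<bar>F f (c * exp x) - F f (exp x)\<bar> + \<bar>1 - inverse c\<bar> * \<bar>F f (exp x)\<bar>)"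
    proof -
      have "inverse c * \<bar>F f (c * exp x) - F f (exp x)\<bar> \<le> 1 * \<bar>F f (c * exp x) - F f (exp x)\<bar>"
        using c by (intro mult_right_mono) (auto simp: inverse_le_1_iff)
      then show ?thesis unfolding abs_mult
        using c by (intro mult_mono order_trans[OF abs_triangle_ineq4] add_mono) (auto simp: abs_mult)
    qed
    also have "\<dots> \<le> exp (- x) * (1 * (C * (c - 1) / gap * exp x) + \<delta> * (C / gap * exp x))"
    proof (intro mult_left_mono add_mono mult_mono)
      show "\<bar>1 - inverse c\<bar> \<le> \<delta>" using inv c by (simp add: inverse_le_1_iff)
      show "\<bar>F f (exp x)\<bar> \<le> C / gap * exp x" by (rule word_sum_linear_bound[OF f_le _ C_nonneg]) auto
      show "\<bar>F f (c * exp x) - F f (exp x)\<bar> \<le> C * (c - 1) / gap * exp x"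
        by (rule word_sum_log_lipschitz[OF tame C_nonneg _ c]) simp
    qed (use that in auto)
    also have "\<dots> = C / gap * (c - 1 + \<delta>) * (exp (- x) * exp x)"
      by (simp add: algebra_simps add_divide_distrib diff_divide_distrib)
    also have "\<dots> = C / gap * (c - 1 + \<delta>)" by (simp add: exp_minus)
    also have "\<dots> \<le> C / gap * (4 * \<delta>)"
      using c1 that C_nonneg gap_pos by (intro mult_left_mono) auto
    finally show ?thesis by (simp add: mult_ac)
  next
    case False
    then have "1 / 2 \<le> \<delta>" using ln2_ge_two_thirds by simp
    then have "C / gap * 2 \<le> C / gap * (4 * \<delta>)" using C_nonneg gap_pos by (intro mult_left_mono) auto
    then have "C / gap + C / gap \<le> 4 * C / gap * \<delta>" by (simp add: mult_ac)
    then show ?thesis using Z_bounded[of "x + \<delta>"] Z_bounded[of x] by linarith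
  qed
  show ?thesis
  proof (cases "x \<ge> y")
    case True
    then show ?thesis using main[of "x - y" y] by simp
  next
    case False
    then show ?thesis using main[of "y - x" x] by (simp add: abs_minus_commute)
  qed
qed

lemma Z_continuous: "continuous_on UNIV (Z f)"
proof -
  have "lipschitz_on (4 * C / gap) UNIV (Z f)"
    using Z_lipschitz C_nonneg gap_pos by (intro lipschitz_onI) (auto simp: dist_real_def)
  then show ?thesis by (rule lipschitz_on_continuous_on)
qed

lemma z_continuous: "continuous_on UNIV (z f)"
proof -
  have "continuous_on UNIV (\<lambda>x. Z f x - (\<Sum>a\<in>UNIV. p a * Z f (x - l a)))"
    by (intro continuous_intros continuous_on_compose2[OF Z_continuous]) auto
  moreover have "Z f x - (\<Sum>a\<in>UNIV. p a * Z f (x - l a)) = z f x" for x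
    using Z_renewal[of x] by linarith
  ultimately show ?thesis by simp
qed

lemma z_dominated: "\<bar>z f x\<bar> \<le> 2 * C * inverse (1 + x\<^sup>2)"
proof -
  have "1 + \<bar>x\<bar> + \<bar>x\<bar>\<^sup>2 / 2 \<le> exp \<bar>x\<bar>" by (rule exp_lower_Taylor_quadratic) simp
  then have "(1 + x\<^sup>2) / 2 \<le> exp \<bar>x\<bar>" by (simp add: field_simps)
  then have "exp (- \<bar>x\<bar>) \<le> 2 * inverse (1 + x\<^sup>2)"
    by (simp add: exp_minus field_simps add_pos_nonneg)
  then have "C * exp (- \<bar>x\<bar>) \<le> C * (2 * inverse (1 + x\<^sup>2))"
    using C_nonneg by (intro mult_left_mono)
  then show ?thesis using abs_scaled_le[OF tame, of x] by simp
qed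

lemma z_integrable: "integrable lborel (z f)"
proof (rule Bochner_Integration.integrable_bound)
  show "integrable lborel (\<lambda>x. 2 * C * inverse (1 + x\<^sup>2))"
    using integrable_inverse_1_plus_square by (simp add: set_integrable_def einterval_def)
  show "z f \<in> borel_measurable lborel"
    using z_continuous by (simp add: borel_measurable_continuous_onI)
  show "AE x in lborel. norm (z f x) \<le> norm (2 * C * inverse (1 + x\<^sup>2))"
    using z_dominated C_nonneg by (intro AE_I2) (auto intro: order_trans[OF _ abs_ge_self])
qed

lemma z_integral_tendsto: "((\<lambda>y. integral {-y..y} (z f)) \<longlongrightarrow> weight f) at_top"
proof -
  have "((\<lambda>y. LINT x|lborel. indicator {-y..y} x * z f x) \<longlongrightarrow> (LINT x|lborel. z f x)) at_top"
  proof (rule integral_dominated_convergence_at_top)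
    show "integrable lborel (\<lambda>x. \<bar>z f x\<bar>)" using z_integrable by (rule integrable_abs)
    show "AE x in lborel. ((\<lambda>y. indicator {-y..y} x * z f x) \<longlongrightarrow> z f x) at_top"
    proof (rule AE_I2, rule tendsto_eventually)
      fix x
      show "eventually (\<lambda>y. indicator {-y..y} x * z f x = z f x) at_top"
        using eventually_ge_at_top[of "\<bar>x\<bar>"] by eventually_elim (auto simp: indicator_def)
    qed
    show "eventually (\<lambda>y. AE x in lborel. norm (indicator {-y..y} x * z f x) \<le> \<bar>z f x\<bar>) at_top"
      by (intro always_eventually allI AE_I2) (auto simp: indicator_def)
  qed (use z_integrable in auto)
  moreover have "(LINT x|lborel. indicator {-y..y} x * z f x) = integral {-y..y} (z f)" for y
    using set_borel_integral_eq_integral(2)[OF borel_integrable_atLeastAtMost'[OF continuous_on_subset[OF z_continuous]], of "-y" y]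
    by (simp add: set_lebesgue_integral_def)
  ultimately show ?thesis by (simp add: weight_def)
qed

text \<open>
  Integrating the renewal equation over \<open>{-y..y}\<close> leaves boundary terms only. The lower ones
  vanish in the limit because \<open>Z f x\<close> is at most of order \<open>exp x\<close>.
\<close>

lemma Z_window_integrals:
  "((\<lambda>y. \<Sum>a\<in>UNIV. p a * integral {- l a..0} (\<lambda>t. Z f (y + t))) \<longlongrightarrow> weight f) at_top"
proof -
  have ci: "continuous_on A (\<lambda>x. Z f (g x))" if "continuous_on A g" for A g
    by (rule continuous_on_compose2[OF Z_continuous that]) auto
  define R where "R y = (\<Sum>a\<in>UNIV. p a * integral {- l a..0} (\<lambda>t. Z f (- y + t)))" for y
  have R_lim: "(R \<longlongrightarrow> (\<Sum>a\<in>UNIV. p a * 0)) at_top"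
    unfolding R_def
  proof (intro tendsto_sum tendsto_mult tendsto_const)
    fix a
    have "\<bar>integral {- l a..0} (\<lambda>t. Z f (- y + t))\<bar> \<le> C / gap * exp (- y) * (0 - - l a)" for y
    proof -
      have "norm (integral {- l a..0} (\<lambda>t. Z f (- y + t))) \<le> C / gap * exp (- y) * (0 - - l a)"
      proof (rule integral_bound)
        show "norm (Z f (- y + t)) \<le> C / gap * exp (- y)" if "t \<in> {- l a..0}" for t
        proof -
          have "C / gap * exp (- y + t) \<le> C / gap * exp (- y)"
            using that C_nonneg gap_pos by (intro mult_left_mono) auto
          then show ?thesis using Z_le_exp[of "- y + t"] by simp
        qed
      qed (use l_pos[of a] in \<open>auto intro!: ci continuous_intros\<close>)
      then show ?thesis by simp
    qed
    then have b: "norm (integral {- l a..0} (\<lambda>t. Z f (- y + t))) \<le> C / gap * (0 - - l a) * exp (- y)" for y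
      by (simp add: mult_ac)
    have "((\<lambda>y. C / gap * (0 - - l a) * exp (- y)) \<longlongrightarrow> C / gap * (0 - - l a) * 0) at_top"
      by (intro tendsto_intros filterlim_compose[OF exp_at_bot filterlim_uminus_at_bot_at_top])
    then show "((\<lambda>y. integral {- l a..0} (\<lambda>t. Z f (- y + t))) \<longlongrightarrow> 0) at_top"
      by (intro Lim_null_comparison[OF always_eventually[OF allI[OF b]]]) simp
  qed
  have "eventually (\<lambda>y. integral {-y..y} (z f) + R y = (\<Sum>a\<in>UNIV. p a * integral {- l a..0} (\<lambda>t. Z f (y + t)))) at_top"
    using eventually_ge_at_top[of 0]
  proof eventually_elim
    case (elim y)
    have "integral {-y..y} (z f) = integral {-y..y} (\<lambda>x. \<Sum>a\<in>UNIV. p a * (Z f x - Z f (x - l a)))"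
    proof (rule arg_cong[where f = "integral _"], rule ext)
      fix x
      have "(\<Sum>a\<in>UNIV. p a * (Z f x - Z f (x - l a))) = (\<Sum>a\<in>UNIV. p a) * Z f x - (\<Sum>a\<in>UNIV. p a * Z f (x - l a))"
        by (simp add: right_diff_distrib sum_subtractf sum_distrib_right)
      then show "z f x = (\<Sum>a\<in>UNIV. p a * (Z f x - Z f (x - l a)))"
        using Z_renewal[of x] by (simp add: p_sum)
    qed
    also have "\<dots> = (\<Sum>a\<in>UNIV. p a * (integral {-y..y} (Z f) - integral {-y..y} (\<lambda>x. Z f (x - l a))))"
      by (subst integral_sum) (auto intro!: integrable_continuous_interval continuous_intros ci
          sum.cong arg_cong2[where f = "(*)"] Henstock_Kurzweil_Integration.integral_diff)
    also have "\<dots> = (\<Sum>a\<in>UNIV. p a * integral {- l a..0} (\<lambda>t. Z f (y + t))) - R y"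
      unfolding R_def sum_subtractf[symmetric]
      using continuous_shifted_integral_diff[OF Z_continuous less_imp_le[OF l_pos] elim]
      by (intro sum.cong refl) (simp add: right_diff_distrib[symmetric] del: minus_minus)
    finally show ?case by simp
  qed
  moreover have "((\<lambda>y. integral {-y..y} (z f) + R y) \<longlongrightarrow> weight f + 0) at_top"
    using R_lim by (intro tendsto_add z_integral_tendsto) simp
  ultimately show ?thesis by (simp add: filterlim_cong)
qed

lemma z_tendsto_0: "(z f \<longlongrightarrow> 0) at_top"
proof -
  have "((\<lambda>x. C * exp (- x)) \<longlongrightarrow> C * 0) at_top"
    by (intro tendsto_intros filterlim_compose[OF exp_at_bot filterlim_uminus_at_bot_at_top])
  moreover have "eventually (\<lambda>x. norm (z f x) \<le> C * exp (- x)) at_top"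
    using eventually_ge_at_top[of 0]
  proof eventually_elim
    case (elim x)
    then show ?case using abs_scaled_le[OF tame, of x] by simp
  qed
  ultimately show ?thesis by (intro Lim_null_comparison[of "z f"]) auto
qed

text \<open>
  Increments of \<open>Z f\<close> over the steps \<open>l a\<close> die out, hence also those over all elements of the group
  that the steps generate. An irrational ratio of two steps makes this group dense.
\<close>

lemma Z_increment_tendsto_of_dense:
  assumes "\<not> periodic_probs p"
  shows "((\<lambda>y. Z f (y + t) - Z f y) \<longlongrightarrow> 0) at_top"
proof -
  obtain a b where "ln (p a) / ln (p b) \<notin> \<rat>"
    using assms by (auto simp: periodic_probs_def)
  then have irr: "l a / l b \<notin> \<rat>" by simp
  define S where "S = {t. ((\<lambda>y. Z f (y + t) - Z f y) \<longlongrightarrow> 0) at_top}"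
  have shift: "filterlim (\<lambda>x. x + c) at_top at_top" for c :: real
    unfolding filterlim_at_top
  proof
    fix u :: real
    show "eventually (\<lambda>x. u \<le> x + c) at_top"
      using eventually_ge_at_top[of "u - c"] by eventually_elim simp
  qed
  have S_minus: "- t \<in> S" if "t \<in> S" for t
  proof -
    have "((\<lambda>y. Z f (y + - t + t) - Z f (y + - t)) \<longlongrightarrow> 0) at_top"
      using that filterlim_compose[OF _ shift[of "- t"]] unfolding S_def by fast
    from tendsto_minus[OF this] show ?thesis unfolding S_def by simp
  qed
  have S_add: "t + u \<in> S" if "t \<in> S" "u \<in> S" for t u
  proof -
    have "((\<lambda>y. Z f (y + t + u) - Z f (y + t)) \<longlongrightarrow> 0) at_top"
      using that filterlim_compose[OF _ shift[of t]] unfolding S_def by fast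
    moreover have "((\<lambda>y. Z f (y + t) - Z f y) \<longlongrightarrow> 0) at_top" using that unfolding S_def by simp
    ultimately have "((\<lambda>y. (Z f (y + t + u) - Z f (y + t)) + (Z f (y + t) - Z f y)) \<longlongrightarrow> 0 + 0) at_top"
      by (rule tendsto_add)
    then show ?thesis unfolding S_def by (simp add: add.assoc)
  qed
  have S_l: "l c \<in> S" for c
  proof -
    have "((\<lambda>y. Z f y - Z f (y - l c)) \<longlongrightarrow> 0) at_top"
      by (rule renewal_increment_tendsto[OF p_pos p_sum Z_bounded Z_renewal z_tendsto_0])
    from tendsto_minus[OF this] have "- l c \<in> S" unfolding S_def by simp
    from S_minus[OF this] show ?thesis by simp
  qed
  have S_0: "0 \<in> S" unfolding S_def by simp
  have S_nat: "real k * t \<in> S" if "t \<in> S" for k t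
    using that S_0 S_add by (induction k) (auto simp: algebra_simps)
  have S_int: "of_int j * t \<in> S" if "t \<in> S" for j t
  proof (cases "j \<ge> 0")
    case True
    then show ?thesis using S_nat[OF that, of "nat j"] by simp
  next
    case False
    then show ?thesis using S_minus[OF S_nat[OF that, of "nat (- j)"]] by simp
  qed
  \<comment> \<open>By Kronecker's theorem \<open>S\<close> is dense; the Lipschitz bound makes it everything.\<close>
  have close: "\<exists>u\<in>S. \<bar>t - u\<bar> < e" if "e > 0" for e
  proof -
    have "e / l b > 0" by (rule divide_pos_pos[OF that l_pos])
    then obtain k where k: "\<bar>frac (real k * (l a / l b)) - frac (t / l b)\<bar> < e / l b"
      using Kronecker_approx_1_explicit[OF irr, of "frac (t / l b)" "e / l b"]
      by (auto simp: less_imp_le[OF frac_lt_1])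
    define j where "j = \<lfloor>real k * (l a / l b)\<rfloor> - \<lfloor>t / l b\<rfloor>"
    define u where "u = real k * l a + of_int (- j) * l b"
    have uS: "u \<in> S" unfolding u_def by (intro S_add S_nat S_int S_l)
    have "t - u = l b * (frac (t / l b) - frac (real k * (l a / l b)))"
      using l_pos[of b] unfolding u_def j_def frac_def by (simp add: field_simps)
    then have "\<bar>t - u\<bar> = l b * \<bar>frac (real k * (l a / l b)) - frac (t / l b)\<bar>"
      using l_pos[of b] by (simp add: abs_mult abs_minus_commute)
    also have "\<dots> < l b * (e / l b)" by (rule mult_strict_left_mono[OF k l_pos])
    also have "\<dots> = e" using l_pos[of b] by simp
    finally have "\<bar>t - u\<bar> < e" .
    with uS show ?thesis by blast
  qed
  show ?thesis
  proof (rule tendstoI)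
    fix e :: real assume e: "e > 0"
    define K where "K = 4 * C / gap + 1"
    have K: "K > 0" unfolding K_def using C_nonneg gap_pos by (simp add: add_nonneg_pos)
    obtain u where u: "u \<in> S" "\<bar>t - u\<bar> < e / (2 * K)" using close[of "e / (2 * K)"] e K by auto
    have small: "\<bar>Z f (y + t) - Z f (y + u)\<bar> \<le> e / 2" for y
    proof -
      have "\<bar>Z f (y + t) - Z f (y + u)\<bar> \<le> 4 * C / gap * \<bar>t - u\<bar>" using Z_lipschitz[of "y + t" "y + u"] by simp
      also have "\<dots> \<le> K * (e / (2 * K))" using u K by (intro mult_mono) (auto simp: K_def)
      finally show ?thesis using K by simp
    qed
    have "eventually (\<lambda>y. dist (Z f (y + u) - Z f y) 0 < e / 2) at_top"
      using u(1) e unfolding S_def by (intro tendstoD) auto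
    then show "eventually (\<lambda>y. dist (Z f (y + t) - Z f y) 0 < e) at_top"
    proof eventually_elim
      case (elim y)
      then have "\<bar>Z f (y + u) - Z f y\<bar> < e / 2" by (simp add: dist_real_def)
      with small[of y] have "\<bar>Z f (y + t) - Z f y\<bar> < e" by linarith
      then show ?case by (simp add: dist_real_def)
    qed
  qed
qed

text \<open>
  Far out, \<open>Z f\<close> is nearly constant on windows of bounded length, so each window integral in
  \<open>Z_window_integrals\<close> is close to \<open>l a\<close> times a value of \<open>Z f\<close>. The averaged window length is the entropy.
\<close>

lemma Z_tendsto_of_aperiodic:
  assumes "\<not> periodic_probs p"
  shows "(Z f \<longlongrightarrow> weight f / source_entropy p) at_top"
proof -
  have ci: "continuous_on A (\<lambda>x. Z f (g x))" if "continuous_on A g" for A g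
    by (rule continuous_on_compose2[OF Z_continuous that]) auto
  have int: "(\<lambda>t. Z f (y + t)) integrable_on {- l a..0}" for y a
    by (intro integrable_continuous_interval ci continuous_intros)
  have "((\<lambda>y. integral {- l a..0} (\<lambda>t. Z f (y + t)) - l a * Z f y) \<longlongrightarrow> 0) at_top" for a
  proof -
    have "((\<lambda>y. LINT t|lborel. indicator {- l a..0} t * (Z f (y + t) - Z f y)) \<longlongrightarrow> (LINT t::real|lborel. 0)) at_top"
    proof (rule integral_dominated_convergence_at_top)
      show "integrable lborel (\<lambda>t. indicator {- l a..0} t * (2 * C / gap))"
        using borel_integrable_atLeastAtMost'[of "- l a" 0 "\<lambda>_. 2 * C / gap"] by (simp add: set_integrable_def)
      show "AE t in lborel. ((\<lambda>y. indicator {- l a..0} t * (Z f (y + t) - Z f y)) \<longlongrightarrow> 0) at_top"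
        by (intro AE_I2 tendsto_mult_right_zero Z_increment_tendsto_of_dense assms)
      show "eventually (\<lambda>y. AE t in lborel. norm (indicator {- l a..0} t * (Z f (y + t) - Z f y)) \<le> indicator {- l a..0} t * (2 * C / gap)) at_top"
      proof (intro always_eventually allI AE_I2)
        fix y t
        show "norm (indicator {- l a..0} t * (Z f (y + t) - Z f y)) \<le> indicator {- l a..0} t * (2 * C / gap)"
          using Z_bounded[of "y + t"] Z_bounded[of y] by (auto simp: indicator_def)
      qed
      show "(\<lambda>t. indicator {- l a..0} t * (Z f (y + t) - Z f y)) \<in> borel_measurable lborel" for y
        using borel_measurable_continuous_onI[OF ci[of UNIV "\<lambda>t. y + t"]] continuous_on_add[OF continuous_on_const continuous_on_id, of UNIV y]
        by (auto intro!: borel_measurable_times borel_measurable_diff)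
    qed auto
    moreover have "(LINT t|lborel. indicator {- l a..0} t * (Z f (y + t) - Z f y)) = integral {- l a..0} (\<lambda>t. Z f (y + t)) - l a * Z f y" for y
    proof -
      have "(LINT t|lborel. indicator {- l a..0} t * (Z f (y + t) - Z f y)) = integral {- l a..0} (\<lambda>t. Z f (y + t) - Z f y)"
        using set_borel_integral_eq_integral(2)[OF borel_integrable_atLeastAtMost'[of "- l a" 0 "\<lambda>t. Z f (y + t) - Z f y"]]
        by (simp add: set_lebesgue_integral_def ci continuous_intros)
      also have "\<dots> = integral {- l a..0} (\<lambda>t. Z f (y + t)) - l a * Z f y"
        using l_pos[of a] int[of y a] by (subst Henstock_Kurzweil_Integration.integral_diff) auto
      finally show ?thesis .
    qed
    ultimately show ?thesis by simp
  qed
  then have "((\<lambda>y. \<Sum>a\<in>UNIV. p a * (integral {- l a..0} (\<lambda>t. Z f (y + t)) - l a * Z f y)) \<longlongrightarrow> (\<Sum>a\<in>UNIV. p a * 0)) at_top"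
    by (intro tendsto_sum tendsto_mult tendsto_const)
  moreover have "(\<Sum>a\<in>UNIV. p a * (integral {- l a..0} (\<lambda>t. Z f (y + t)) - l a * Z f y))
      = (\<Sum>a\<in>UNIV. p a * integral {- l a..0} (\<lambda>t. Z f (y + t))) - source_entropy p * Z f y" for y
    unfolding sum_p_l[symmetric] by (simp only: right_diff_distrib sum_subtractf sum_distrib_right mult.assoc)
  ultimately have "((\<lambda>y. (\<Sum>a\<in>UNIV. p a * integral {- l a..0} (\<lambda>t. Z f (y + t))) - source_entropy p * Z f y) \<longlongrightarrow> 0) at_top"
    by simp
  from tendsto_diff[OF Z_window_integrals this]
  have "((\<lambda>y. source_entropy p * Z f y) \<longlongrightarrow> weight f) at_top" by simp
  from tendsto_divide[OF this tendsto_const[of "source_entropy p"]] show ?thesis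
    using source_entropy_pos by simp
qed

theorem word_sum_aperiodic:
  assumes "\<not> periodic_probs p"
  shows "((\<lambda>x. F f x / x) \<longlongrightarrow> weight f / source_entropy p) at_top"
proof -
  have "((\<lambda>x. Z f (ln x)) \<longlongrightarrow> weight f / source_entropy p) at_top"
    by (rule filterlim_compose[OF Z_tendsto_of_aperiodic[OF assms] ln_at_top])
  moreover have "eventually (\<lambda>x. Z f (ln x) = F f x / x) at_top"
    using eventually_gt_at_top[of 0] by eventually_elim (simp add: Z_def exp_minus field_simps)
  ultimately show ?thesis by (simp add: filterlim_cong)
qed

end

end

section \<open>Exponential convergence in the lattice case\<close>

text \<open>
  Contraction by \<open>1 - \<eta>\<close> in every \<open>N\<close> steps would yield the rate \<open>root N (1 - \<eta>)\<close>. Giving away half of \<open>\<eta>\<close>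
  pays for the inhomogeneous term, unless the latter decays more slowly and dictates the rate.
\<close>

lemma exponential_decay_of_contraction:
  fixes \<Delta> :: "nat \<Rightarrow> real"
  assumes "0 < \<eta>" "\<eta> \<le> 1" "0 < \<theta>" "\<theta> < 1" "0 < N" "A \<ge> 0"
    and bound: "\<And>n. \<Delta> n \<le> B"
    and step: "\<And>n. \<Delta> (n + N) \<le> (1 - \<eta>) * \<Delta> n + A * \<theta> ^ n"
  defines "\<rho> \<equiv> max \<theta> (root N (1 - \<eta> / 2))"
  shows "\<Delta> n \<le> max (B / \<rho> ^ N) (2 * A / \<eta>) * \<rho> ^ n"
proof -
  define K where "K = max (B / \<rho> ^ N) (2 * A / \<eta>)"
  have \<rho>: "0 < \<rho>" "\<rho> \<le> 1" "\<theta> \<le> \<rho>"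
    using assms by (auto simp: \<rho>_def real_root_le_1_iff)
  have \<rho>N: "1 - \<eta> / 2 \<le> \<rho> ^ N"
  proof -
    have "1 - \<eta> / 2 = root N (1 - \<eta> / 2) ^ N" using assms by simp
    also have "\<dots> \<le> \<rho> ^ N" using assms by (intro power_mono) (auto simp: \<rho>_def)
    finally show ?thesis .
  qed
  have K0: "K \<ge> 0" unfolding K_def using assms by (intro max.coboundedI2) auto
  have "\<Delta> n \<le> K * \<rho> ^ n" for n
  proof (induction n rule: less_induct)
    case (less n)
    show ?case
    proof (cases "n < N")
      case True
      have "\<Delta> n \<le> B / \<rho> ^ N * \<rho> ^ N" using bound[of n] \<rho> by simp
      also have "\<dots> \<le> K * \<rho> ^ N" unfolding K_def using \<rho> by (intro mult_right_mono) auto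
      also have "\<dots> \<le> K * \<rho> ^ n" using True \<rho> K0 by (intro mult_left_mono power_decreasing) auto
      finally show ?thesis .
    next
      case False
      define m where "m = n - N"
      have n: "n = m + N" using False by (simp add: m_def)
      have "\<Delta> n \<le> (1 - \<eta>) * (K * \<rho> ^ m) + A * \<theta> ^ m"
        unfolding n using step[of m] less[of m] n \<open>0 < N\<close> assms(2)
          mult_left_mono[of "\<Delta> m" "K * \<rho> ^ m" "1 - \<eta>"] by linarith
      also have "A * \<theta> ^ m \<le> (K * \<eta> / 2) * \<rho> ^ m"
      proof (intro mult_mono power_mono)
        have "2 * A / \<eta> \<le> K" unfolding K_def by simp
        then show "A \<le> K * \<eta> / 2" using assms(1) by (simp add: field_simps)
      qed (use \<rho> assms K0 in auto)
      also have "(1 - \<eta>) * (K * \<rho> ^ m) + (K * \<eta> / 2) * \<rho> ^ m = K * \<rho> ^ m * (1 - \<eta> / 2)"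
        by (simp add: algebra_simps)
      also have "\<dots> \<le> K * \<rho> ^ m * \<rho> ^ N"
        using \<rho>N K0 \<rho> by (intro mult_left_mono) auto
      finally show ?thesis by (simp add: n power_add mult_ac)
    qed
  qed
  then show ?thesis unfolding K_def by simp
qed

text \<open>
  A renewal sequence with an exponentially small error term is enclosed between a subsolution \<open>U\<close> and a
  supersolution \<open>V\<close> of the homogeneous equation, and the enclosure narrows at an exponential rate.
\<close>

definition renewal_bracket ::
    "('a::finite \<Rightarrow> real) \<Rightarrow> ('a \<Rightarrow> nat) \<Rightarrow> real \<Rightarrow> real \<Rightarrow> real \<Rightarrow> (nat \<Rightarrow> real) \<Rightarrow> (nat \<Rightarrow> real) \<Rightarrow> bool" where
  "renewal_bracket q k B A \<theta> U V \<longleftrightarrow>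
     (\<forall>n. \<bar>U n\<bar> \<le> B \<and> \<bar>V n\<bar> \<le> B \<and> V n \<le> U n \<and> U n \<le> V n + A * \<theta> ^ n) \<and>
     (\<forall>n. (\<forall>a. k a \<le> n) \<longrightarrow> U n \<le> (\<Sum>a\<in>UNIV. q a * U (n - k a)) \<and> (\<Sum>a\<in>UNIV. q a * V (n - k a)) \<le> V n)"

text \<open>
  The maximum of \<open>U\<close> over a window as long as the largest step never increases, and the minimum of \<open>V\<close>
  never decreases. Their difference contracts: words lead from the place where \<open>V\<close> is lowest, and \<open>U\<close> is low too, to
  every index of a window further on, with weights at least \<open>\<eta>\<close>, and this pulls down the maximum there. The
  constants must not depend on \<open>U\<close> and \<open>V\<close>, since the lemma is applied at all shifts of the lattice.
\<close>

lemma lattice_renewal_contraction: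
  fixes q :: "'a::finite \<Rightarrow> real" and k :: "'a \<Rightarrow> nat"
  assumes q_pos: "\<And>a. q a > 0" and q_sum: "(\<Sum>a\<in>UNIV. q a) = 1"
    and k_pos: "\<And>a. k a > 0"
    and reach: "\<And>n. n \<ge> start \<Longrightarrow> \<exists>w. sum_list (map k w) = n"
    and \<theta>: "0 < \<theta>" "\<theta> < 1" and A: "A \<ge> 0"
  obtains \<rho> K where "0 < \<rho>" "\<rho> < 1" "K \<ge> 0"
    "\<And>U V n m. renewal_bracket q k B A \<theta> U V \<Longrightarrow> n \<le> m \<Longrightarrow> \<bar>U m - U n\<bar> \<le> K * \<rho> ^ n"
proof -
  define k_max where "k_max = Max (range k)"
  have k_le: "k a \<le> k_max" for a unfolding k_max_def by (intro Max_ge) auto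
  have k_max_pos: "k_max > 0" using k_pos k_le by (metis gr_zeroI le_zero_eq less_irrefl)
  define N where "N = start + 2 * k_max"
  obtain wd where wd: "\<And>n. n \<ge> start \<Longrightarrow> sum_list (map k (wd n)) = n" using reach by metis
  define Q where "Q w = word_prob q w" for w
  have Q_pos: "Q w > 0" for w unfolding Q_def by (induction w) (auto simp: q_pos)
  have q_le: "q a \<le> 1" for a
    using member_le_sum[of a UNIV q] q_sum q_pos by (auto intro: less_imp_le)
  have Q_le: "Q w \<le> 1" for w
  proof (induction w)
    case (Cons a w)
    then show ?case using mult_mono[of "q a" 1 "Q w" 1] q_le[of a] Q_pos[of w] by (simp add: Q_def)
  qed (simp add: Q_def)
  define \<eta> where "\<eta> = Min ((\<lambda>n. Q (wd n)) ` {start..N + k_max})"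
  have \<eta>_le: "\<eta> \<le> Q (wd n)" if "n \<in> {start..N + k_max}" for n
    unfolding \<eta>_def using that by (intro Min_le) auto
  have \<eta>: "0 < \<eta>" unfolding \<eta>_def using Q_pos by (subst Min_gr_iff) (auto simp: N_def)
  have "\<eta> \<le> Q (wd start)" by (rule \<eta>_le) (simp add: N_def)
  then have \<eta>1: "\<eta> \<le> 1" using Q_le order_trans by blast
  define \<rho> where "\<rho> = max \<theta> (root N (1 - \<eta> / 2))"
  define K where "K = max (2 * B / \<rho> ^ N) (2 * A / \<eta>)"
  have N: "N > 0" using k_max_pos by (simp add: N_def)
  show ?thesis
  proof
    show "0 < \<rho>" "\<rho> < 1" unfolding \<rho>_def using \<theta> \<eta> \<eta>1 N by auto
    show "K \<ge> 0" unfolding K_def using A \<eta> by (intro max.coboundedI2) auto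
    fix U V :: "nat \<Rightarrow> real" and n m :: nat
    assume bracket: "renewal_bracket q k B A \<theta> U V" and nm: "n \<le> m"
    have U_bd: "\<bar>U n\<bar> \<le> B" and V_bd: "\<bar>V n\<bar> \<le> B" and VU: "V n \<le> U n" and UV: "U n \<le> V n + A * \<theta> ^ n" for n
      using bracket unfolding renewal_bracket_def by blast+
    have U_rec: "U n \<le> (\<Sum>a\<in>UNIV. q a * U (n - k a))" and V_rec: "V n \<ge> (\<Sum>a\<in>UNIV. q a * V (n - k a))"
      if "\<And>a. k a \<le> n" for n
      using bracket that unfolding renewal_bracket_def by blast+
    define hi where "hi n = Max (U ` {n..<n + k_max})" for n
    define lo where "lo n = Min (V ` {n..<n + k_max})" for n
    have U_le: "U i \<le> hi n" if "i \<ge> n" for i n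
      using that
    proof (induction i rule: less_induct)
      case (less i)
      show ?case
      proof (cases "i < n + k_max")
        case True
        then show ?thesis unfolding hi_def using less.prems by (intro Max_ge) auto
      next
        case False
        have "U i \<le> (\<Sum>a\<in>UNIV. q a * U (i - k a))"
          using False k_le by (intro U_rec) (metis add_leD2 leI order_trans)
        also have "\<dots> \<le> (\<Sum>a\<in>UNIV. q a * hi n)"
        proof (intro sum_mono mult_left_mono less.IH)
          fix a show "i - k a < i" "n \<le> i - k a" using k_pos[of a] k_le[of a] False k_max_pos by linarith+
        qed (auto intro: less_imp_le q_pos)
        finally show ?thesis by (simp add: sum_distrib_right[symmetric] q_sum)
      qed
    qed
    have V_ge: "lo n \<le> V i" if "i \<ge> n" for i n
      using that
    proof (induction i rule: less_induct)
      case (less i)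
      show ?case
      proof (cases "i < n + k_max")
        case True
        then show ?thesis unfolding lo_def using less.prems by (intro Min_le) auto
      next
        case False
        have "(\<Sum>a\<in>UNIV. q a * lo n) \<le> (\<Sum>a\<in>UNIV. q a * V (i - k a))"
        proof (intro sum_mono mult_left_mono less.IH)
          fix a show "i - k a < i" "n \<le> i - k a" using k_pos[of a] k_le[of a] False k_max_pos by linarith+
        qed (auto intro: less_imp_le q_pos)
        also have "\<dots> \<le> V i" using False k_le by (intro V_rec) (metis add_leD2 leI order_trans)
        finally show ?thesis by (simp add: sum_distrib_right[symmetric] q_sum)
      qed
    qed
    have gap_le: "\<bar>U m - U n\<bar> \<le> hi n - lo n" if "n \<le> m" for n m
      using U_le[of n m] U_le[of n n] V_ge[of n m] V_ge[of n n] VU[of m] VU[of n] that by auto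
    \<comment> \<open>A low value at \<open>j\<close> is felt, with weight \<open>Q w\<close>, at every index reached from \<open>j\<close> by a word \<open>w\<close>.\<close>
    have word: "U (j + sum_list (map k w)) \<le> hi n - Q w * (hi n - U j)" if "j \<ge> n + k_max" for j n w
    proof (induction w)
      case Nil
      then show ?case by (simp add: Q_def)
    next
      case (Cons a w)
      define i where "i = j + sum_list (map k w)"
      have i: "i \<ge> n + k_max" using that by (simp add: i_def)
      have "U (i + k a) \<le> (\<Sum>c\<in>UNIV. q c * U (i + k a - k c))"
        using i k_le by (intro U_rec) (metis add_leD2 order_trans trans_le_add1)
      also have "\<dots> = q a * U i + (\<Sum>c\<in>UNIV - {a}. q c * U (i + k a - k c))"
        by (simp add: sum.remove[of UNIV a])
      also have "(\<Sum>c\<in>UNIV - {a}. q c * U (i + k a - k c)) \<le> (\<Sum>c\<in>UNIV - {a}. q c * hi n)"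
      proof (intro sum_mono mult_left_mono U_le)
        fix c show "n \<le> i + k a - k c" using i k_le[of c] by linarith
      qed (auto intro: less_imp_le q_pos)
      also have "\<dots> = (1 - q a) * hi n"
        using q_sum by (simp add: sum_distrib_right[symmetric] sum_diff1)
      also have "q a * U i \<le> q a * (hi n - Q w * (hi n - U j))"
        using Cons.IH q_pos[of a] by (intro mult_left_mono) (auto simp: i_def)
      finally have "U (i + k a) \<le> q a * (hi n - Q w * (hi n - U j)) + (1 - q a) * hi n" by simp
      then show ?case by (simp add: i_def Q_def algebra_simps)
    qed
    have contract: "hi (n + N) - lo (n + N) \<le> (1 - \<eta>) * (hi n - lo n) + A * \<theta> ^ n" for n
    proof -
      have "lo (n + k_max) \<in> V ` {n + k_max..<n + k_max + k_max}"
        unfolding lo_def using k_max_pos by (intro Min_in) auto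
      then obtain j where j: "n + k_max \<le> j" "j < n + 2 * k_max" "V j = lo (n + k_max)" by auto
      have "A * \<theta> ^ j \<le> A * \<theta> ^ n" using A \<theta> j by (intro mult_left_mono power_decreasing) auto
      then have Uj: "U j \<le> lo (n + k_max) + A * \<theta> ^ n" using UV[of j] j by simp
      have "U i \<le> hi n - \<eta> * (hi n - lo (n + k_max) - A * \<theta> ^ n)" if i: "i \<in> {n + N..<n + N + k_max}" for i
      proof -
        have r: "i - j \<in> {start..N + k_max}" using i j by (auto simp: N_def)
        have "U i \<le> hi n - Q (wd (i - j)) * (hi n - U j)"
          using word[OF j(1), of "wd (i - j)"] wd[of "i - j"] r i j by (auto simp: N_def)
        moreover have "\<eta> * (hi n - U j) \<le> Q (wd (i - j)) * (hi n - U j)"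
          using \<eta>_le[OF r] U_le[of n j] j by (intro mult_right_mono) auto
        moreover have "\<eta> * (hi n - lo (n + k_max) - A * \<theta> ^ n) \<le> \<eta> * (hi n - U j)"
          using \<eta> Uj by (intro mult_left_mono) auto
        ultimately show ?thesis by linarith
      qed
      then have "hi (n + N) \<le> hi n - \<eta> * (hi n - lo (n + k_max) - A * \<theta> ^ n)"
        unfolding hi_def[of "n + N"] using k_max_pos by (subst Max_le_iff) auto
      moreover have lo_mono: "lo n \<le> lo (n + c)" for n c
        unfolding lo_def[of "n + c"] using k_max_pos V_ge[of n] by (subst Min_ge_iff) auto
      have "lo n \<le> lo (n + k_max)" "lo (n + k_max) \<le> lo (n + N)"
        using lo_mono[of n k_max] lo_mono[of "n + k_max" "start + k_max"] by (auto simp: N_def add_ac mult_2)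
      moreover have "\<eta> * (A * \<theta> ^ n) \<le> 1 * (A * \<theta> ^ n)" using \<eta>1 A \<theta> by (intro mult_right_mono) auto
      moreover have "(1 - \<eta>) * (hi n - lo (n + k_max)) \<le> (1 - \<eta>) * (hi n - lo n)"
        using \<eta>1 calculation by (intro mult_left_mono) auto
      ultimately show ?thesis by (simp add: algebra_simps)
    qed
    have bounded: "hi n - lo n \<le> 2 * B" for n
    proof -
      have "hi n \<le> B" unfolding hi_def using k_max_pos U_bd by (subst Max_le_iff) (auto simp: abs_le_iff)
      moreover have "- B \<le> lo n" unfolding lo_def using k_max_pos V_bd
        by (subst Min_ge_iff) (auto simp: abs_le_iff minus_le_iff)
      ultimately show ?thesis by simp
    qed
    have "hi n - lo n \<le> K * \<rho> ^ n"
      unfolding K_def \<rho>_def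
      by (rule exponential_decay_of_contraction[OF \<eta> \<eta>1 \<theta> N A bounded contract])
    then show "\<bar>U m - U n\<bar> \<le> K * \<rho> ^ n" using gap_le[OF nm] by simp
  qed
qed

text \<open>
  Replacing copies of \<open>v\<close> by copies of \<open>w\<close> raises the sum by one at a time; from \<open>s * s\<close> on there are enough
  copies to realize every residue modulo \<open>s\<close>.
\<close>

lemma semigroup_reaches_all_large:
  fixes k :: "'a \<Rightarrow> nat"
  assumes v: "sum_list (map k v) = s" and w: "sum_list (map k w) = s + 1" and n: "n \<ge> s * s"
  shows "\<exists>u. sum_list (map k u) = n"
proof -
  have rep: "sum_list (map k (concat (replicate i u))) = i * sum_list (map k u)" for i u
    by (induction i) auto
  define x where "x = n div s - n mod s"
  have "sum_list (map k (concat (replicate x v) @ concat (replicate (n mod s) w))) = x * s + (n mod s) * (s + 1)"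
    by (simp add: rep v w)
  also have "\<dots> = n"
  proof (cases "s = 0")
    case False
    have "s \<le> n div s" using n False by (simp add: less_eq_div_iff_mult_less_eq)
    then have "n mod s \<le> n div s" using False mod_less_divisor[of s n] by linarith
    then have "x * s + (n mod s) * (s + 1) = (n div s) * s + n mod s"
      unfolding x_def by (simp add: algebra_simps diff_mult_distrib)
    then show ?thesis by simp
  qed (simp add: x_def)
  finally show ?thesis by blast
qed

lemma integral_periods:
  fixes G :: "real \<Rightarrow> real"
  assumes G: "continuous_on UNIV G" and per: "\<And>x. G (x + d) = G x" and "d > 0"
  shows "integral {- (d * real k)..0} G = real k * integral {0..d} G"
proof (induction k)
  case (Suc k)
  have int: "G integrable_on {a..b}" for a b
    by (intro integrable_continuous_interval continuous_on_subset[OF G]) auto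
  have perk: "G (x + d * real n) = G x" for x n
    using per by (induction n arbitrary: x) (auto simp: algebra_simps, metis add.assoc add.commute)
  have "integral {- (d * real (Suc k))..- (d * real k)} G = integral {0 + - (d * real (Suc k))..d + - (d * real (Suc k))} G"
    by (simp add: algebra_simps)
  also have "\<dots> = integral {0..d} (\<lambda>t. G (- (d * real (Suc k)) + t))"
    by (subst integral_shift_Icc_real[symmetric]) (simp add: o_def)
  also have "\<dots> = integral {0..d} G"
    using perk[of "- (d * real (Suc k)) + t" "Suc k" for t] by (simp add: algebra_simps)
  finally have "integral {- (d * real (Suc k))..- (d * real k)} G = integral {0..d} G" .
  moreover have "integral {- (d * real (Suc k))..- (d * real k)} G + integral {- (d * real k)..0} G = integral {- (d * real (Suc k))..0} G"
    using \<open>d > 0\<close> by (intro Henstock_Kurzweil_Integration.integral_combine int) auto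
  ultimately show ?case using Suc.IH by (simp add: algebra_simps)
qed simp

context letter_probs
begin

text \<open>
  Rational ratios make all \<open>l a\<close> multiples of one number. The step \<open>d\<close> of the lattice is chosen
  maximal, namely the least positive difference of two word lengths \<open>l\<close>; then some two words differ by exactly
  one step, which is what lets words reach all large lattice points.
\<close>

lemma lattice_of_periodic:
  assumes "periodic_probs p"
  obtains d k v w where "d > 0" "\<And>a. k a > (0::nat)" "\<And>a. l a = d * real (k a)"
    "sum_list (map k w) = sum_list (map k v) + 1"
proof -
  obtain b :: 'a where True by simp
  have "\<exists>m n. n > 0 \<and> m > 0 \<and> l a / l b = real m / real n" for a
  proof -
    have "l a / l b \<in> \<rat>" using assms by (simp add: periodic_probs_def)
    then obtain m n :: nat where mn: "n \<noteq> 0" "\<bar>l a / l b\<bar> = real m / real n"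
      by (rule Rats_abs_nat_div_natE)
    have pos: "l a / l b > 0" by (rule divide_pos_pos[OF l_pos l_pos])
    then have "l a / l b = real m / real n" using mn by linarith
    moreover have "m > 0" using pos calculation by (cases m) auto
    ultimately show ?thesis using mn by blast
  qed
  then obtain num den where nd: "\<And>a. den a > (0::nat)" "\<And>a. num a > (0::nat)" "\<And>a. l a / l b = real (num a) / real (den a)"
    by metis
  define N where "N = (\<Prod>a\<in>UNIV. den a)"
  have N: "N > 0" unfolding N_def using nd by (intro prod_pos) auto
  have dvd: "den a dvd N" for a unfolding N_def by (intro dvd_prodI) auto
  define k0 where "k0 a = num a * (N div den a)" for a
  define d0 where "d0 = l b / real N"
  have d0: "d0 > 0" unfolding d0_def using N l_pos[of b] by (intro divide_pos_pos) auto
  have k0: "k0 a > 0" for a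
    unfolding k0_def using nd(1)[of a] nd(2)[of a] N dvd[of a] by (auto simp: div_greater_zero_iff dvd_imp_le)
  have l_k0: "l a = d0 * real (k0 a)" for a
  proof -
    have "d0 * real (k0 a) = l b * (real (num a) / real (den a))"
      unfolding d0_def k0_def using dvd[of a] N by (simp add: real_of_nat_div)
    also have "\<dots> = l b * (l a / l b)" by (simp only: nd(3))
    also have "\<dots> = l a" using l_pos[of b] by simp
    finally show ?thesis by simp
  qed
  define K0 where "K0 w = sum_list (map k0 w)" for w
  have K0_rep: "K0 (concat (replicate i u)) = i * K0 u" for i u
    unfolding K0_def by (induction i) auto
  have K0_simps: "K0 [] = 0" "K0 (a # u) = k0 a + K0 u" for a u by (simp_all add: K0_def)
  define H where "H n \<longleftrightarrow> n > 0 \<and> (\<exists>v w. K0 w = K0 v + n)" for n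
  define g where "g = (LEAST n. H n)"
  have "H (k0 b)" unfolding H_def using k0 by (intro conjI exI[of _ "[]"] exI[of _ "[b]"]) (auto simp: K0_simps)
  then have Hg: "H g" unfolding g_def by (rule LeastI)
  then obtain v w where vw: "K0 w = K0 v + g" and g: "g > 0" unfolding H_def by blast
  have g_dvd: "g dvd k0 a" for a
  proof (rule ccontr)
    assume "\<not> g dvd k0 a"
    then have r: "k0 a mod g > 0" by (simp add: mod_greater_zero_iff_not_dvd)
    have "K0 (a # concat (replicate (k0 a div g) v)) = K0 (concat (replicate (k0 a div g) w)) + k0 a mod g"
      by (simp add: K0_simps K0_rep vw algebra_simps)
    then have "H (k0 a mod g)" unfolding H_def using r by blast
    then have "g \<le> k0 a mod g" unfolding g_def by (rule Least_le)
    then show False using mod_less_divisor[OF g, of "k0 a"] by linarith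
  qed
  define k where "k a = k0 a div g" for a
  have k: "k0 a = g * k a" for a unfolding k_def using g_dvd[of a] by simp
  have K: "K0 u = g * sum_list (map k u)" for u
    unfolding K0_def by (induction u) (auto simp: k algebra_simps)
  show ?thesis
  proof
    show "d0 * real g > 0" using d0 g by simp
    show "k a > 0" for a using k0[of a] k[of a] by (cases "k a") auto
    show "l a = d0 * real g * real (k a)" for a using l_k0[of a] k[of a] by simp
    have "g * sum_list (map k w) = g * (sum_list (map k v) + 1)" using vw by (simp add: K)
    then show "sum_list (map k w) = sum_list (map k v) + 1" using g by (subst (asm) mult_cancel1) simp
  qed
qed

context
  fixes f :: "real \<Rightarrow> real" and C :: real
  assumes tame: "tame kappa C f"
begin

text \<open>
  The error term of the renewal equation is absorbed by the function \<open>C * exp (- y)\<close>, whose average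
  over the points \<open>y - l a\<close> is \<open>CARD('a)\<close> times larger than its value at \<open>y\<close>.
\<close>

lemma Z_corrected:
  assumes "y \<ge> 0"
  shows Z_subsolution: "Z f y + C * exp (- y) \<le> (\<Sum>a\<in>UNIV. p a * (Z f (y - l a) + C * exp (- (y - l a))))"
    and Z_supersolution: "Z f y - C * exp (- y) \<ge> (\<Sum>a\<in>UNIV. p a * (Z f (y - l a) - C * exp (- (y - l a))))"
proof -
  have e: "p a * exp (- (y - l a)) = exp (- y)" for a
    using p_pos[of a] by (simp add: exp_add exp_minus exp_diff field_simps)
  have s: "(\<Sum>a\<in>UNIV. p a * (C * exp (- (y - l a)))) = real CARD('a) * (C * exp (- y))"
  proof -
    have "(\<Sum>a\<in>UNIV. p a * (C * exp (- (y - l a)))) = (\<Sum>a\<in>(UNIV::'a set). C * exp (- y))"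
      using e by (intro sum.cong refl) (metis mult.left_commute)
    then show ?thesis by simp
  qed
  have "\<bar>z f y\<bar> \<le> C * exp (- y)" using abs_scaled_le[OF tame, of y] assms by simp
  moreover have "2 * (C * exp (- y)) \<le> real CARD('a) * (C * exp (- y))"
    using alphabet C_nonneg[OF tame] by (intro mult_right_mono) auto
  moreover have "(\<Sum>a\<in>UNIV. p a * (Z f (y - l a) + C * exp (- (y - l a))))
      = (\<Sum>a\<in>UNIV. p a * Z f (y - l a)) + (\<Sum>a\<in>UNIV. p a * (C * exp (- (y - l a))))"
    "(\<Sum>a\<in>UNIV. p a * (Z f (y - l a) - C * exp (- (y - l a))))
      = (\<Sum>a\<in>UNIV. p a * Z f (y - l a)) - (\<Sum>a\<in>UNIV. p a * (C * exp (- (y - l a))))"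
    by (simp_all only: distrib_left right_diff_distrib sum.distrib sum_subtractf)
  ultimately show "Z f y + C * exp (- y) \<le> (\<Sum>a\<in>UNIV. p a * (Z f (y - l a) + C * exp (- (y - l a))))"
    "Z f y - C * exp (- y) \<ge> (\<Sum>a\<in>UNIV. p a * (Z f (y - l a) - C * exp (- (y - l a))))"
    using Z_renewal[OF tame, of y] s by linarith+
qed

context
  fixes d :: real and k :: "'a \<Rightarrow> nat" and v w :: "'a list"
  assumes d: "d > 0" and k_pos: "\<And>a. k a > 0" and l_eq: "\<And>a. l a = d * real (k a)"
    and step_words: "sum_list (map k w) = sum_list (map k v) + 1"
begin

lemma Z_lattice_cauchy:
  obtains \<rho> K where "0 < \<rho>" "\<rho> < 1" "K \<ge> 0"
    "\<And>x n m. x \<ge> 0 \<Longrightarrow> n \<le> m \<Longrightarrow> \<bar>Z f (x + d * real m) - Z f (x + d * real n)\<bar> \<le> K * \<rho> ^ n"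
proof -
  define s where "s = sum_list (map k v)"
  define \<theta> where "\<theta> = exp (- d)"
  have \<theta>: "0 < \<theta>" "\<theta> < 1" using d by (auto simp: \<theta>_def)
  have \<theta>n: "exp (- (x + d * real n)) = exp (- x) * \<theta> ^ n" for x n
    unfolding \<theta>_def by (simp add: exp_add exp_minus exp_diff exp_of_nat_mult[symmetric] field_simps)
  have C: "C \<ge> 0" by (rule C_nonneg[OF tame])
  then have C2: "2 * C \<ge> 0" by simp
  have reach: "\<And>n. n \<ge> s * s \<Longrightarrow> \<exists>u. sum_list (map k u) = n"
    using semigroup_reaches_all_large[of k v s w] step_words by (simp add: s_def)
  obtain \<rho> K where \<rho>: "0 < \<rho>" "\<rho> < 1" "K \<ge> 0" and contr:
    "\<And>U V n m. renewal_bracket p k (C / gap + C) (2 * C) \<theta> U V \<Longrightarrow> n \<le> m \<Longrightarrow> \<bar>U m - U n\<bar> \<le> K * \<rho> ^ n"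
    using lattice_renewal_contraction[where q = p and k = k and start = "s * s" and A = "2 * C" and B = "C / gap + C",
      OF p_pos p_sum k_pos reach \<theta> C2] by metis
  define \<rho>' where "\<rho>' = max \<rho> \<theta>"
  show ?thesis
  proof
    show "0 < \<rho>'" "\<rho>' < 1" "K + 2 * C \<ge> 0" using \<rho> \<theta> C by (auto simp: \<rho>'_def)
    fix x :: real and n m :: nat
    assume x: "x \<ge> 0" and nm: "n \<le> m"
    define E where "E n = C * exp (- (x + d * real n))" for n
    have E: "0 \<le> E n" "E n \<le> C * \<theta> ^ n" "E n \<le> C" for n
    proof -
      have "exp (- x) * \<theta> ^ n \<le> 1 * \<theta> ^ n" using x \<theta> by (intro mult_right_mono) auto
      moreover have "\<theta> ^ n \<le> 1" using \<theta> by (simp add: power_le_one)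
      ultimately show "0 \<le> E n" "E n \<le> C * \<theta> ^ n" "E n \<le> C"
        unfolding E_def \<theta>n using C \<theta> mult_left_mono[of "exp (- x) * \<theta> ^ n" "\<theta> ^ n" C]
          mult_left_mono[OF order_trans, of "exp (- x) * \<theta> ^ n" "\<theta> ^ n" 1 C] by auto
    qed
    have arg: "x + d * real n - l a = x + d * real (n - k a)" if "k a \<le> n" for n a
      using that by (simp only: l_eq of_nat_diff right_diff_distrib)
    have nn: "x + d * real n \<ge> 0" for n using x d by simp
    have "\<bar>(Z f (x + d * real m) + E m) - (Z f (x + d * real n) + E n)\<bar> \<le> K * \<rho> ^ n"
    proof (rule contr[OF _ nm])
      have "\<bar>Z f (x + d * real n) + E n\<bar> \<le> C / gap + C \<and> \<bar>Z f (x + d * real n) - E n\<bar> \<le> C / gap + C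
          \<and> Z f (x + d * real n) - E n \<le> Z f (x + d * real n) + E n
          \<and> Z f (x + d * real n) + E n \<le> Z f (x + d * real n) - E n + 2 * C * \<theta> ^ n" for n
        using Z_bounded[OF tame, of "x + d * real n"] E[of n] by (intro conjI) linarith+
      moreover have "Z f (x + d * real n) + E n \<le> (\<Sum>a\<in>UNIV. p a * (Z f (x + d * real (n - k a)) + E (n - k a)))
          \<and> (\<Sum>a\<in>UNIV. p a * (Z f (x + d * real (n - k a)) - E (n - k a))) \<le> Z f (x + d * real n) - E n"
        if kn: "\<forall>a. k a \<le> n" for n
        unfolding E_def using Z_subsolution[OF nn[of n]] Z_supersolution[OF nn[of n]]
        by (simp only: arg[OF kn[rule_format]])
      ultimately show "renewal_bracket p k (C / gap + C) (2 * C) \<theta> (\<lambda>n. Z f (x + d * real n) + E n) (\<lambda>n. Z f (x + d * real n) - E n)"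
        unfolding renewal_bracket_def by blast
    qed
    moreover have "K * \<rho> ^ n \<le> K * \<rho>' ^ n"
      using \<rho> by (intro mult_left_mono power_mono) (auto simp: \<rho>'_def)
    moreover have "E n \<le> C * \<rho>' ^ n"
    proof -
      have "C * \<theta> ^ n \<le> C * \<rho>' ^ n" using C \<theta> by (intro mult_left_mono power_mono) (auto simp: \<rho>'_def)
      then show ?thesis using E(2)[of n] by linarith
    qed
    moreover have "E m \<le> C * \<rho>' ^ n"
    proof -
      have "C * \<theta> ^ m \<le> C * \<theta> ^ n" using C \<theta> nm by (intro mult_left_mono power_decreasing) auto
      also have "\<dots> \<le> C * \<rho>' ^ n" using C \<theta> by (intro mult_left_mono power_mono) (auto simp: \<rho>'_def)
      finally show ?thesis using E(2)[of m] by linarith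
    qed
    ultimately show "\<bar>Z f (x + d * real m) - Z f (x + d * real n)\<bar> \<le> (K + 2 * C) * \<rho>' ^ n"
      using E(1)[of m] E(1)[of n] unfolding distrib_right by linarith
  qed
qed

text \<open>
  On each translate of the lattice \<open>Z f\<close> converges exponentially fast, uniformly in the translate. The limit is
  \<open>d\<close>-periodic, and its mean is found by letting \<open>y\<close> run through the lattice in \<open>Z_window_integrals\<close>: each
  window \<open>{- l a..0}\<close> consists of \<open>k a\<close> full periods.
\<close>

lemma Z_lattice_limit:
  obtains G \<epsilon> B where "continuous_on UNIV G" "\<And>x. G (x + d) = G x"
    "integral {0..d} G = d * weight f / source_entropy p" "0 < \<epsilon>" "\<epsilon> < 1"
    "\<And>y. y \<ge> 0 \<Longrightarrow> \<bar>Z f y - G y\<bar> \<le> B * exp (- \<epsilon> * y)"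
proof -
  obtain \<rho> K where \<rho>: "0 < \<rho>" "\<rho> < 1" and K: "K \<ge> 0" and cauchy:
    "\<And>x n m. x \<ge> 0 \<Longrightarrow> n \<le> m \<Longrightarrow> \<bar>Z f (x + d * real m) - Z f (x + d * real n)\<bar> \<le> K * \<rho> ^ n"
    using Z_lattice_cauchy by blast
  have conv0: "convergent (\<lambda>n. Z f (x + d * real n))" if "x \<ge> 0" for x
  proof -
    have "Cauchy (\<lambda>n. Z f (x + d * real n))"
    proof (rule CauchyI')
      fix e :: real assume "e > 0"
      have "(\<lambda>n. K * \<rho> ^ n) \<longlonglongrightarrow> K * 0"
        using \<rho> by (intro tendsto_mult tendsto_const LIMSEQ_power_zero) auto
      then have "eventually (\<lambda>n. K * \<rho> ^ n < e) sequentially"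
        using \<open>e > 0\<close> by (intro order_tendstoD) auto
      then obtain M where M: "\<And>n. n \<ge> M \<Longrightarrow> K * \<rho> ^ n < e" by (auto simp: eventually_sequentially)
      show "\<exists>M. \<forall>m\<ge>M. \<forall>n>m. dist (Z f (x + d * real m)) (Z f (x + d * real n)) < e"
      proof (intro exI allI impI)
        fix m n assume "M \<le> m" "m < n"
        then show "dist (Z f (x + d * real m)) (Z f (x + d * real n)) < e"
          using cauchy[OF that, of m n] M[of m] by (simp add: dist_real_def abs_minus_commute)
      qed
    qed
    then show ?thesis by (simp add: Cauchy_convergent_iff)
  qed
  have conv: "convergent (\<lambda>n. Z f (x + d * real n))" for x
  proof -
    obtain n0 :: nat where "- x / d \<le> real n0" using real_arch_simple by blast
    then have "x + d * real n0 \<ge> 0" using d by (simp add: field_simps)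
    from conv0[OF this] have "convergent (\<lambda>n. Z f (x + d * real (n + n0)))" by (simp add: algebra_simps)
    then show ?thesis by (subst (asm) convergent_ignore_initial_segment)
  qed
  define G where "G x = lim (\<lambda>n. Z f (x + d * real n))" for x
  have G: "(\<lambda>n. Z f (x + d * real n)) \<longlonglongrightarrow> G x" for x
    unfolding G_def using conv by (simp add: convergent_LIMSEQ_iff)
  have per: "G (x + d) = G x" for x
  proof -
    have "(\<lambda>n. Z f (x + d * real (Suc n))) \<longlonglongrightarrow> G x" using G[of x] by (rule LIMSEQ_Suc)
    moreover have "(\<lambda>n. Z f (x + d * real (Suc n))) \<longlonglongrightarrow> G (x + d)" using G[of "x + d"] by (simp add: algebra_simps)
    ultimately show ?thesis using LIMSEQ_unique by blast
  qed
  have "\<bar>G x - G y\<bar> \<le> 4 * C / gap * \<bar>x - y\<bar>" for x y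
  proof (rule LIMSEQ_le_const2)
    show "(\<lambda>n. \<bar>Z f (x + d * real n) - Z f (y + d * real n)\<bar>) \<longlonglongrightarrow> \<bar>G x - G y\<bar>"
      by (intro tendsto_intros G)
    show "\<exists>N. \<forall>n\<ge>N. \<bar>Z f (x + d * real n) - Z f (y + d * real n)\<bar> \<le> 4 * C / gap * \<bar>x - y\<bar>"
      using Z_lipschitz[OF tame, of "x + d * real n" "y + d * real n" for n] by simp
  qed
  then have "lipschitz_on (4 * C / gap) UNIV G"
    using C_nonneg[OF tame] gap_pos by (intro lipschitz_onI) (auto simp: dist_real_def)
  then have G_cont: "continuous_on UNIV G" by (rule lipschitz_on_continuous_on)
  define \<epsilon>0 where "\<epsilon>0 = - ln \<rho> / d"
  have \<epsilon>0: "\<epsilon>0 > 0" unfolding \<epsilon>0_def using \<rho> d by (intro divide_pos_pos) auto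
  have rate: "\<bar>Z f y - G y\<bar> \<le> K / \<rho> * exp (- min \<epsilon>0 (1 / 2) * y)" if y: "y \<ge> 0" for y
  proof -
    define n where "n = nat \<lfloor>y / d\<rfloor>"
    have n: "real n \<le> y / d" "y / d - 1 \<le> real n" using y d unfolding n_def by (auto simp: of_nat_nat) 
    have x: "y - d * real n \<ge> 0" using n(1) d by (simp add: field_simps)
    have "\<bar>G y - Z f y\<bar> \<le> K * \<rho> ^ n"
    proof (rule LIMSEQ_le_const2)
      show "(\<lambda>j. \<bar>Z f (y + d * real j) - Z f y\<bar>) \<longlonglongrightarrow> \<bar>G y - Z f y\<bar>" by (intro tendsto_intros G)
      show "\<exists>N. \<forall>j\<ge>N. \<bar>Z f (y + d * real j) - Z f y\<bar> \<le> K * \<rho> ^ n"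
        using cauchy[OF x, of n "n + j" for j] by (simp add: algebra_simps)
    qed
    also have "\<dots> \<le> K * (exp (- \<epsilon>0 * y) / \<rho>)"
    proof (intro mult_left_mono K)
      have "\<rho> ^ n = exp (ln \<rho> * real n)" using \<rho> by (simp add: exp_of_nat2_mult)
      also have "\<dots> \<le> exp (ln \<rho> * (y / d - 1))" using n(2) \<rho> by (simp add: mult_left_mono_neg)
      also have "\<dots> = exp (- \<epsilon>0 * y) / \<rho>"
        using \<rho> d by (simp add: \<epsilon>0_def right_diff_distrib exp_diff)
      finally show "\<rho> ^ n \<le> exp (- \<epsilon>0 * y) / \<rho>" .
    qed
    \<comment> \<open>The minimum keeps the exponent below \<open>1\<close>.\<close>
    also have "\<dots> \<le> K * (exp (- min \<epsilon>0 (1 / 2) * y) / \<rho>)"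
      using K \<rho> y by (intro mult_left_mono divide_right_mono) (auto simp: mult_right_mono)
    finally show ?thesis by (simp add: abs_minus_commute)
  qed
  have int_lim: "(\<lambda>n. integral {- l a..0} (\<lambda>t. Z f (d * real n + t))) \<longlonglongrightarrow> integral {- l a..0} G" for a
  proof (rule dominated_convergence(2))
    show "(\<lambda>t. Z f (d * real n + t)) integrable_on {- l a..0}" for n
      by (intro integrable_continuous_interval continuous_on_compose2[OF Z_continuous[OF tame]] continuous_intros) auto
    show "(\<lambda>t. C / gap) integrable_on {- l a..0}" by (rule integrable_const_ivl)
    show "norm (Z f (d * real n + t)) \<le> C / gap" for n t using Z_bounded[OF tame] by simp
    show "(\<lambda>n. Z f (d * real n + t)) \<longlonglongrightarrow> G t" for t using G[of t] by (simp add: add.commute)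
  qed
  have "(\<lambda>n. \<Sum>a\<in>UNIV. p a * integral {- l a..0} (\<lambda>t. Z f (d * real n + t))) \<longlonglongrightarrow> (\<Sum>a\<in>UNIV. p a * integral {- l a..0} G)"
    by (intro tendsto_sum tendsto_mult tendsto_const int_lim)
  moreover have "filterlim (\<lambda>n. d * real n) at_top sequentially"
    using d by (intro filterlim_tendsto_pos_mult_at_top[OF tendsto_const] filterlim_real_sequentially) auto
  then have "(\<lambda>n. \<Sum>a\<in>UNIV. p a * integral {- l a..0} (\<lambda>t. Z f (d * real n + t))) \<longlonglongrightarrow> weight f"
    by (rule filterlim_compose[OF Z_window_integrals[OF tame]])
  ultimately have "weight f = (\<Sum>a\<in>UNIV. p a * integral {- l a..0} G)" using LIMSEQ_unique by blast
  also have "\<dots> = (\<Sum>a\<in>UNIV. p a * (real (k a) * integral {0..d} G))"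
    using integral_periods[OF G_cont per d] by (simp only: l_eq)
  finally have "d * weight f = (\<Sum>a\<in>UNIV. p a * (d * real (k a))) * integral {0..d} G"
    by (simp add: sum_distrib_left sum_distrib_right mult_ac)
  also have "(\<Sum>a\<in>UNIV. p a * (d * real (k a))) = source_entropy p"
    unfolding sum_p_l[symmetric] by (simp only: l_eq)
  finally have mean: "integral {0..d} G = d * weight f / source_entropy p"
    using source_entropy_pos by (simp add: field_simps)
  show ?thesis by (rule that[OF G_cont per mean _ _ rate]) (use \<epsilon>0 in auto)
qed

end

end

theorem word_sum_periodic:
  assumes "periodic_probs p"
  obtains d where "d > 0"
    "\<And>f C. tame kappa C f \<Longrightarrow> \<exists>G \<epsilon> B. continuous_on UNIV G \<and> (\<forall>x. G (x + d) = G x) \<and>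
       integral {0..d} G = d * weight f / source_entropy p \<and> 0 < \<epsilon> \<and> \<epsilon> < 1 \<and>
       (\<forall>x\<ge>1. \<bar>F f x - x * G (ln x)\<bar> \<le> B * x powr (1 - \<epsilon>))"
proof -
  obtain d k v w where L: "d > 0" "\<And>a. k a > (0::nat)" "\<And>a. l a = d * real (k a)"
    "sum_list (map k w) = sum_list (map k v) + 1"
    using lattice_of_periodic[OF assms] by metis
  show ?thesis
  proof
    fix f C assume tame: "tame kappa C f"
    obtain G \<epsilon> B where G: "continuous_on UNIV G" "\<And>x. G (x + d) = G x"
      "integral {0..d} G = d * weight f / source_entropy p" "0 < \<epsilon>" "\<epsilon> < 1"
      and rate: "\<And>y. y \<ge> 0 \<Longrightarrow> \<bar>Z f y - G y\<bar> \<le> B * exp (- \<epsilon> * y)"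
      using Z_lattice_limit[OF tame L] by metis
    have "\<bar>F f x - x * G (ln x)\<bar> \<le> B * x powr (1 - \<epsilon>)" if x: "x \<ge> 1" for x
    proof -
      have "F f x - x * G (ln x) = x * (Z f (ln x) - G (ln x))"
        using x by (simp add: Z_def exp_minus field_simps)
      also have "\<bar>\<dots>\<bar> \<le> x * (B * exp (- \<epsilon> * ln x))"
        unfolding abs_mult using rate[of "ln x"] x by (intro mult_mono) auto
      also have "\<dots> = B * x powr (1 - \<epsilon>)"
        using x by (simp add: powr_def left_diff_distrib exp_diff exp_minus field_simps)
      finally show ?thesis .
    qed
    then show "\<exists>G \<epsilon> B. continuous_on UNIV G \<and> (\<forall>x. G (x + d) = G x) \<and>
       integral {0..d} G = d * weight f / source_entropy p \<and> 0 < \<epsilon> \<and> \<epsilon> < 1 \<and>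
       (\<forall>x\<ge>1. \<bar>F f x - x * G (ln x)\<bar> \<le> B * x powr (1 - \<epsilon>))"
      using G by blast
  qed (rule L(1))
qed

end

section \<open>Poisson weights\<close>

definition pois :: "nat \<Rightarrow> real \<Rightarrow> real" where
  "pois k t = t ^ k * exp (- t) / fact k"

text \<open>The Euler derivative \<open>t * f' t\<close> of \<open>f = pois k\<close>.\<close>

definition euler_pois :: "nat \<Rightarrow> real \<Rightarrow> real" where
  "euler_pois k t = real k * pois k t - real (k + 1) * pois (k + 1) t"

text \<open>
  A common bound for the Poisson weights \<open>pois k\<close> with \<open>k \<ge> 2\<close> and for their products with
  polynomials. Its product with a function of linear growth, such as a word sum, is still bounded by \<open>kappa\<close>.
\<close>

definition phi :: "real \<Rightarrow> real" where
  "phi t = t\<^sup>2 * exp (- t / 2)"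

lemma Suc_times_pois: "real (k + 1) * pois (k + 1) t = t * pois k t"
proof -
  have "fact (k + 1) = real (k + 1) * fact k" by (metis Suc_eq_plus1 fact_Suc of_nat_mult of_nat_fact)
  then show ?thesis unfolding pois_def by (simp del: of_nat_add of_nat_Suc fact_Suc)
qed

lemma euler_pois_eq: "euler_pois k t = (real k - t) * pois k t"
  unfolding euler_pois_def Suc_times_pois by (simp add: left_diff_distrib)

lemma phi_nonneg: "phi t \<ge> 0"
  by (simp add: phi_def)

lemma pois_nonneg: "t \<ge> 0 \<Longrightarrow> pois k t \<ge> 0"
  by (simp add: pois_def)

lemma power_exp_le:
  fixes t :: real
  assumes "t \<ge> 0" "c > 0"
  shows "t ^ j * exp (- (c * t)) \<le> fact j / c ^ j"
proof -
  have s: "(\<lambda>n. (c * t) ^ n /\<^sub>R fact n) sums exp (c * t)" by (rule exp_converges)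
  have "(\<Sum>n\<in>{j}. (c * t) ^ n /\<^sub>R fact n) \<le> (\<Sum>n. (c * t) ^ n /\<^sub>R fact n)"
    using s assms by (intro sum_le_suminf sums_summable[OF s]) auto
  then have "(c * t) ^ j / fact j \<le> exp (c * t)"
    using s by (simp add: sums_iff divide_inverse mult.commute)
  then show ?thesis
    using assms by (simp add: exp_minus field_simps power_mult_distrib)
qed

text \<open>Any polynomial factor is absorbed when \<open>exp (- t)\<close> is relaxed to \<open>exp (- t / 2)\<close>.\<close>

lemma power_exp_le_phi:
  assumes "t \<ge> 0" "k \<ge> 2"
  shows "t ^ k * exp (- t) \<le> fact (k - 2) * 2 ^ (k - 2) * phi t"
proof -
  have "t ^ k * exp (- t) = phi t * (t ^ (k - 2) * exp (- (1 / 2 * t)))"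
  proof -
    have "t ^ k = t\<^sup>2 * t ^ (k - 2)" using power_add[of t 2 "k - 2"] assms by (simp only: le_add_diff_inverse)
    moreover have "exp (- t) = exp (- t / 2) * exp (- (1 / 2 * t))" by (simp flip: exp_add)
    ultimately show ?thesis unfolding phi_def by (simp only: mult_ac)
  qed
  also have "\<dots> \<le> phi t * (fact (k - 2) / (1 / 2) ^ (k - 2))"
    using assms by (intro mult_left_mono power_exp_le phi_nonneg) auto
  finally show ?thesis by (simp add: power_divide mult_ac)
qed

lemma polynomial_phi_le_kappa:
  assumes "t > 0"
  shows "phi t \<le> 66 * kappa t" "t * phi t \<le> 66 * kappa t"
proof -
  have e: "t ^ j * exp (- t / 2) \<le> fact j * 2 ^ j" for j
    using power_exp_le[of t "1 / 2" j] assms by (simp add: power_divide)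
  have *: "phi t * (1 + t)\<^sup>2 \<le> 66 * t\<^sup>2" "t * phi t * (1 + t)\<^sup>2 \<le> 66 * t\<^sup>2"
  proof -
    have e0: "exp (- (t / 2)) \<le> 1" using assms by simp
    \<comment> \<open>The constant is \<open>66 = fact 1 * 2 + 2 * (fact 2 * 2\<^sup>2) + fact 3 * 2 ^ 3\<close>.\<close>
    have f: "fact 3 = (6::real)" by (simp add: eval_nat_numeral)
    have "(1 + t)\<^sup>2 * exp (- t / 2) \<le> 66"
    proof -
      have "(1 + t)\<^sup>2 * exp (- t / 2) = exp (- (t / 2)) + 2 * (t ^ 1 * exp (- t / 2)) + t\<^sup>2 * exp (- t / 2)"
        by (simp add: power2_eq_square algebra_simps)
      moreover have "fact 1 * 2 ^ 1 = (2::real)" "fact 2 * 2\<^sup>2 = (8::real)" by (simp_all add: fact_2)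
      ultimately show ?thesis using e0 e[of 1] e[of 2] by linarith
    qed
    then have "t\<^sup>2 * ((1 + t)\<^sup>2 * exp (- t / 2)) \<le> t\<^sup>2 * 66" by (intro mult_left_mono) auto
    then show "phi t * (1 + t)\<^sup>2 \<le> 66 * t\<^sup>2" by (simp add: phi_def mult_ac)
    have "t * (1 + t)\<^sup>2 * exp (- t / 2) \<le> 66"
      using e[of 1] e[of 2] e[of 3] f by (simp add: power2_eq_square power3_eq_cube algebra_simps)
    then have "t\<^sup>2 * (t * (1 + t)\<^sup>2 * exp (- t / 2)) \<le> t\<^sup>2 * 66" by (intro mult_left_mono) auto
    then show "t * phi t * (1 + t)\<^sup>2 \<le> 66 * t\<^sup>2" by (simp add: phi_def mult_ac)
  qed
  have p: "(1 + t)\<^sup>2 > 0" using assms by simp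
  show "phi t \<le> 66 * kappa t" "t * phi t \<le> 66 * kappa t"
    using * p by (simp_all add: kappa_def pos_le_divide_eq)
qed

lemma phi_le_linear:
  assumes "t > 0"
  shows "phi t \<le> 2 * t"
proof -
  have "t * (t * exp (- (1 / 2 * t))) \<le> t * 2"
    using power_exp_le[of t "1 / 2" 1] assms by (intro mult_left_mono) auto
  then show ?thesis by (simp add: phi_def power2_eq_square mult_ac)
qed

lemma tame_phi_nonneg: "tame phi C f \<Longrightarrow> C \<ge> 0"
proof -
  assume "tame phi C f"
  then have "\<bar>f 1\<bar> \<le> C * phi 1" unfolding tame_def by (auto dest!: spec[of _ 1])
  then have "0 \<le> C * phi 1" by (rule order_trans[OF abs_ge_zero])
  then show ?thesis by (simp add: phi_def zero_le_mult_iff)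
qed

lemma tame_phi_kappa: "tame phi C f \<Longrightarrow> tame kappa (66 * C) f"
proof -
  assume t: "tame phi C f"
  have C: "C \<ge> 0" by (rule tame_phi_nonneg) (rule t)
  show ?thesis
    unfolding tame_def
  proof (intro conjI allI impI)
    fix x :: real assume x: "x > 0"
    have "C * phi x \<le> C * (66 * kappa x)" using polynomial_phi_le_kappa[OF x] C by (intro mult_left_mono)
    moreover have "\<bar>f x\<bar> \<le> C * phi x" using t x by (auto simp: tame_def)
    ultimately show "\<bar>f x\<bar> \<le> 66 * C * kappa x" by simp
    fix c :: real assume c: "1 \<le> c" "c \<le> 2"
    have "C * (c - 1) * phi x \<le> C * (c - 1) * (66 * kappa x)"
      using polynomial_phi_le_kappa[OF x] C c by (intro mult_left_mono) auto
    moreover have "\<bar>f (c * x) - f x\<bar> \<le> C * (c - 1) * phi x" using t x c by (auto simp: tame_def)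
    ultimately show "\<bar>f (c * x) - f x\<bar> \<le> 66 * C * (c - 1) * kappa x" by (simp add: mult_ac)
  qed
qed

lemma tame_add: "tame \<phi> C f \<Longrightarrow> tame \<phi> D g \<Longrightarrow> tame \<phi> (C + D) (\<lambda>t. f t + g t)"
proof (unfold tame_def distrib_right, intro conjI allI impI, goal_cases)
  case (1 t)
  then have "\<bar>f t\<bar> \<le> C * \<phi> t" "\<bar>g t\<bar> \<le> D * \<phi> t" by auto
  then show ?case by linarith
next
  case (2 t c)
  then have "\<bar>f (c * t) - f t\<bar> \<le> C * (c - 1) * \<phi> t" "\<bar>g (c * t) - g t\<bar> \<le> D * (c - 1) * \<phi> t" by auto
  then show ?case by linarith
qed

lemma tame_cmult: "tame \<phi> C f \<Longrightarrow> tame \<phi> (\<bar>r\<bar> * C) (\<lambda>t. r * f t)"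
  unfolding tame_def by (auto simp: abs_mult mult.assoc right_diff_distrib[symmetric] intro!: mult_left_mono)

lemma tame_diff:
  assumes "tame \<phi> C f" "tame \<phi> D g"
  shows "tame \<phi> (C + D) (\<lambda>t. f t - g t)"
  using tame_add[OF assms(1) tame_cmult[OF assms(2), of "- 1"]] by simp

text \<open>
  The typical second factor is a word sum, which by \<open>word_sum_linear_bound\<close> and
  \<open>word_sum_log_lipschitz\<close> has these properties.
\<close>

lemma tame_times:
  assumes f: "tame phi C f" and G: "\<And>t. t > 0 \<Longrightarrow> \<bar>G t\<bar> \<le> D * t"
    "\<And>t c. t > 0 \<Longrightarrow> 1 \<le> c \<Longrightarrow> c \<le> 2 \<Longrightarrow> \<bar>G (c * t) - G t\<bar> \<le> D * (c - 1) * t"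
  shows "tame kappa (198 * (C * D)) (\<lambda>t. f t * G t)"
  unfolding tame_def
proof (intro conjI allI impI)
  fix t :: real assume t: "t > 0"
  have C: "C \<ge> 0" by (rule tame_phi_nonneg) (rule f)
  have D: "D \<ge> 0" using G(1)[of 1] abs_ge_zero[of "G 1"] by simp
  have ft: "\<bar>f t\<bar> \<le> C * phi t" using f t by (auto simp: tame_def)
  have k: "t * phi t \<le> 66 * kappa t" using polynomial_phi_le_kappa[OF t] by simp
  have "\<bar>f t * G t\<bar> \<le> (C * phi t) * (D * t)"
    unfolding abs_mult using ft G(1)[OF t] C D phi_nonneg by (intro mult_mono) auto
  also have "\<dots> = C * D * (t * phi t)" by simp
  also have "\<dots> \<le> C * D * (198 * kappa t)" using k C D kappa_nonneg[of t] by (intro mult_left_mono) auto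
  finally show "\<bar>f t * G t\<bar> \<le> 198 * (C * D) * kappa t" by (simp add: mult_ac)
  fix c :: real assume c: "1 \<le> c" "c \<le> 2"
  have "f (c * t) * G (c * t) - f t * G t = (f (c * t) - f t) * G (c * t) + f t * (G (c * t) - G t)"
    by (simp add: algebra_simps)
  also have "\<bar>\<dots>\<bar> \<le> \<bar>f (c * t) - f t\<bar> * \<bar>G (c * t)\<bar> + \<bar>f t\<bar> * \<bar>G (c * t) - G t\<bar>"
    using abs_triangle_ineq by (metis abs_mult)
  also have "\<dots> \<le> (C * (c - 1) * phi t) * (D * (2 * t)) + (C * phi t) * (D * (c - 1) * t)"
  proof (intro add_mono mult_mono)
    show "\<bar>f (c * t) - f t\<bar> \<le> C * (c - 1) * phi t" using f t c by (auto simp: tame_def)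
    have "D * (c * t) \<le> D * (2 * t)" using c t D by (intro mult_left_mono mult_right_mono) auto
    then show "\<bar>G (c * t)\<bar> \<le> D * (2 * t)" using G(1)[of "c * t"] t c by simp
    show "\<bar>G (c * t) - G t\<bar> \<le> D * (c - 1) * t" using G(2)[OF t c] .
  qed (use ft C c phi_nonneg in auto)
  also have "\<dots> = 3 * (C * D * (c - 1)) * (t * phi t)" by (simp add: algebra_simps)
  also have "\<dots> \<le> 3 * (C * D * (c - 1)) * (66 * kappa t)" using k C D c by (intro mult_left_mono) auto
  finally show "\<bar>f (c * t) * G (c * t) - f t * G t\<bar> \<le> 198 * (C * D) * (c - 1) * kappa t" by (simp add: mult_ac)
qed

lemma tame_linear:
  assumes "tame phi C f"
  shows "t > 0 \<Longrightarrow> \<bar>f t\<bar> \<le> 2 * C * t"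
    and "t > 0 \<Longrightarrow> 1 \<le> c \<Longrightarrow> c \<le> 2 \<Longrightarrow> \<bar>f (c * t) - f t\<bar> \<le> 2 * C * (c - 1) * t"
proof -
  have C: "C \<ge> 0" by (rule tame_phi_nonneg) (rule assms)
  assume t: "t > 0"
  have "C * phi t \<le> C * (2 * t)" using phi_le_linear[OF t] C by (intro mult_left_mono)
  moreover have "\<bar>f t\<bar> \<le> C * phi t" using assms t by (auto simp: tame_def)
  ultimately show "\<bar>f t\<bar> \<le> 2 * C * t" by simp
  assume c: "1 \<le> c" "c \<le> 2"
  have "C * (c - 1) * phi t \<le> C * (c - 1) * (2 * t)" using phi_le_linear[OF t] C c by (intro mult_left_mono) auto
  moreover have "\<bar>f (c * t) - f t\<bar> \<le> C * (c - 1) * phi t" using assms t c by (auto simp: tame_def)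
  ultimately show "\<bar>f (c * t) - f t\<bar> \<le> 2 * C * (c - 1) * t" by (simp add: mult_ac)
qed

lemma pois_deriv: "(pois k has_real_derivative (real k * t ^ (k - 1) - t ^ k) * exp (- t) / fact k) (at t)"
  unfolding pois_def
  by (auto intro!: derivative_eq_intros simp: field_simps)

lemma pois_tame:
  assumes k: "k \<ge> 2"
  shows "\<exists>C. tame phi C (pois k)"
proof -
  define A :: real where "A = real k * 2 ^ (k - 1) * (fact (k - 2) * 2 ^ (k - 2)) + 2 ^ k * (fact (k - 1) * 2 ^ (k - 1))"
  have A1: "fact (k - 2) * 2 ^ (k - 2) \<le> A"
  proof -
    have "1 * (fact (k - 2) * 2 ^ (k - 2)) \<le> real k * 2 ^ (k - 1) * (fact (k - 2) * 2 ^ (k - 2))"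
      using k mult_mono[of 1 "real k" 1 "2 ^ (k - 1)"] by (intro mult_right_mono) auto
    moreover have "0 \<le> 2 ^ k * (fact (k - 1) * 2 ^ (k - 1) :: real)" by simp
    ultimately show ?thesis unfolding A_def by linarith
  qed
  have "tame phi A (pois k)"
    unfolding tame_def
  proof (intro conjI allI impI)
    fix t :: real assume t: "t > 0"
    have "\<bar>pois k t\<bar> = t ^ k * exp (- t) / fact k" using t by (simp add: pois_def)
    also have "\<dots> \<le> t ^ k * exp (- t) / 1" using t by (intro divide_left_mono) auto
    also have "\<dots> \<le> fact (k - 2) * 2 ^ (k - 2) * phi t" using power_exp_le_phi[of t k] t k by simp
    also have "\<dots> \<le> A * phi t" using A1 phi_nonneg by (intro mult_right_mono)
    finally show "\<bar>pois k t\<bar> \<le> A * phi t" .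
    fix c :: real assume c: "1 \<le> c" "c \<le> 2"
    show "\<bar>pois k (c * t) - pois k t\<bar> \<le> A * (c - 1) * phi t"
    proof (cases "c = 1")
      case False
      then have lt: "t < c * t" using c t by simp
      obtain \<xi> where \<xi>: "t < \<xi>" "\<xi> < c * t"
        and eq: "pois k (c * t) - pois k t = (c * t - t) * ((real k * \<xi> ^ (k - 1) - \<xi> ^ k) * exp (- \<xi>) / fact k)"
        using MVT2[OF lt pois_deriv] by blast
      have \<xi>2: "\<xi> \<le> 2 * t" using \<xi> c t mult_right_mono[of c 2 t] by linarith
      have "\<bar>(real k * \<xi> ^ (k - 1) - \<xi> ^ k) * exp (- \<xi>) / fact k\<bar> \<le> (real k * \<xi> ^ (k - 1) + \<xi> ^ k) * exp (- \<xi>) / 1"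
        unfolding abs_divide abs_mult using \<xi> t
        by (intro frac_le mult_mono) (auto intro!: order_trans[OF abs_triangle_ineq4] mult_nonneg_nonneg)
      also have "\<dots> \<le> (real k * (2 * t) ^ (k - 1) + (2 * t) ^ k) * exp (- t)"
      proof -
        have "\<xi> ^ j \<le> (2 * t) ^ j" for j using \<xi> \<xi>2 t by (intro power_mono) auto
        then show ?thesis using \<xi> t unfolding div_by_1
          by (intro mult_mono add_mono mult_left_mono) auto
      qed
      finally have "\<bar>pois k (c * t) - pois k t\<bar> \<le> (c * t - t) * ((real k * (2 * t) ^ (k - 1) + (2 * t) ^ k) * exp (- t))"
        unfolding eq abs_mult using lt by (intro mult_mono) auto
      also have "\<dots> = (c - 1) * (real k * 2 ^ (k - 1) * (t ^ k * exp (- t)) + 2 ^ k * (t ^ (k + 1) * exp (- t)))"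
        using k power_add[of t 1 "k - 1"] by (simp add: power_mult_distrib algebra_simps)
      also have "\<dots> \<le> (c - 1) * (real k * 2 ^ (k - 1) * (fact (k - 2) * 2 ^ (k - 2) * phi t) + 2 ^ k * (fact (k - 1) * 2 ^ (k - 1) * phi t))"
        using power_exp_le_phi[of t k] power_exp_le_phi[of t "k + 1"] c t k
        by (intro mult_left_mono add_mono) auto
      also have "\<dots> = A * (c - 1) * phi t" by (simp add: A_def algebra_simps)
      finally show ?thesis .
    qed simp
  qed
  then show ?thesis by blast
qed

lemma euler_pois_tame:
  assumes "k \<ge> 2"
  shows "\<exists>C. tame phi C (euler_pois k)"
proof -
  obtain C D where "tame phi C (pois k)" "tame phi D (pois (k + 1))"
    using pois_tame[of k] pois_tame[of "k + 1"] assms by auto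
  from tame_diff[OF tame_cmult[OF this(1), of "real k"] tame_cmult[OF this(2), of "real (k + 1)"]]
  show ?thesis unfolding euler_pois_def[abs_def] by blast
qed

section \<open>Weights of the test functions\<close>

lemma filterlim_exhaustion:
  fixes A :: "nat \<Rightarrow> 'b set"
  assumes fin: "\<And>n. finite (A n)" and mono: "\<And>n m. n \<le> m \<Longrightarrow> A n \<subseteq> A m" and ex: "\<And>b. \<exists>n. b \<in> A n"
  shows "filterlim A (finite_subsets_at_top UNIV) sequentially"
  unfolding filterlim_finite_subsets_at_top
proof (intro allI impI)
  fix W :: "'b set" assume "finite W \<and> W \<subseteq> UNIV"
  then have "finite W" by simp
  then have "\<exists>n. W \<subseteq> A n"
  proof induction
    case (insert w W)
    then obtain n m where "W \<subseteq> A n" "w \<in> A m" using ex by blast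
    then have "insert w W \<subseteq> A (max n m)" using mono[of n "max n m"] mono[of m "max n m"] by auto
    then show ?case by blast
  qed simp
  then obtain n where "W \<subseteq> A n" by blast
  then have "\<forall>m\<ge>n. finite (A m) \<and> W \<subseteq> A m \<and> A m \<subseteq> UNIV" using fin mono by blast
  then show "eventually (\<lambda>m. finite (A m) \<and> W \<subseteq> A m \<and> A m \<subseteq> UNIV) sequentially"
    unfolding eventually_sequentially by blast
qed

lemma has_sum_of_exhaustion:
  fixes g :: "'b \<Rightarrow> real"
  assumes fin: "\<And>n. finite (A n)" and mono: "\<And>n m. n \<le> m \<Longrightarrow> A n \<subseteq> A m" and ex: "\<And>b. \<exists>n. b \<in> A n"
    and nonneg: "\<And>b. g b \<ge> 0" and lim: "(\<lambda>n. sum g (A n)) \<longlonglongrightarrow> S"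
  shows "(g has_sum S) UNIV"
proof -
  have A: "filterlim A (finite_subsets_at_top UNIV) sequentially" by (rule filterlim_exhaustion[OF fin mono ex])
  have le: "sum g (A n) \<le> S" for n
  proof (rule LIMSEQ_le_const[OF lim])
    show "\<exists>N. \<forall>m\<ge>N. sum g (A n) \<le> sum g (A m)" using mono nonneg fin by (intro exI[of _ n]) (auto intro!: sum_mono2)
  qed
  have "sum g W \<le> S" if W: "finite W" for W
  proof -
    have "eventually (\<lambda>n. W \<subseteq> A n) sequentially"
      using A W unfolding filterlim_finite_subsets_at_top by (simp add: eventually_conj_iff)
    then obtain n where "W \<subseteq> A n" by (auto simp: eventually_sequentially)
    then have "sum g W \<le> sum g (A n)" using nonneg fin by (intro sum_mono2) auto
    then show ?thesis using le order_trans by blast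
  qed
  then have "g summable_on UNIV"
    using nonneg by (intro nonneg_bdd_above_summable_on) (auto intro!: bdd_aboveI2)
  then have sum: "(g has_sum (infsum g UNIV)) UNIV" by simp
  then have "(\<lambda>n. sum g (A n)) \<longlonglongrightarrow> infsum g UNIV"
    unfolding has_sum_def by (rule filterlim_compose[OF _ A])
  then have "infsum g UNIV = S" using lim LIMSEQ_unique by blast
  with sum show ?thesis by simp
qed

lemma short_words_exhaust: "\<exists>n. w \<in> {w. length w < n}"
  by (auto intro: exI[of _ "Suc (length w)"])

lemma short_words_mono: "n \<le> m \<Longrightarrow> {w. length w < n} \<subseteq> {w. length w < m}"
  by auto

lemmas filterlim_short_words = filterlim_exhaustion[of "\<lambda>n. {w. length w < n}", OF finite_short_words short_words_mono short_words_exhaust]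

lemma weight_scale:
  assumes "r > 0"
  shows "weight (\<lambda>t. f (r * t)) = r * weight f"
proof -
  have "weight f = (LINT x|lborel. exp (- (ln r + x)) * f (exp (ln r + x)))"
    unfolding weight_def by (subst lborel_integral_real_affine[of 1 _ "ln r"]) auto
  also have "\<dots> = (LINT x|lborel. inverse r * (exp (- x) * f (r * exp x)))"
    using assms by (intro Bochner_Integration.integral_cong) (auto simp: exp_add exp_minus exp_diff field_simps)
  also have "\<dots> = inverse r * weight (\<lambda>t. f (r * t))" unfolding weight_def by simp
  finally show ?thesis using assms by simp
qed

context letter_probs
begin

lemma weight_add:
  assumes "tame kappa C f" "tame kappa D g"
  shows "weight (\<lambda>t. f t + g t) = weight f + weight g"
  unfolding weight_def distrib_left
  by (rule Bochner_Integration.integral_add[OF z_integrable[OF assms(1)] z_integrable[OF assms(2)]])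

lemma weight_cmult: "weight (\<lambda>t. r * f t) = r * weight f"
  unfolding weight_def by (simp add: mult.left_commute[of _ r])

lemma weight_diff:
  assumes "tame kappa C f" "tame kappa D g"
  shows "weight (\<lambda>t. f t - g t) = weight f - weight g"
  unfolding weight_def right_diff_distrib
  by (rule Bochner_Integration.integral_diff[OF z_integrable[OF assms(1)] z_integrable[OF assms(2)]])

lemma weight_antiderivative:
  assumes tame: "tame kappa C g" and H: "\<And>x. (H has_real_derivative exp (- x) * g (exp x)) (at x)"
    and top: "(H \<longlongrightarrow> A) at_top" and bot: "(H \<longlongrightarrow> B) at_bot"
  shows "weight g = A - B"
proof -
  have "((\<lambda>y. H y - H (- y)) \<longlongrightarrow> A - B) at_top"
    by (intro tendsto_diff top filterlim_compose[OF bot] filterlim_uminus_at_bot_at_top)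
  moreover have "eventually (\<lambda>y. H y - H (- y) = integral {-y..y} (z g)) at_top"
    using eventually_ge_at_top[of 0]
  proof eventually_elim
    case (elim y)
    have "(z g has_integral H y - H (- y)) {-y..y}"
      using elim H by (intro fundamental_theorem_of_calculus)
        (auto simp: has_real_derivative_iff_has_vector_derivative[symmetric] intro: has_field_derivative_at_within)
    then show ?case by (simp add: integral_unique)
  qed
  ultimately have "((\<lambda>y. integral {-y..y} (z g)) \<longlongrightarrow> A - B) at_top" by (simp add: filterlim_cong)
  then show ?thesis using z_integral_tendsto[OF tame] tendsto_unique trivial_limit_at_top_linorder by blast
qed

lemma z_limits:
  assumes tame: "tame kappa C f"
  shows "(z f \<longlongrightarrow> 0) at_top" "(z f \<longlongrightarrow> 0) at_bot"
proof -
  show "(z f \<longlongrightarrow> 0) at_top" by (rule z_tendsto_0[OF tame])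
  have "((\<lambda>x. C * exp x) \<longlongrightarrow> C * 0) at_bot" by (intro tendsto_intros exp_at_bot)
  moreover have "eventually (\<lambda>x. norm (z f x) \<le> C * exp x) at_bot"
    using eventually_le_at_bot[of 0]
  proof eventually_elim
    case (elim x)
    then show ?case using abs_scaled_le[OF tame, of x] by simp
  qed
  ultimately show "(z f \<longlongrightarrow> 0) at_bot" by (intro Lim_null_comparison[of "z f"]) auto
qed

lemma tame_kappa_pois: "k \<ge> 2 \<Longrightarrow> \<exists>C. tame kappa C (pois k)"
  and tame_kappa_euler_pois: "k \<ge> 2 \<Longrightarrow> \<exists>C. tame kappa C (euler_pois k)"
  using pois_tame euler_pois_tame tame_phi_kappa by blast+

text \<open>The function \<open>exp (- x) * pois k (exp x)\<close> vanishes at both ends and has derivative \<open>exp (- x) * (euler_pois k - pois k) (exp x)\<close>.\<close>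

lemma weight_euler_pois:
  assumes k: "k \<ge> 2"
  shows "weight (euler_pois k) = weight (pois k)"
proof -
  obtain C D where t: "tame kappa C (pois k)" "tame kappa D (euler_pois k)"
    using tame_kappa_pois tame_kappa_euler_pois k by blast
  have "(z (pois k) has_real_derivative exp (- x) * (euler_pois k (exp x) - pois k (exp x))) (at x)" for x
  proof -
    have d: "(z (pois k) has_real_derivative
        exp (- x) * ((real k * (exp x) ^ (k - 1) - (exp x) ^ k) * exp (- exp x) / fact k * exp x) + (- exp (- x)) * pois k (exp x)) (at x)"
      by (rule derivative_eq_intros DERIV_chain2[OF pois_deriv] refl | simp)+
    have e: "(real k * (exp x) ^ (k - 1) - (exp x) ^ k) * exp (- exp x) / fact k * exp x = euler_pois k (exp x)"
    proof -
      have "(exp x) ^ (k - 1) * exp x = (exp x) ^ k" using k by (simp flip: power_Suc2)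
      moreover have "(real k * (exp x) ^ (k - 1) - (exp x) ^ k) * exp (- exp x) / fact k * exp x
          = (real k * ((exp x) ^ (k - 1) * exp x) - exp x * (exp x) ^ k) * exp (- exp x) / fact k"
        by (simp add: algebra_simps)
      ultimately show ?thesis unfolding euler_pois_eq pois_def by (simp add: algebra_simps)
    qed
    show ?thesis using d unfolding e by (simp add: right_diff_distrib)
  qed
  then have "weight (\<lambda>t. euler_pois k t - pois k t) = 0 - 0"
    by (rule weight_antiderivative[OF tame_diff[OF t(2,1)] _ z_limits[OF t(1)]])
  then show ?thesis using weight_diff[OF t(2,1)] by simp
qed

text \<open>
  By induction: \<open>weight_euler_pois\<close> links the weights of \<open>pois k\<close> and \<open>pois (k + 1)\<close>.
\<close>

lemma weight_pois: "k \<ge> 2 \<Longrightarrow> weight (pois k) = 1 / (real k * (real k - 1))"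
proof (induction k rule: dec_induct)
  case base
  obtain C where t: "tame kappa C (pois 2)" using tame_kappa_pois[of 2] by auto
  have "weight (pois 2) = 0 - (- (1 / 2))"
  proof (rule weight_antiderivative[OF t])
    show "((\<lambda>x. - exp (- exp x) / 2) has_real_derivative exp (- x) * pois 2 (exp x)) (at x)" for x
      by (auto intro!: derivative_eq_intros simp: pois_def power2_eq_square exp_minus field_simps fact_2)
    have "((\<lambda>x. - exp (- exp x) / 2 :: real) \<longlongrightarrow> - 0 / 2) at_top"
      by (intro tendsto_intros filterlim_compose[OF exp_at_bot] filterlim_compose[OF filterlim_uminus_at_bot_at_top] exp_at_top) simp
    then show "((\<lambda>x. - exp (- exp x) / 2 :: real) \<longlongrightarrow> 0) at_top" by simp
    have "((\<lambda>x. - exp (- exp x) / 2 :: real) \<longlongrightarrow> - exp (- 0) / 2) at_bot"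
      by (intro tendsto_intros exp_at_bot) simp
    then show "((\<lambda>x. - exp (- exp x) / 2 :: real) \<longlongrightarrow> - (1 / 2)) at_bot" by simp
  qed
  then show ?case by simp
next
  case (step k)
  obtain C D where t: "tame kappa C (pois k)" "tame kappa D (pois (k + 1))"
    using tame_kappa_pois[of k] tame_kappa_pois[of "k + 1"] step by auto
  have "weight (euler_pois k) = real k * weight (pois k) - real (k + 1) * weight (pois (k + 1))"
    unfolding euler_pois_def[abs_def]
    using weight_diff[OF tame_cmult[OF t(1), of "real k"] tame_cmult[OF t(2), of "real (k + 1)"]]
    by (simp only: weight_cmult)
  then have "real (k + 1) * weight (pois (k + 1)) = (real k - 1) * weight (pois k)"
    using weight_euler_pois[OF step.hyps(1)] by (simp add: left_diff_distrib)
  also have "\<dots> = 1 / real k" using step.IH step.hyps(1) by simp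
  finally have "real (k + 1) * weight (pois (k + 1)) = 1 / real k" .
  moreover have "weight (pois (k + 1)) = real (k + 1) * weight (pois (k + 1)) / real (k + 1)" by simp
  ultimately have "weight (pois (k + 1)) = 1 / real k / real (k + 1)" by (simp only:)
  then show ?case by (simp add: mult.commute)
qed

lemma pois_times_pois_scaled:
  assumes "y \<ge> 0"
  shows "pois a t * pois b (t * y) = y ^ b / (1 + y) ^ (a + b) * (fact (a + b) / (fact a * fact b)) * pois (a + b) ((1 + y) * t)"
proof -
  define r where "r = 1 + y"
  have r: "r > 0" using assms by (simp add: r_def)
  have e: "exp (- t) * exp (- (t * y)) = exp (- (r * t))" by (simp add: exp_add[symmetric] algebra_simps r_def)
  have "pois a t * pois b (t * y) = (t ^ a * (t * y) ^ b / (fact a * fact b)) * (exp (- t) * exp (- (t * y)))"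
    by (simp add: pois_def)
  also have "\<dots> = y ^ b / r ^ (a + b) * (fact (a + b) / (fact a * fact b)) * pois (a + b) (r * t)"
    unfolding e pois_def using r by (simp add: power_mult_distrib power_add)
  finally show ?thesis unfolding r_def .
qed

text \<open>
  The weight of \<open>\<lambda>t. pois a t * pois b (t * x)\<close>, a Beta-type integral.
\<close>

definition pair_weight :: "nat \<Rightarrow> nat \<Rightarrow> real \<Rightarrow> real" where
  "pair_weight a b x = x ^ b * fact (a + b - 2) / (fact a * fact b * (1 + x) ^ (a + b - 1))"

lemma weight_pois_times_pois:
  assumes "a \<ge> 2" "b \<ge> 2" "x \<ge> 0"
  shows "weight (\<lambda>t. pois a t * pois b (t * x)) = pair_weight a b x"
proof -
  have x: "1 + x > 0" using assms by simp
  define n where "n = a + b - 2"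
  have n: "a + b = Suc (Suc n)" "a + b - 1 = Suc n" using assms by (auto simp: n_def)
  have "weight (\<lambda>t. pois a t * pois b (t * x))
      = x ^ b / (1 + x) ^ (a + b) * (fact (a + b) / (fact a * fact b)) * ((1 + x) * (1 / (real (a + b) * (real (a + b) - 1))))"
    unfolding pois_times_pois_scaled[OF assms(3)] weight_cmult
    using x assms weight_pois[of "a + b"] weight_scale[of "1 + x" "pois (a + b)"] by simp
  also have "\<dots> = pair_weight a b x"
  proof -
    define N where "N = real (Suc (Suc n)) * (real (Suc (Suc n)) - 1)"
    have N: "N > 0" "fact (Suc (Suc n)) = N * fact n" unfolding N_def by (auto simp: algebra_simps intro!: add_pos_nonneg)
    show ?thesis
      unfolding pair_weight_def n_def[symmetric] n N_def[symmetric] N(2) using x N(1) by simp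
  qed
  finally show ?thesis .
qed

lemma tame_pois_times_word_sum:
  assumes "a \<ge> 2" "b \<ge> 2"
  shows "\<exists>C. tame kappa C (\<lambda>t. pois a t * F (pois b) t)"
proof -
  obtain A B where A: "tame phi A (pois a)" and B: "tame kappa B (pois b)"
    using pois_tame tame_kappa_pois assms by blast
  have le: "\<And>t. t > 0 \<Longrightarrow> \<bar>pois b t\<bar> \<le> B * kappa t" using B by (auto simp: tame_def)
  have "tame kappa (198 * (A * (B / gap))) (\<lambda>t. pois a t * F (pois b) t)"
    using word_sum_linear_bound[OF le _ tame_nonneg[OF B]] word_sum_log_lipschitz[OF B tame_nonneg[OF B]]
    by (intro tame_times[OF A]) (auto simp: mult_ac)
  then show ?thesis by blast
qed

text \<open>
  A word below \<open>w\<close> is \<open>w @ u\<close> with \<open>P (w @ u) = P w * P u\<close>, so this is the sum of the pair weights over the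
  position \<open>u\<close> relative to \<open>w\<close>. Integral and sum are exchanged by dominated convergence.
\<close>

lemma weight_pois_times_word_sum:
  assumes a: "a \<ge> 2" and b: "b \<ge> 2"
  shows "((\<lambda>u. pair_weight a b (P u)) has_sum weight (\<lambda>t. pois a t * F (pois b) t)) UNIV"
proof (rule has_sum_of_exhaustion[of "\<lambda>n. {u. length u < n}", OF finite_short_words short_words_mono short_words_exhaust])
  show "pair_weight a b (P u) \<ge> 0" for u
    unfolding pair_weight_def using P_pos[of u] by (auto intro!: divide_nonneg_nonneg mult_nonneg_nonneg)
  obtain C where C: "tame kappa C (\<lambda>t. pois a t * F (pois b) t)" using tame_pois_times_word_sum[OF a b] by blast
  obtain A where A: "tame kappa A (pois b)" using tame_kappa_pois b by blast
  have sum: "((\<lambda>u. pois b (t * P u)) has_sum F (pois b) t) UNIV" if "t > 0" for t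
    unfolding word_sum_def using A that by (intro has_sum_infsum summable_of_kappa_bound) (auto simp: tame_def)
  have pb: "pois b (t * P u) \<ge> 0" if "t > 0" for t u
    using that P_pos[of u] by (intro pois_nonneg) auto
  define g where "g n x = (\<Sum>u | length u < n. exp (- x) * (pois a (exp x) * pois b (exp x * P u)))" for n and x :: real
  have meas: "(\<lambda>x. exp (- x) * (pois a (exp x) * pois b (exp x * P u))) \<in> borel_measurable lborel" for u
    unfolding pois_def by (auto intro!: borel_measurable_continuous_onI continuous_intros)
  have zi: "integrable lborel (z (\<lambda>t. pois a t * F (pois b) t))" by (rule z_integrable[OF C])
  have g_bound: "\<bar>g n x\<bar> \<le> z (\<lambda>t. pois a t * F (pois b) t) x" for n x
  proof -
    have "(\<Sum>u | length u < n. pois b (exp x * P u)) \<le> F (pois b) (exp x)"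
      using sum[of "exp x"] pb by (intro finite_sum_le_has_sum[OF _ finite_short_words]) auto
    then have "exp (- x) * (pois a (exp x) * (\<Sum>u | length u < n. pois b (exp x * P u))) \<le> z (\<lambda>t. pois a t * F (pois b) t) x"
      by (intro mult_left_mono pois_nonneg) auto
    moreover have "g n x \<ge> 0" unfolding g_def using pb by (intro sum_nonneg mult_nonneg_nonneg) (auto intro: pois_nonneg)
    ultimately show ?thesis by (simp add: g_def sum_distrib_left)
  qed
  have "(\<lambda>n. LINT x|lborel. g n x) \<longlonglongrightarrow> (LINT x|lborel. z (\<lambda>t. pois a t * F (pois b) t) x)"
  proof (rule integral_dominated_convergence)
    show "AE x in lborel. (\<lambda>n. g n x) \<longlonglongrightarrow> z (\<lambda>t. pois a t * F (pois b) t) x"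
    proof (rule AE_I2)
      fix x
      have "(\<lambda>n. \<Sum>u | length u < n. pois b (exp x * P u)) \<longlonglongrightarrow> F (pois b) (exp x)"
        using sum[of "exp x"] unfolding has_sum_def by (intro filterlim_compose[OF _ filterlim_short_words]) auto
      then have "(\<lambda>n. exp (- x) * (pois a (exp x) * (\<Sum>u | length u < n. pois b (exp x * P u)))) \<longlonglongrightarrow> z (\<lambda>t. pois a t * F (pois b) t) x"
        by (intro tendsto_intros)
      then show "(\<lambda>n. g n x) \<longlonglongrightarrow> z (\<lambda>t. pois a t * F (pois b) t) x"
        by (simp add: g_def sum_distrib_left)
    qed
    show "integrable lborel (z (\<lambda>t. pois a t * F (pois b) t))" by (rule zi)
    then show "z (\<lambda>t. pois a t * F (pois b) t) \<in> borel_measurable lborel" by auto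
    show "g n \<in> borel_measurable lborel" for n unfolding g_def using meas by (intro borel_measurable_sum)
    show "AE x in lborel. norm (g n x) \<le> z (\<lambda>t. pois a t * F (pois b) t) x" for n
      using g_bound by (intro AE_I2) simp
  qed
  moreover have "(LINT x|lborel. g n x) = (\<Sum>u | length u < n. pair_weight a b (P u))" for n
  proof -
    have "integrable lborel (\<lambda>x. exp (- x) * (pois a (exp x) * pois b (exp x * P u)))" for u
    proof (rule Bochner_Integration.integrable_bound[OF zi meas], rule AE_I2)
      fix x
      have "exp (- x) * (pois a (exp x) * pois b (exp x * P u)) \<le> g (Suc (length u)) x"
        unfolding g_def using pb by (intro member_le_sum) (auto intro!: mult_nonneg_nonneg intro: pois_nonneg simp: finite_short_words)
      also have "\<dots> \<le> z (\<lambda>t. pois a t * F (pois b) t) x" using g_bound[of "Suc (length u)" x] by simp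
      finally have "exp (- x) * (pois a (exp x) * pois b (exp x * P u)) \<le> z (\<lambda>t. pois a t * F (pois b) t) x" .
      moreover have "0 \<le> exp (- x) * (pois a (exp x) * pois b (exp x * P u))"
        using pb by (intro mult_nonneg_nonneg) (auto intro: pois_nonneg)
      ultimately show "norm (exp (- x) * (pois a (exp x) * pois b (exp x * P u))) \<le> norm (z (\<lambda>t. pois a t * F (pois b) t) x)"
        unfolding real_norm_def by linarith
    qed
    then have "(LINT x|lborel. g n x) = (\<Sum>u | length u < n. weight (\<lambda>t. pois a t * pois b (t * P u)))"
      unfolding g_def weight_def by (intro Bochner_Integration.integral_sum)
    then show ?thesis using weight_pois_times_pois[OF a b less_imp_le[OF P_pos]] by simp
  qed
  ultimately show "(\<lambda>n. \<Sum>u | length u < n. pair_weight a b (P u)) \<longlonglongrightarrow> weight (\<lambda>t. pois a t * F (pois b) t)"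
    by (simp add: weight_def)
qed

subsection \<open>The power series for the pair weights\<close>

text \<open>
  The powers of letter probabilities satisfy \<open>S = 1 + \<sigma> * S\<close> for their sum \<open>S\<close> over all words, where \<open>\<sigma>\<close> is
  the sum over the letters.
\<close>

lemma infsum_powers:
  assumes "s \<ge> 2"
  shows "(\<lambda>u. P u ^ s) summable_on UNIV" "(\<Sum>\<^sub>\<infinity>u\<in>- {[]}. P u ^ s) = power_ratio p s"
proof -
  \<comment> \<open>Word probabilities are at most \<open>1\<close>, so the power may be cut off there to be bounded by \<open>kappa\<close>.\<close>
  have b: "\<bar>if t \<le> 1 then t ^ s else 0\<bar> \<le> 4 * kappa t" if "t > 0" for t
  proof (cases "t \<le> 1")
    case True
    have "t ^ s \<le> t\<^sup>2" using that True assms by (intro power_decreasing) auto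
    moreover have "t\<^sup>2 * (1 + t)\<^sup>2 \<le> t\<^sup>2 * 2\<^sup>2" using that True by (intro mult_left_mono power_mono) auto
    then have "t\<^sup>2 \<le> 4 * kappa t" using that by (simp add: kappa_def pos_le_divide_eq mult.commute)
    ultimately show ?thesis using that True by simp
  qed (use kappa_nonneg in auto)
  have "(\<lambda>u. if 1 * P u \<le> 1 then (1 * P u) ^ s else 0) summable_on UNIV"
    by (rule summable_of_kappa_bound[OF b]) auto
  then show sum: "(\<lambda>u. P u ^ s) summable_on UNIV" by (simp add: P_le_1)
  define \<sigma> where "\<sigma> = (\<Sum>a\<in>UNIV. p a ^ s)"
  have "\<sigma> < (\<Sum>a\<in>UNIV. p a)" unfolding \<sigma>_def
  proof (rule sum_strict_mono)
    fix a
    have "p a ^ s \<le> p a ^ 2" using assms p_pos[of a] p_less_1[of a] by (intro power_decreasing) auto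
    also have "\<dots> < p a" using p_pos[of a] p_less_1[of a] by (simp add: power2_eq_square)
    finally show "p a ^ s < p a" .
  qed auto
  then have \<sigma>: "\<sigma> < 1" by (simp add: p_sum)
  define S where "S = (\<Sum>\<^sub>\<infinity>u. P u ^ s)"
  have "S = 1 + (\<Sum>a\<in>UNIV. \<Sum>\<^sub>\<infinity>u. p a ^ s * P u ^ s)"
    unfolding S_def using infsum_words_Cons[OF sum] by (simp add: power_mult_distrib)
  also have "\<dots> = 1 + \<sigma> * S" unfolding S_def \<sigma>_def
    using infsum_cmult_right[OF sum] by (simp add: sum_distrib_right)
  finally have S: "S * (1 - \<sigma>) = 1" by (simp add: algebra_simps)
  have all: "insert [] (- {[]}) = (UNIV :: 'a list set)" by auto
  have "S = P [] ^ s + (\<Sum>\<^sub>\<infinity>u\<in>- {[]}. P u ^ s)"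
    unfolding S_def using infsum_insert[of "\<lambda>u. P u ^ s" "- {[]}" "[]"] summable_on_subset[OF sum, of "- {[]}"]
    by (simp add: all)
  then have "(\<Sum>\<^sub>\<infinity>u\<in>- {[]}. P u ^ s) = S - 1" by simp
  also have "\<dots> = \<sigma> / (1 - \<sigma>)" using S \<sigma> by (simp add: field_simps)
  finally show "(\<Sum>\<^sub>\<infinity>u\<in>- {[]}. P u ^ s) = power_ratio p s" by (simp add: power_ratio_def \<sigma>_def)
qed

lemma negative_binomial_sums:
  fixes y :: real
  assumes "\<bar>y\<bar> < 1"
  shows "(\<lambda>j. fact (r + j) / fact j * (- y) ^ j) sums (fact r / (1 + y) ^ (r + 1))"
proof -
  have "(\<lambda>j. (- real (r + 1) gchoose j) * y ^ j) sums (1 + y) powr (- real (r + 1))"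
    by (rule gen_binomial_real[OF assms])
  moreover have "(- real (r + 1) gchoose j) = (- 1) ^ j * (fact (r + j) / (fact j * fact r))" for j
  proof -
    have "(- real (r + 1) gchoose j) = (- 1) ^ j * (real (r + j) gchoose j)"
      by (subst gbinomial_minus) (simp add: algebra_simps)
    also have "real (r + j) gchoose j = real ((r + j) choose j)" by (rule binomial_gbinomial[symmetric])
    also have "\<dots> = fact (r + j) / (fact j * fact r)" by (subst binomial_fact) auto
    finally show ?thesis .
  qed
  moreover have "(1 + y) powr (- real (r + 1)) = 1 / (1 + y) ^ (r + 1)"
    using assms by (subst powr_minus) (simp add: powr_realpow divide_inverse abs_less_iff del: power_Suc of_nat_Suc of_nat_add)
  ultimately have "(\<lambda>j. (- 1) ^ j * (fact (r + j) / (fact j * fact r)) * y ^ j) sums (1 / (1 + y) ^ (r + 1))" by simp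
  from sums_mult[OF this, of "fact r"] show ?thesis
    by (simp add: power_minus[of y] mult_ac)
qed

text \<open>
  Expanding the denominator of \<open>pair_weight\<close> in powers of \<open>P u\<close> and exchanging the sums. The
  empty word is left out because the expansion diverges at \<open>P [] = 1\<close>, while at nonempty words \<open>P u\<close> is bounded
  by \<open>p_max < 1\<close>; this makes the double series absolutely summable.
\<close>

lemma pair_weight_series:
  assumes a: "a \<ge> 2" and b: "b \<ge> 2"
  shows "(\<lambda>j. (- 1) ^ j * power_ratio p (b + j) * (fact (a + b + j - 2) / fact j)) sums
    (fact a * fact b * (\<Sum>\<^sub>\<infinity>u\<in>- {[]}. pair_weight a b (P u)))"
proof -
  define r where "r = a + b - 2"
  have r: "a + b + j - 2 = r + j" "a + b - 1 = r + 1" for j using a b by (auto simp: r_def)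
  define g where "g u j = P u ^ b * (fact (r + j) / fact j * (- P u) ^ j)" for u j
  have Pu: "P u < 1" if "u \<in> - {[]}" for u using P_le_p_max[of u] p_max_less_1 that by auto
  have s1: "(\<lambda>j. g u j) sums (P u ^ b * (fact r / (1 + P u) ^ (r + 1)))" if "u \<in> - {[]}" for u
    unfolding g_def by (intro sums_mult negative_binomial_sums) (use Pu[OF that] P_pos[of u] in auto)
  have ng: "norm (g u j) = P u ^ b * (fact (r + j) / fact j * (- (- P u)) ^ j)" for u j
    unfolding g_def using P_pos[of u] by (simp add: abs_mult power_abs)
  have s2: "(\<lambda>j. norm (g u j)) sums (P u ^ b * (fact r / (1 - P u) ^ (r + 1)))" if "u \<in> - {[]}" for u
    unfolding ng using negative_binomial_sums[of "- P u" r] Pu[OF that] P_pos[of u]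
    by (intro sums_mult) (auto simp: abs_less_iff)
  have abs: "(\<lambda>(u, j). norm (g u j)) summable_on (- {[]}) \<times> UNIV"
  proof (rule summable_on_SigmaI)
    fix u :: "'a list" assume u: "u \<in> - {[]}"
    show "((\<lambda>j. case (u, j) of (u, j) \<Rightarrow> norm (g u j)) has_sum (P u ^ b * (fact r / (1 - P u) ^ (r + 1)))) UNIV"
      using s2[OF u] by (auto intro!: sums_nonneg_imp_has_sum)
  next
    show "(\<lambda>u. P u ^ b * (fact r / (1 - P u) ^ (r + 1))) summable_on - {[]}"
    proof (rule summable_on_comparison_test)
      show "(\<lambda>u. P u ^ b * (fact r / (1 - p_max) ^ (r + 1))) summable_on - {[]}"
        by (intro summable_on_cmult_left summable_on_subset[OF infsum_powers(1)[OF b]]) auto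
      fix u :: "'a list" assume u: "u \<in> - {[]}"
      show "P u ^ b * (fact r / (1 - P u) ^ (r + 1)) \<le> P u ^ b * (fact r / (1 - p_max) ^ (r + 1))"
        using P_le_p_max[of u] u p_max_less_1 P_pos[of u]
        by (intro mult_left_mono divide_left_mono power_mono mult_pos_pos zero_less_power) auto
      show "0 \<le> P u ^ b * (fact r / (1 - P u) ^ (r + 1))"
        using Pu[OF u] P_pos[of u] by (intro mult_nonneg_nonneg divide_nonneg_nonneg zero_le_power) auto
    qed
  qed auto
  then have gs: "(\<lambda>(u, j). g u j) summable_on (- {[]}) \<times> UNIV"
    by (subst summable_on_iff_abs_summable_on_real) (simp add: case_prod_unfold)
  have "(\<lambda>(j, u). g u j) summable_on UNIV \<times> (- {[]})"
    using summable_on_swap[of "\<lambda>(u, j). g u j" "- {[]}" UNIV] gs by simp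
  then have js: "(\<lambda>j. \<Sum>\<^sub>\<infinity>u\<in>- {[]}. g u j) summable_on UNIV"
    by (rule summable_on_Sigma_banach)
  have "(\<Sum>\<^sub>\<infinity>j. \<Sum>\<^sub>\<infinity>u\<in>- {[]}. g u j) = (\<Sum>\<^sub>\<infinity>u\<in>- {[]}. \<Sum>\<^sub>\<infinity>j. g u j)"
    using infsum_swap_banach[OF gs] by simp
  also have "\<dots> = (\<Sum>\<^sub>\<infinity>u\<in>- {[]}. fact a * fact b * pair_weight a b (P u))"
  proof (rule infsum_cong)
    fix u :: "'a list" assume u: "u \<in> - {[]}"
    have "(g u has_sum (P u ^ b * (fact r / (1 + P u) ^ (r + 1)))) UNIV"
      using s1[OF u] s2[OF u] by (intro norm_summable_imp_has_sum) (auto simp: sums_iff)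
    then have "(\<Sum>\<^sub>\<infinity>j. g u j) = P u ^ b * (fact r / (1 + P u) ^ (r + 1))" by (rule infsumI)
    also have "\<dots> = fact a * fact b * pair_weight a b (P u)"
      unfolding pair_weight_def r r_def[symmetric] by simp
    finally show "(\<Sum>\<^sub>\<infinity>j. g u j) = fact a * fact b * pair_weight a b (P u)" .
  qed
  also have "\<dots> = fact a * fact b * (\<Sum>\<^sub>\<infinity>u\<in>- {[]}. pair_weight a b (P u))"
    by (rule infsum_cmult_right')
  finally have "(\<lambda>j. \<Sum>\<^sub>\<infinity>u\<in>- {[]}. g u j) sums (fact a * fact b * (\<Sum>\<^sub>\<infinity>u\<in>- {[]}. pair_weight a b (P u)))"
    using js by (metis has_sum_imp_sums has_sum_infsum)
  moreover have "(\<Sum>\<^sub>\<infinity>u\<in>- {[]}. g u j) = (- 1) ^ j * power_ratio p (b + j) * (fact (a + b + j - 2) / fact j)" for j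
  proof -
    have "(\<Sum>\<^sub>\<infinity>u\<in>- {[]}. g u j) = (\<Sum>\<^sub>\<infinity>u\<in>- {[]}. (fact (r + j) / fact j * (- 1) ^ j) * P u ^ (b + j))"
      unfolding g_def by (intro infsum_cong) (simp add: power_minus[of "P _"] power_add)
    also have "\<dots> = (fact (r + j) / fact j * (- 1) ^ j) * power_ratio p (b + j)"
      unfolding infsum_cmult_right' using infsum_powers(2)[of "b + j"] b by simp
    finally show ?thesis unfolding r by simp
  qed
  ultimately show ?thesis by simp
qed

end

section \<open>Occurrences as assignments of strings to external nodes\<close>

definition starts_with :: "'a stream \<Rightarrow> 'a list \<Rightarrow> bool" where
  "starts_with s w \<longleftrightarrow> stake (length w) s = w"

lemma starts_with_append:
  "starts_with s (u @ v) \<longleftrightarrow> starts_with s u \<and> starts_with (sdrop (length u) s) v"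
  unfolding starts_with_def length_append stake_add[symmetric] by (rule append_eq_append_conv) simp

lemma starts_with_prefix: "starts_with s v \<Longrightarrow> prefix u v \<Longrightarrow> starts_with s u"
  by (auto simp: prefix_def starts_with_append)

lemma starts_with_take: "starts_with s w \<Longrightarrow> l \<le> length w \<Longrightarrow> stake l s = take l w"
  unfolding starts_with_def by (metis min_absorb1 take_stake)

lemma starts_with_iff_prefix: "length w \<le> D \<Longrightarrow> starts_with s w \<longleftrightarrow> prefix w (stake D s)"
proof
  assume l: "length w \<le> D" and "starts_with s w"
  then have "w = take (length w) (stake D s)" by (simp add: starts_with_def take_stake min_absorb1)
  then show "prefix w (stake D s)" by (metis take_is_prefix)
next
  assume l: "length w \<le> D" and "prefix w (stake D s)"
  then have "w = take (length w) (stake D s)" by (auto simp: prefix_def)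
  then show "starts_with s w" using l by (simp add: starts_with_def take_stake min_absorb1)
qed

lemma starts_with_comparable: "starts_with s u \<Longrightarrow> starts_with s v \<Longrightarrow> prefix u v \<or> prefix v u"
  using starts_with_iff_prefix[of u "max (length u) (length v)" s] starts_with_iff_prefix[of v "max (length u) (length v)" s]
    prefix_same_cases by auto

lemma motif_antichain: "motif \<tau> T \<Longrightarrow> W \<in> T \<Longrightarrow> W' \<in> T \<Longrightarrow> prefix W W' \<Longrightarrow> W = W'"
  unfolding motif_def by blast

text \<open>
  A motif is the shape of every set of strings that continue its words, one string for each word: the antichain
  condition separates the strings, and the condition on \<open>butlast\<close> keeps the separation from happening earlier.
\<close>

lemma trie_shape_of_assignment:
  assumes T: "motif \<tau> T" and s: "\<And>W. W \<in> T \<Longrightarrow> starts_with (s W) W"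
  shows "trie_shape (s ` T) = T"
proof -
  have sep: "W = W'" if "W \<in> T" "W' \<in> T" "starts_with (s W') W" for W W'
    using starts_with_comparable[OF that(3) s[OF that(2)]] motif_antichain[OF T] that by blast
  have sub: "\<exists>s'\<in>s ` T - {s W}. stake l s' = stake l (s W)" if W: "W \<in> T" and l: "l < length W" for W l
  proof -
    obtain W' where W': "W' \<in> T" "W' \<noteq> W" "prefix (butlast W) W'" using T W unfolding motif_def by blast
    have "stake l (s W') = take l (butlast W)"
      using starts_with_prefix[OF s[OF W'(1)] W'(3)] l by (intro starts_with_take) auto
    moreover have "stake l (s W) = take l (butlast W)"
      using starts_with_prefix[OF s[OF W], of "butlast W"] l take_is_prefix[of "length W - 1" W]
      by (intro starts_with_take) (auto simp: butlast_conv_take)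
    moreover have "s W' \<noteq> s W" using sep[OF W W'(1)] s[OF W] W'(2) by auto
    ultimately show ?thesis using W' by auto
  qed
  have "W \<in> trie_shape (s ` T)" if W: "W \<in> T" for W
    unfolding trie_shape_def
    using W s[OF W] sub[OF W] sep[OF W] by (auto simp: starts_with_def)
  moreover have "u \<in> T" if "u \<in> trie_shape (s ` T)" for u
  proof -
    obtain W where W: "W \<in> T" and u: "stake (length u) (s W) = u"
      "\<And>s'. s' \<in> s ` T - {s W} \<Longrightarrow> stake (length u) s' \<noteq> u"
      "\<And>l. l < length u \<Longrightarrow> \<exists>s'\<in>s ` T - {s W}. stake l s' = stake l (s W)"
      using \<open>u \<in> trie_shape (s ` T)\<close> unfolding trie_shape_def by auto
    have "\<not> length u < length W" using sub[OF W, of "length u"] u(1,2) by auto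
    moreover have "\<not> length W < length u"
    proof
      assume "length W < length u"
      from u(3)[OF this] obtain W' where "W' \<in> T" "s W' \<noteq> s W" "stake (length W) (s W') = stake (length W) (s W)" by auto
      then show False using s[OF W] sep[OF W] by (auto simp: starts_with_def)
    qed
    ultimately have "length u = length W" by simp
    then show "u \<in> T" using u(1) s[OF W] W by (simp add: starts_with_def)
  qed
  ultimately show ?thesis by blast
qed

text \<open>
  The strings \<open>s 0, \<dots>, s (n - 1)\<close> fill the slots \<open>v k\<close>, the string numbered \<open>h k\<close> going through the
  node \<open>v k\<close>, while no other string passes through a node of \<open>V\<close>.
\<close>

definition fills :: "'k set \<Rightarrow> ('k \<Rightarrow> 'a list) \<Rightarrow> 'a list set \<Rightarrow> nat \<Rightarrow> (nat \<Rightarrow> 'a stream) \<Rightarrow> ('k \<Rightarrow> nat) \<Rightarrow> bool" where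
  "fills K v V n s h \<longleftrightarrow> (\<forall>k\<in>K. starts_with (s (h k)) (v k)) \<and>
     (\<forall>i<n. i \<notin> h ` K \<longrightarrow> (\<forall>r\<in>V. \<not> starts_with (s i) r))"

definition assignments :: "'k set \<Rightarrow> nat \<Rightarrow> ('k \<Rightarrow> nat) set" where
  "assignments K n = {h \<in> K \<rightarrow>\<^sub>E {..<n}. inj_on h K}"

lemma assignmentsI:
  assumes "\<And>k. k \<in> K \<Longrightarrow> h k < n" "inj_on h K"
  shows "restrict h K \<in> assignments K n"
  using assms unfolding assignments_def by (auto simp: inj_on_def)

lemma fills_restrict [simp]: "fills K v V n s (restrict h K) = fills K v V n s h"
  by (simp add: fills_def)

text \<open>
  Uniqueness makes the events for different assignments disjoint, so that their probabilities add up.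
\<close>

lemma fills_unique:
  assumes h: "h \<in> assignments K n" "fills K v V n s h" and h': "h' \<in> assignments K n" "fills K v V n s h'"
    and anti: "\<And>k k'. k \<in> K \<Longrightarrow> k' \<in> K \<Longrightarrow> prefix (v k) (v k') \<Longrightarrow> k = k'"
    and root: "\<And>k. k \<in> K \<Longrightarrow> \<exists>r\<in>V. prefix r (v k)"
  shows "h = h'"
proof (rule extensionalityI)
  show "h \<in> extensional K" "h' \<in> extensional K" using h(1) h'(1) by (auto simp: assignments_def PiE_def)
  fix k assume k: "k \<in> K"
  have s: "starts_with (s (h k)) (v k)" using h(2) k by (auto simp: fills_def)
  obtain r where r: "r \<in> V" "starts_with (s (h k)) r" using root[OF k] starts_with_prefix[OF s] by blast
  have "h k < n" using h(1) k by (auto simp: assignments_def)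
  then have "h k \<in> h' ` K" using h'(2) r by (auto simp: fills_def)
  then obtain k' where k': "k' \<in> K" "h k = h' k'" by auto
  then have "starts_with (s (h k)) (v k')" using h'(2) by (auto simp: fills_def)
  then have "k = k'" using starts_with_comparable[OF s] anti k k' by blast
  then show "h k = h' k" using k' by simp
qed

lemma occurrence_iff_fills:
  assumes T: "motif \<tau> T"
  shows "occurrence T s n w \<longleftrightarrow> (\<exists>f\<in>assignments T n. fills T ((@) w) {w} n s f)"
proof
  define I where "I = {i. i < n \<and> starts_with (s i) w}"
  have fin: "finite I" unfolding I_def by simp
  assume "occurrence T s n w"
  then have I: "card I = card T" "trie_shape ((\<lambda>i. sdrop (length w) (s i)) ` I) = T"
    unfolding occurrence_def Let_def I_def starts_with_def by auto
  have "\<exists>i\<in>I. starts_with (s i) (w @ W)" if "W \<in> T" for W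
  proof -
    have "W \<in> trie_shape ((\<lambda>i. sdrop (length w) (s i)) ` I)" using I(2) that by simp
    then obtain i where "i \<in> I" "starts_with (sdrop (length w) (s i)) W"
      unfolding trie_shape_def starts_with_def by auto
    then show ?thesis unfolding I_def by (auto simp: starts_with_append)
  qed
  then obtain f where f: "\<And>W. W \<in> T \<Longrightarrow> f W \<in> I" "\<And>W. W \<in> T \<Longrightarrow> starts_with (s (f W)) (w @ W)" by metis
  have inj: "inj_on f T"
  proof (rule inj_onI)
    fix W W' assume W: "W \<in> T" "W' \<in> T" "f W = f W'"
    then have "prefix (w @ W) (w @ W') \<or> prefix (w @ W') (w @ W)"
      using f(2)[of W] f(2)[of W'] starts_with_comparable by metis
    then show "W = W'" using motif_antichain[OF T] W by auto
  qed
  have "f ` T = I"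
    using fin f(1) I(1) card_image[OF inj] by (intro card_subset_eq) auto
  then have "fills T ((@) w) {w} n s f"
    unfolding fills_def using f(2) by (auto simp: I_def)
  moreover have "restrict f T \<in> assignments T n"
    using f(1) inj by (intro assignmentsI) (auto simp: I_def)
  ultimately show "\<exists>f\<in>assignments T n. fills T ((@) w) {w} n s f" by (intro bexI[of _ "restrict f T"]) auto
next
  assume "\<exists>f\<in>assignments T n. fills T ((@) w) {w} n s f"
  then obtain f where f: "f \<in> assignments T n" "fills T ((@) w) {w} n s f" by blast
  have inj: "inj_on f T" and lt: "\<And>W. W \<in> T \<Longrightarrow> f W < n" using f(1) by (auto simp: assignments_def)
  have I: "{i. i < n \<and> starts_with (s i) w} = f ` T"
    using f(2) lt unfolding fills_def by (auto simp: starts_with_append)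
  have "trie_shape ((\<lambda>W. sdrop (length w) (s (f W))) ` T) = T"
    using f(2) by (intro trie_shape_of_assignment[OF T]) (auto simp: fills_def starts_with_append)
  then show "occurrence T s n w"
    unfolding occurrence_def Let_def using I card_image[OF inj]
    by (simp add: starts_with_def image_image)
qed

lemma joint_occurrence_iff_fills:
  assumes T: "motif \<tau> T" and T': "motif \<tau>' T'" and inc: "\<not> prefix w w'" "\<not> prefix w' w"
  shows "occurrence T s n w \<and> occurrence T' s n w' \<longleftrightarrow>
    (\<exists>h\<in>assignments (T <+> T') n. fills (T <+> T') (case_sum ((@) w) ((@) w')) {w, w'} n s h)"
proof
  have no: "\<not> (starts_with t w \<and> starts_with t w')" for t using starts_with_comparable inc by blast
  assume "occurrence T s n w \<and> occurrence T' s n w'"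
  then obtain f g where f: "f \<in> assignments T n" "fills T ((@) w) {w} n s f"
    and g: "g \<in> assignments T' n" "fills T' ((@) w') {w'} n s g"
    using occurrence_iff_fills[OF T] occurrence_iff_fills[OF T'] by blast
  define h where "h = case_sum f g"
  have fw: "starts_with (s (f W)) w" if "W \<in> T" for W using f(2) that by (auto simp: fills_def starts_with_append)
  have gw: "starts_with (s (g W)) w'" if "W \<in> T'" for W using g(2) that by (auto simp: fills_def starts_with_append)
  have fg: "f W \<noteq> g W'" if "W \<in> T" "W' \<in> T'" for W W' using fw[OF that(1)] gw[OF that(2)] no by metis
  have injf: "inj_on f T" and injg: "inj_on g T'" using f(1) g(1) by (auto simp: assignments_def)
  have "inj_on h (T <+> T')"
  proof (rule inj_onI)
    fix a b assume "a \<in> T <+> T'" "b \<in> T <+> T'" "h a = h b"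
    then show "a = b"
      using fg fg[symmetric] by (cases a; cases b) (auto simp: h_def dest: inj_onD[OF injf] inj_onD[OF injg])
  qed
  then have "restrict h (T <+> T') \<in> assignments (T <+> T') n"
    using f(1) g(1) by (intro assignmentsI) (auto simp: h_def assignments_def)
  moreover have "fills (T <+> T') (case_sum ((@) w) ((@) w')) {w, w'} n s h"
    using f(2) g(2) unfolding fills_def h_def by (auto simp: Plus_def image_Un image_image)
  ultimately show "\<exists>h\<in>assignments (T <+> T') n. fills (T <+> T') (case_sum ((@) w) ((@) w')) {w, w'} n s h"
    by (intro bexI[of _ "restrict h (T <+> T')"]) auto
next
  have no: "\<not> (starts_with t w \<and> starts_with t w')" for t using starts_with_comparable inc by blast
  assume "\<exists>h\<in>assignments (T <+> T') n. fills (T <+> T') (case_sum ((@) w) ((@) w')) {w, w'} n s h"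
  then obtain h where h: "h \<in> assignments (T <+> T') n" "fills (T <+> T') (case_sum ((@) w) ((@) w')) {w, w'} n s h" by blast
  have slot: "starts_with (s (h k)) (case_sum ((@) w) ((@) w') k)" if "k \<in> T <+> T'" for k
    using h(2) that by (simp add: fills_def)
  have hT: "starts_with (s (h (Inl W))) (w @ W)" if "W \<in> T" for W using slot[of "Inl W"] that by auto
  have hT': "starts_with (s (h (Inr W))) (w' @ W)" if "W \<in> T'" for W using slot[of "Inr W"] that by auto
  have out: "\<not> starts_with (s i) w \<and> \<not> starts_with (s i) w'" if "i < n" "i \<notin> h ` (T <+> T')" for i
    using h(2) that by (auto simp: fills_def)
  have "fills T ((@) w) {w} n s (\<lambda>W. h (Inl W))"
    unfolding fills_def
  proof (intro conjI ballI allI impI)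
    fix i r assume i: "i < n" "i \<notin> (\<lambda>W. h (Inl W)) ` T" "r \<in> {w}"
    show "\<not> starts_with (s i) r"
    proof (cases "i \<in> (\<lambda>W. h (Inr W)) ` T'")
      case True
      then show ?thesis using hT' no[of "s i"] i by (auto simp: starts_with_append)
    next
      case False
      then show ?thesis using out[of i] i by (auto simp: Plus_def)
    qed
  qed (rule hT)
  moreover have "fills T' ((@) w') {w'} n s (\<lambda>W. h (Inr W))"
    unfolding fills_def
  proof (intro conjI ballI allI impI)
    fix i r assume i: "i < n" "i \<notin> (\<lambda>W. h (Inr W)) ` T'" "r \<in> {w'}"
    show "\<not> starts_with (s i) r"
    proof (cases "i \<in> (\<lambda>W. h (Inl W)) ` T")
      case True
      then show ?thesis using hT no[of "s i"] i by (auto simp: starts_with_append)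
    next
      case False
      then show ?thesis using out[of i] i by (auto simp: Plus_def)
    qed
  qed (rule hT')
  moreover have "restrict (\<lambda>W. h (Inl W)) T \<in> assignments T n" "restrict (\<lambda>W. h (Inr W)) T' \<in> assignments T' n"
    using h(1) by (auto intro!: assignmentsI simp: assignments_def inj_on_def)
  ultimately show "occurrence T s n w \<and> occurrence T' s n w'"
    using occurrence_iff_fills[OF T] occurrence_iff_fills[OF T'] fills_restrict by metis
qed

section \<open>Occurrences at comparable words\<close>

lemma trie_shape_append_iff:
  assumes "x \<noteq> y" "u @- x \<in> A" "u @- y \<in> A"
  shows "u @ W \<in> trie_shape A \<longleftrightarrow> W \<in> trie_shape {s. u @- s \<in> A}"
  using assms
proof (induction u arbitrary: A)
  case (Cons a u)
  have "a ## u @- x \<in> A" "a ## u @- y \<in> A" "a ## u @- x \<noteq> a ## u @- y" using Cons.prems by simp_all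
  then have ne: "A \<noteq> {}" "\<nexists>s. A = {s}" by (blast, metis singletonD)
  have "(a # u) @ W \<in> trie_shape A \<longleftrightarrow> u @ W \<in> trie_shape {s. a ## s \<in> A}"
    using trie_shape_Cons_iff[OF ne] by simp
  also have "\<dots> \<longleftrightarrow> W \<in> trie_shape {s. u @- s \<in> {s. a ## s \<in> A}}"
    using Cons.prems by (intro Cons.IH) auto
  finally show ?case by simp
qed simp

text \<open>
  The strings through \<open>w @ u\<close> are among the strings through \<open>w\<close>, so the lower shape is the subtree of the upper
  one at \<open>u\<close>.
\<close>

lemma nested_occurrences:
  assumes T': "motif \<tau>' T'" and occ: "occurrence T s n w" "occurrence T' s n (w @ u)"
  shows "{W. u @ W \<in> T} = T'"
proof -
  define I where "I v = {i. i < n \<and> starts_with (s i) v}" for v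
  define A where "A v = (\<lambda>i. sdrop (length v) (s i)) ` I v" for v
  have shape: "trie_shape (A w) = T" "trie_shape (A (w @ u)) = T'"
    using occ unfolding occurrence_def Let_def A_def I_def starts_with_def by auto
  have eq: "A (w @ u) = {x. u @- x \<in> A w}"
  proof (intro set_eqI iffI)
    fix x assume "x \<in> A (w @ u)"
    then obtain i where i: "i < n" "starts_with (s i) (w @ u)" "x = sdrop (length (w @ u)) (s i)"
      unfolding A_def I_def by auto
    have "stake (length u) (sdrop (length w) (s i)) = u"
      using i(2) by (simp only: starts_with_append) (simp add: starts_with_def)
    then have "u @- sdrop (length u) (sdrop (length w) (s i)) = sdrop (length w) (s i)"
      by (metis stake_sdrop)
    then have "u @- x = sdrop (length w) (s i)" using i(3) by simp
    then show "x \<in> {x. u @- x \<in> A w}" using i unfolding A_def I_def by (auto simp: starts_with_append)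
  next
    fix x assume "x \<in> {x. u @- x \<in> A w}"
    then obtain i where i: "i < n" "starts_with (s i) w" "u @- x = sdrop (length w) (s i)"
      unfolding A_def I_def by auto
    have "starts_with (sdrop (length w) (s i)) u" unfolding i(3)[symmetric] starts_with_def by (simp add: stake_shift)
    moreover have "x = sdrop (length (w @ u)) (s i)"
    proof -
      have "sdrop (length u) (u @- x) = x" by (simp add: sdrop_shift)
      then show ?thesis unfolding i(3) by simp
    qed
    ultimately show "x \<in> A (w @ u)" using i unfolding A_def I_def by (auto simp: starts_with_append)
  qed
  have "A (w @ u) \<noteq> {}" using shape(2) T' unfolding motif_def trie_shape_def by auto
  moreover have "\<nexists>x. A (w @ u) = {x}"
    using shape(2) T' trie_shape_Nil_iff[of "A (w @ u)"] unfolding motif_def by blast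
  ultimately obtain x y where xy: "x \<in> A (w @ u)" "y \<in> A (w @ u)" "x \<noteq> y" by blast
  then show ?thesis
    using trie_shape_append_iff[of x y u "A w"] shape unfolding eq by auto
qed

lemma motif_not_proper_subtree_of_itself:
  assumes T: "motif \<tau> T" and u: "{W. u @ W \<in> T} = T"
  shows "u = []"
proof -
  have fin: "finite T" "T \<noteq> {}" using T unfolding motif_def by auto
  obtain W where W: "W \<in> T" "\<And>W'. W' \<in> T \<Longrightarrow> length W' \<le> length W"
  proof -
    have "Max (length ` T) \<in> length ` T" using fin by (intro Max_in) auto
    then obtain W where "W \<in> T" "length W = Max (length ` T)" by auto
    with fin that show thesis by auto
  qed
  then have "u @ W \<in> T" using u by blast
  from W(2)[OF this] show ?thesis by simp
qed

text \<open>
  Different occurrences have different sets of strings below them. This crude bound provides the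
  integrability of the counts.
\<close>

lemma occurrences_bounded:
  assumes T: "motif \<tau> T"
  shows finite_occurrences: "finite {w. occurrence T s n w}" and card_occurrences_le: "card {w. occurrence T s n w} \<le> 2 ^ n"
proof -
  define I where "I w = {i. i < n \<and> starts_with (s i) w}" for w
  have inj: "inj_on I {w. occurrence T s n w}"
  proof (rule inj_onI)
    fix w w' assume w: "w \<in> {w. occurrence T s n w}" "w' \<in> {w. occurrence T s n w}" "I w = I w'"
    have "card (I w) \<ge> 2" using w T unfolding occurrence_def Let_def I_def starts_with_def motif_def by auto
    then obtain i where "i \<in> I w" by fastforce
    then have "starts_with (s i) w" "starts_with (s i) w'" using w(3) by (auto simp: I_def)
    then consider u where "w' = w @ u" | u where "w = w' @ u"
      using starts_with_comparable by (metis prefix_def)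
    then show "w = w'"
    proof cases
      case 1
      then have "{W. u @ W \<in> T} = T" using nested_occurrences[OF T] w by auto
      then show ?thesis using motif_not_proper_subtree_of_itself[OF T] 1 by auto
    next
      case 2
      then have "{W. u @ W \<in> T} = T" using nested_occurrences[OF T] w by auto
      then show ?thesis using motif_not_proper_subtree_of_itself[OF T] 2 by auto
    qed
  qed
  have sub: "I ` {w. occurrence T s n w} \<subseteq> Pow {..<n}" unfolding I_def by auto
  then have fin: "finite (I ` {w. occurrence T s n w})" by (rule finite_subset) simp
  then show "finite {w. occurrence T s n w}" using inj by (rule finite_imageD)
  have "card {w. occurrence T s n w} = card (I ` {w. occurrence T s n w})" by (rule card_image[OF inj, symmetric])
  also have "\<dots> \<le> card (Pow {..<n})" using sub by (intro card_mono) auto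
  finally show "card {w. occurrence T s n w} \<le> 2 ^ n" by (simp add: card_Pow)
qed

text \<open>
  For nonoverlapping motifs, or a motif and itself, nested occurrences are impossible. This is where
  the restriction on the pair of motifs enters.
\<close>

lemma comparable_occurrences:
  assumes T: "motif \<tau> T" and T': "motif \<tau>' T'" and "T = T' \<or> nonoverlapping T T'"
    and occ: "occurrence T s n w" "occurrence T' s n w'" and "prefix w w' \<or> prefix w' w"
  shows "T = T' \<and> w = w'"
proof -
  consider u where "w' = w @ u" | u where "w = w' @ u" using assms(6) by (auto simp: prefix_def)
  then show ?thesis
  proof cases
    case 1
    then have "{W. u @ W \<in> T} = T'" using nested_occurrences[OF T'] occ by blast
    with 1 assms(3) motif_not_proper_subtree_of_itself[OF T, of u] show ?thesis
      unfolding nonoverlapping_def appears_as_subtree_def by auto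
  next
    case 2
    then have "{W. u @ W \<in> T'} = T" using nested_occurrences[OF T] occ by blast
    with 2 assms(3) motif_not_proper_subtree_of_itself[OF T', of u] show ?thesis
      unfolding nonoverlapping_def appears_as_subtree_def by auto
  qed
qed

section \<open>Probabilities of occurrences\<close>

text \<open>
  The expected number of indices \<open>b\<close> with a random property is the sum of the probabilities. The
  exhaustion \<open>A\<close> reduces this to finite sums and dominated convergence.
\<close>

lemma (in finite_measure) has_sum_measure_of_counting:
  fixes A :: "nat \<Rightarrow> 'b set" and R :: "'b \<Rightarrow> 'a \<Rightarrow> bool"
  assumes fin: "\<And>n. finite (A n)" and mono: "\<And>n m. n \<le> m \<Longrightarrow> A n \<subseteq> A m" and ex: "\<And>b. \<exists>n. b \<in> A n"
    and meas: "\<And>b. {\<omega> \<in> space M. R b \<omega>} \<in> sets M"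
    and finR: "\<And>\<omega>. finite {b. R b \<omega>}" and bound: "\<And>\<omega>. real (card {b. R b \<omega>}) \<le> B"
  shows "integrable M (\<lambda>\<omega>. real (card {b. R b \<omega>}))"
    and "((\<lambda>b. measure M {\<omega> \<in> space M. R b \<omega>}) has_sum (LINT \<omega>|M. real (card {b. R b \<omega>}))) UNIV"
proof -
  define N where "N n \<omega> = (\<Sum>b\<in>A n. indicator {\<omega> \<in> space M. R b \<omega>} \<omega> :: real)" for n \<omega>
  have N_eq: "N n \<omega> = real (card {b \<in> A n. R b \<omega>})" if "\<omega> \<in> space M" for n \<omega>
    unfolding N_def using fin that by (simp add: indicator_def sum.If_cases Int_def)
  have N_meas: "N n \<in> borel_measurable M" for n
    unfolding N_def using meas by (intro borel_measurable_sum borel_measurable_indicator)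
  have lim: "(\<lambda>n. N n \<omega>) \<longlonglongrightarrow> real (card {b. R b \<omega>})" if w: "\<omega> \<in> space M" for \<omega>
  proof -
    have "eventually (\<lambda>n. {b. R b \<omega>} \<subseteq> A n) sequentially"
      using filterlim_exhaustion[of A, OF fin mono ex] finR[of \<omega>] unfolding filterlim_finite_subsets_at_top
      by (simp add: eventually_conj_iff)
    then have "eventually (\<lambda>n. N n \<omega> = real (card {b. R b \<omega>})) sequentially"
    proof eventually_elim
      case (elim n)
      then have "{b \<in> A n. R b \<omega>} = {b. R b \<omega>}" by auto
      then show ?case using N_eq[OF w] by simp
    qed
    then show ?thesis by (rule tendsto_eventually)
  qed
  have N_le: "norm (N n \<omega>) \<le> B" if w: "\<omega> \<in> space M" for n \<omega>
  proof -
    have "card {b \<in> A n. R b \<omega>} \<le> card {b. R b \<omega>}" using finR by (intro card_mono) auto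
    then show ?thesis using bound[of \<omega>] N_eq[OF w] by simp
  qed
  have X_meas: "(\<lambda>\<omega>. real (card {b. R b \<omega>})) \<in> borel_measurable M"
    by (rule borel_measurable_LIMSEQ_real[OF lim N_meas])
  show "integrable M (\<lambda>\<omega>. real (card {b. R b \<omega>}))"
    using bound by (intro integrable_const_bound[where B = B] X_meas AE_I2) auto
  have "(\<lambda>n. LINT \<omega>|M. N n \<omega>) \<longlonglongrightarrow> (LINT \<omega>|M. real (card {b. R b \<omega>}))"
    by (rule integral_dominated_convergence[where w = "\<lambda>_. B"]) (use X_meas N_meas lim N_le in auto)
  moreover have "(LINT \<omega>|M. N n \<omega>) = (\<Sum>b\<in>A n. measure M {\<omega> \<in> space M. R b \<omega>})" for n
  proof -
    have "integrable M (indicator {\<omega> \<in> space M. R b \<omega>} :: _ \<Rightarrow> real)" for b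
      using meas[of b] by (intro integrable_real_indicator) (auto simp: less_top[symmetric])
    then show ?thesis
      unfolding N_def using meas
      by (subst Bochner_Integration.integral_sum) (auto simp: Int_absorb2 sets.sets_into_space intro!: sum.cong)
  qed
  ultimately show "((\<lambda>b. measure M {\<omega> \<in> space M. R b \<omega>}) has_sum (LINT \<omega>|M. real (card {b. R b \<omega>}))) UNIV"
    by (intro has_sum_of_exhaustion[of A, OF fin mono ex]) auto
qed

definition falling :: "nat \<Rightarrow> nat \<Rightarrow> real" where
  "falling n k = real (\<Prod>i=0..<k. n - i)"

lemma card_assignments:
  assumes "finite K"
  shows "real (card (assignments K n)) = falling n (card K)"
  using card_inj_on_subset_funcset[OF assms finite_lessThan[of n] subset_refl]
  by (simp add: assignments_def falling_def)

lemma falling_self: "falling n n = fact n"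
proof -
  have "(\<Prod>i=0..<n. n - i) = (\<Prod>i=1..n. i)"
    by (rule prod.reindex_bij_witness[of _ "\<lambda>i. n - i" "\<lambda>i. n - i"]) auto
  then show ?thesis unfolding falling_def by (simp only: fact_prod)
qed

lemma finite_assignments: "finite K \<Longrightarrow> finite (assignments K n)"
  unfolding assignments_def by (rule finite_subset[of _ "K \<rightarrow>\<^sub>E {..<n}"]) (auto intro: finite_PiE)

lemma word_prob_nth: "word_prob p u = (\<Prod>k<length u. p (u ! k))"
  by (induction u) (simp_all add: prod.lessThan_Suc_shift del: prod.lessThan_Suc)

lemma has_sum_product:
  fixes f :: "'b \<Rightarrow> real" and g :: "'c \<Rightarrow> real"
  assumes f: "(f has_sum a) UNIV" and g: "(g has_sum b) UNIV"
  shows "((\<lambda>(x, y). f x * g y) has_sum a * b) UNIV"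
proof -
  have absf: "(\<lambda>x. \<bar>f x\<bar>) summable_on UNIV" and absg: "(\<lambda>y. \<bar>g y\<bar>) summable_on UNIV"
    using f g summable_on_iff_abs_summable_on_real by (auto dest!: has_sum_imp_summable)
  have "(\<lambda>(x, y). norm (f x * g y)) summable_on UNIV \<times> UNIV"
  proof (rule summable_on_SigmaI)
    show "((\<lambda>y. case (x, y) of (x, y) \<Rightarrow> norm (f x * g y)) has_sum \<bar>f x\<bar> * (\<Sum>\<^sub>\<infinity>y. \<bar>g y\<bar>)) UNIV" for x
      using has_sum_cmult_right[OF has_sum_infsum[OF absg], of "\<bar>f x\<bar>"] by (simp add: abs_mult)
    show "(\<lambda>x. \<bar>f x\<bar> * (\<Sum>\<^sub>\<infinity>y. \<bar>g y\<bar>)) summable_on UNIV"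
      by (rule summable_on_cmult_left[OF absf])
  qed auto
  then have "(\<lambda>(x, y). f x * g y) summable_on UNIV \<times> UNIV"
    by (subst summable_on_iff_abs_summable_on_real) (simp add: case_prod_unfold)
  then have "((\<lambda>(x, y). f x * g y) has_sum a * b) (UNIV \<times> UNIV)"
  proof (rule has_sum_SigmaI[rotated 2])
    show "((\<lambda>y. case (x, y) of (x, y) \<Rightarrow> f x * g y) has_sum f x * b) UNIV" for x
      using has_sum_cmult_right[OF g, of "f x"] by simp
    show "((\<lambda>x. f x * b) has_sum a * b) UNIV" by (rule has_sum_cmult_left[OF f])
  qed
  then show ?thesis by simp
qed

context letter_probs
begin

lemma sum_P_length: "(\<Sum>v | length v = D. P v) = 1"
proof (induction D)
  case (Suc D)
  have eq: "{v :: 'a list. length v = Suc D} = (\<Union>a. (#) a ` {v. length v = D})"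
    by (auto simp: length_Suc_conv image_iff)
  have fin: "finite {v :: 'a list. length v = D}"
    by (rule finite_subset[OF _ finite_short_words[of "Suc D"]]) auto
  have "(\<Sum>v | length v = Suc D. P v) = (\<Sum>a\<in>UNIV. \<Sum>v\<in>(#) a ` {v. length v = D}. P v)"
    unfolding eq using fin by (intro sum.UNION_disjoint) auto
  also have "\<dots> = (\<Sum>a\<in>UNIV. p a * (\<Sum>v | length v = D. P v))"
    by (simp add: sum.reindex sum_distrib_left)
  finally show ?case using Suc by (simp add: p_sum)
qed simp

lemma sum_P_extensions:
  assumes "length u \<le> D"
  shows "(\<Sum>v | length v = D \<and> prefix u v. P v) = P u"
proof -
  have eq: "{v. length v = D \<and> prefix u v} = (@) u ` {v. length v = D - length u}"
    using assms by (auto simp: prefix_def image_iff)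
  show ?thesis unfolding eq by (simp add: sum.reindex inj_on_def sum_distrib_left[symmetric] sum_P_length)
qed

end

locale random_strings = letter_probs p + prob_space M
  for p :: "'a::finite \<Rightarrow> real" and M :: "'w measure" +
  fixes S :: "nat \<Rightarrow> 'w \<Rightarrow> 'a stream"
  assumes indep: "indep_vars (\<lambda>_. count_space UNIV) (\<lambda>(i, k) \<omega>. S i \<omega> !! k) (UNIV :: (nat \<times> nat) set)"
    and letters: "\<And>i k a. measure M {\<omega> \<in> space M. S i \<omega> !! k = a} = p a"
begin

lemma prob_prefixes:
  assumes v: "\<And>i. i < n \<Longrightarrow> length (v i) = D"
  shows "{\<omega> \<in> space M. \<forall>i<n. stake D (S i \<omega>) = v i} \<in> sets M"
    and "prob {\<omega> \<in> space M. \<forall>i<n. stake D (S i \<omega>) = v i} = (\<Prod>i<n. P (v i))"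
proof -
  have rv: "(\<lambda>\<omega>. S i \<omega> !! k) \<in> measurable M (count_space UNIV)" for i k
  proof -
    have "\<forall>j\<in>UNIV. (case j of (i, k) \<Rightarrow> \<lambda>\<omega>. S i \<omega> !! k) \<in> measurable M (count_space UNIV)"
      using indep unfolding indep_vars_def by blast
    from bspec[OF this, of "(i, k)"] show ?thesis by simp
  qed
  have stake_eq: "stake D s = u \<longleftrightarrow> (\<forall>k<D. s !! k = u ! k)" if "length u = D" for s :: "'a stream" and u
    using that by (auto simp: list_eq_iff_nth_eq stake_nth)
  define J where "J = {..<n} \<times> {..<D}"
  have eq: "{\<omega> \<in> space M. \<forall>i<n. stake D (S i \<omega>) = v i}
      = {\<omega> \<in> space M. \<forall>j\<in>J. S (fst j) \<omega> !! snd j = v (fst j) ! snd j}"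
    unfolding J_def using stake_eq[OF v] by auto
  show "{\<omega> \<in> space M. \<forall>i<n. stake D (S i \<omega>) = v i} \<in> sets M"
    unfolding eq using rv by (intro sets.sets_Collect_finite_All) (auto simp: J_def intro!: measurable_sets_Collect)
  have P_nth: "P u = (\<Prod>k<D. p (u ! k))" if "length u = D" for u
    using that by (simp add: word_prob_nth)
  have "prob {\<omega> \<in> space M. \<forall>j\<in>J. S (fst j) \<omega> !! snd j = v (fst j) ! snd j} = (\<Prod>j\<in>J. p (v (fst j) ! snd j))"
  proof (cases "J = {}")
    case True
    then show ?thesis by (simp add: prob_space)
  next
    case False
    have "prob (\<Inter>j\<in>J. (case j of (i, k) \<Rightarrow> \<lambda>\<omega>. S i \<omega> !! k) -` {v (fst j) ! snd j} \<inter> space M)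
        = (\<Prod>j\<in>J. prob ((case j of (i, k) \<Rightarrow> \<lambda>\<omega>. S i \<omega> !! k) -` {v (fst j) ! snd j} \<inter> space M))"
      using indep False by (rule indep_varsD) (auto simp: J_def)
    moreover have "(\<Inter>j\<in>J. (case j of (i, k) \<Rightarrow> \<lambda>\<omega>. S i \<omega> !! k) -` {v (fst j) ! snd j} \<inter> space M)
        = {\<omega> \<in> space M. \<forall>j\<in>J. S (fst j) \<omega> !! snd j = v (fst j) ! snd j}"
      using False by (auto simp: case_prod_unfold)
    moreover have "(case j of (i, k) \<Rightarrow> \<lambda>\<omega>. S i \<omega> !! k) -` {v (fst j) ! snd j} \<inter> space M
        = {\<omega> \<in> space M. S (fst j) \<omega> !! snd j = v (fst j) ! snd j}" for j
      by (auto simp: case_prod_unfold)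
    ultimately show ?thesis by (simp add: letters)
  qed
  also have "\<dots> = (\<Prod>i<n. \<Prod>k<D. p (v i ! k))"
    unfolding J_def by (simp add: prod.cartesian_product case_prod_unfold)
  also have "\<dots> = (\<Prod>i<n. P (v i))" using P_nth[OF v] by simp
  finally show "prob {\<omega> \<in> space M. \<forall>i<n. stake D (S i \<omega>) = v i} = (\<Prod>i<n. P (v i))" unfolding eq .
qed

text \<open>
  Events about prefixes of a common length \<open>D\<close> are finite unions of the events of \<open>prob_prefixes\<close>.
\<close>

lemma prob_prefix_classes:
  assumes E: "\<And>i. i < n \<Longrightarrow> E i \<subseteq> {v. length v = D}"
  shows "{\<omega> \<in> space M. \<forall>i<n. stake D (S i \<omega>) \<in> E i} \<in> sets M"
    and "prob {\<omega> \<in> space M. \<forall>i<n. stake D (S i \<omega>) \<in> E i} = (\<Prod>i<n. \<Sum>v\<in>E i. P v)"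
proof -
  define C where "C v = {\<omega> \<in> space M. \<forall>i<n. stake D (S i \<omega>) = v i}" for v
  have fin: "finite (E i)" if "i < n" for i
    by (rule finite_subset[OF E[OF that]], rule finite_subset[OF _ finite_short_words[of "Suc D"]]) auto
  have finPi: "finite (PiE {..<n} E)" using fin by (intro finite_PiE) auto
  have eq: "{\<omega> \<in> space M. \<forall>i<n. stake D (S i \<omega>) \<in> E i} = (\<Union>v\<in>PiE {..<n} E. C v)"
  proof (intro set_eqI iffI)
    fix \<omega> assume w: "\<omega> \<in> {\<omega> \<in> space M. \<forall>i<n. stake D (S i \<omega>) \<in> E i}"
    then have "restrict (\<lambda>i. stake D (S i \<omega>)) {..<n} \<in> PiE {..<n} E"
      "\<omega> \<in> C (restrict (\<lambda>i. stake D (S i \<omega>)) {..<n})" by (auto simp: C_def)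
    then show "\<omega> \<in> (\<Union>v\<in>PiE {..<n} E. C v)" by blast
  qed (auto simp: C_def)
  have len: "length (v i) = D" if "v \<in> PiE {..<n} E" "i < n" for v i
    using that E[of i] PiE_mem[OF that(1), of i] by auto
  have C_sets: "C v \<in> sets M" if "v \<in> PiE {..<n} E" for v
    unfolding C_def by (rule prob_prefixes(1)) (use len that in auto)
  show "{\<omega> \<in> space M. \<forall>i<n. stake D (S i \<omega>) \<in> E i} \<in> sets M"
    unfolding eq using finPi C_sets by (intro sets.finite_UN) auto
  have "prob (\<Union>v\<in>PiE {..<n} E. C v) = (\<Sum>v\<in>PiE {..<n} E. prob (C v))"
  proof (rule finite_measure_finite_Union[OF finPi])
    show "disjoint_family_on C (PiE {..<n} E)"
      unfolding disjoint_family_on_def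
    proof (intro ballI impI)
      fix u v assume uv: "u \<in> PiE {..<n} E" "v \<in> PiE {..<n} E" "u \<noteq> v"
      then obtain i where "i < n" "u i \<noteq> v i" by (metis PiE_ext lessThan_iff)
      then show "C u \<inter> C v = {}" by (auto simp: C_def)
    qed
  qed (use C_sets in auto)
  also have "\<dots> = (\<Sum>v\<in>PiE {..<n} E. \<Prod>i<n. P (v i))"
    unfolding C_def by (intro sum.cong refl prob_prefixes(2)) (use len in auto)
  also have "\<dots> = (\<Prod>i<n. \<Sum>v\<in>E i. P v)"
    using fin by (subst prod_sum_PiE) auto
  finally show "prob {\<omega> \<in> space M. \<forall>i<n. stake D (S i \<omega>) \<in> E i} = (\<Prod>i<n. \<Sum>v\<in>E i. P v)" unfolding eq .
qed

text \<open>
  Cutting all strings at a common length \<open>D\<close> makes the event a product: a string assigned to \<open>v k\<close> is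
  required to extend it, any other string to avoid the nodes of \<open>V\<close>, which are disjoint events for different
  nodes.
\<close>

lemma prob_fills:
  assumes K: "finite K" and V: "finite V" and h: "h \<in> assignments K n"
    and anti: "\<And>r r'. r \<in> V \<Longrightarrow> r' \<in> V \<Longrightarrow> prefix r r' \<Longrightarrow> r = r'"
  shows "{\<omega> \<in> space M. fills K v V n (\<lambda>i. S i \<omega>) h} \<in> sets M"
    and "prob {\<omega> \<in> space M. fills K v V n (\<lambda>i. S i \<omega>) h} = (\<Prod>k\<in>K. P (v k)) * (1 - (\<Sum>r\<in>V. P r)) ^ (n - card K)"
proof -
  define D where "D = Max (insert 0 (length ` (v ` K \<union> V)))"
  have D: "length u \<le> D" if "u \<in> v ` K \<union> V" for u unfolding D_def using K V that by (intro Max_ge) auto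
  have inj: "inj_on h K" and lt: "\<And>k. k \<in> K \<Longrightarrow> h k < n" using h by (auto simp: assignments_def)
  define E where "E i = (if i \<in> h ` K then {u. length u = D \<and> prefix (v (inv_into K h i)) u}
      else {u. length u = D \<and> (\<forall>r\<in>V. \<not> prefix r u)})" for i
  have eq: "{\<omega> \<in> space M. fills K v V n (\<lambda>i. S i \<omega>) h} = {\<omega> \<in> space M. \<forall>i<n. stake D (S i \<omega>) \<in> E i}"
  proof -
    have "fills K v V n s h \<longleftrightarrow> (\<forall>i<n. stake D (s i) \<in> E i)" for s :: "nat \<Rightarrow> 'a stream"
    proof
      assume f: "fills K v V n s h"
      show "\<forall>i<n. stake D (s i) \<in> E i"
      proof (intro allI impI)
        fix i assume i: "i < n"
        show "stake D (s i) \<in> E i"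
        proof (cases "i \<in> h ` K")
          case True
          then obtain k where k: "k \<in> K" "i = h k" by auto
          then have "prefix (v k) (stake D (s i))"
            using f D[of "v k"] starts_with_iff_prefix[of "v k" D "s i"] by (auto simp: fills_def)
          then show ?thesis using k inj unfolding E_def by simp
        next
          case False
          have "\<not> prefix r (stake D (s i))" if "r \<in> V" for r
            using f i False that D[of r] starts_with_iff_prefix[of r D "s i"] by (auto simp: fills_def)
          then show ?thesis using False unfolding E_def by simp
        qed
      qed
    next
      assume a: "\<forall>i<n. stake D (s i) \<in> E i"
      have "starts_with (s (h k)) (v k)" if "k \<in> K" for k
        using a[rule_format, OF lt[OF that]] that inj D[of "v k"] by (auto simp: E_def starts_with_iff_prefix)
      moreover have "\<not> starts_with (s i) r" if "i < n" "i \<notin> h ` K" "r \<in> V" for i r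
        using a[rule_format, OF that(1)] that D[of r] by (auto simp: E_def starts_with_iff_prefix)
      ultimately show "fills K v V n s h" by (simp add: fills_def)
    qed
    then show ?thesis by simp
  qed
  have E: "\<And>i. i < n \<Longrightarrow> E i \<subseteq> {v. length v = D}" unfolding E_def by auto
  show "{\<omega> \<in> space M. fills K v V n (\<lambda>i. S i \<omega>) h} \<in> sets M" unfolding eq by (rule prob_prefix_classes(1)[OF E])
  have fin: "finite {u :: 'a list. length u = D}" by (rule finite_subset[OF _ finite_short_words[of "Suc D"]]) auto
  have in_K: "(\<Sum>u\<in>E (h k). P u) = P (v k)" if "k \<in> K" for k
    unfolding E_def using that inj sum_P_extensions[OF D[of "v k"]] by simp
  have out_K: "(\<Sum>u\<in>E i. P u) = 1 - (\<Sum>r\<in>V. P r)" if "i \<notin> h ` K" for i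
  proof -
    have U: "(\<Union>r\<in>V. {u. length u = D \<and> prefix r u}) \<subseteq> {u. length u = D}" by auto
    have "E i = {u. length u = D} - (\<Union>r\<in>V. {u. length u = D \<and> prefix r u})"
      unfolding E_def using that by auto
    then have "(\<Sum>u\<in>E i. P u) = 1 - (\<Sum>u\<in>(\<Union>r\<in>V. {u. length u = D \<and> prefix r u}). P u)"
      using sum_diff[OF fin U, of P] sum_P_length[of D] by simp
    also have "(\<Sum>u\<in>(\<Union>r\<in>V. {u. length u = D \<and> prefix r u}). P u) = (\<Sum>r\<in>V. \<Sum>u | length u = D \<and> prefix r u. P u)"
    proof (rule sum.UNION_disjoint[OF V])
      show "\<forall>r\<in>V. finite {u. length u = D \<and> prefix r u}" using fin by (auto intro: finite_subset[OF _ fin])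
      show "\<forall>r\<in>V. \<forall>r'\<in>V. r \<noteq> r' \<longrightarrow> {u. length u = D \<and> prefix r u} \<inter> {u. length u = D \<and> prefix r' u} = {}"
        using anti prefix_same_cases by blast
    qed
    also have "\<dots> = (\<Sum>r\<in>V. P r)" using D by (intro sum.cong refl sum_P_extensions) auto
    finally show ?thesis .
  qed
  have "prob {\<omega> \<in> space M. fills K v V n (\<lambda>i. S i \<omega>) h} = (\<Prod>i<n. \<Sum>u\<in>E i. P u)"
    unfolding eq by (rule prob_prefix_classes(2)[OF E])
  also have "\<dots> = (\<Prod>i\<in>h ` K. \<Sum>u\<in>E i. P u) * (\<Prod>i\<in>{..<n} - h ` K. \<Sum>u\<in>E i. P u)"
    using lt by (subst prod.subset_diff[of "h ` K"]) (auto simp: mult.commute)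
  also have "(\<Prod>i\<in>h ` K. \<Sum>u\<in>E i. P u) = (\<Prod>k\<in>K. P (v k))"
    using inj in_K by (simp add: prod.reindex)
  also have "(\<Prod>i\<in>{..<n} - h ` K. \<Sum>u\<in>E i. P u) = (1 - (\<Sum>r\<in>V. P r)) ^ (n - card K)"
  proof -
    have "card ({..<n} - h ` K) = n - card K"
      using lt K card_image[OF inj] by (subst card_Diff_subset) auto
    then show ?thesis using out_K by simp
  qed
  finally show "prob {\<omega> \<in> space M. fills K v V n (\<lambda>i. S i \<omega>) h} = (\<Prod>k\<in>K. P (v k)) * (1 - (\<Sum>r\<in>V. P r)) ^ (n - card K)" .
qed

lemma prob_exists_filling:
  assumes K: "finite K" and V: "finite V"
    and anti: "\<And>r r'. r \<in> V \<Longrightarrow> r' \<in> V \<Longrightarrow> prefix r r' \<Longrightarrow> r = r'"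
    and anti_v: "\<And>k k'. k \<in> K \<Longrightarrow> k' \<in> K \<Longrightarrow> prefix (v k) (v k') \<Longrightarrow> k = k'"
    and root: "\<And>k. k \<in> K \<Longrightarrow> \<exists>r\<in>V. prefix r (v k)"
  shows "{\<omega> \<in> space M. \<exists>h\<in>assignments K n. fills K v V n (\<lambda>i. S i \<omega>) h} \<in> sets M"
    and "prob {\<omega> \<in> space M. \<exists>h\<in>assignments K n. fills K v V n (\<lambda>i. S i \<omega>) h}
      = falling n (card K) * (\<Prod>k\<in>K. P (v k)) * (1 - (\<Sum>r\<in>V. P r)) ^ (n - card K)"
proof -
  define C where "C h = {\<omega> \<in> space M. fills K v V n (\<lambda>i. S i \<omega>) h}" for h
  have eq: "{\<omega> \<in> space M. \<exists>h\<in>assignments K n. fills K v V n (\<lambda>i. S i \<omega>) h} = (\<Union>h\<in>assignments K n. C h)"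
    by (auto simp: C_def)
  have C_sets: "C h \<in> sets M" if "h \<in> assignments K n" for h
    unfolding C_def by (rule prob_fills(1)[OF K V that anti])
  show "{\<omega> \<in> space M. \<exists>h\<in>assignments K n. fills K v V n (\<lambda>i. S i \<omega>) h} \<in> sets M"
    unfolding eq using finite_assignments[OF K] C_sets by (intro sets.finite_UN) auto
  have "prob (\<Union>h\<in>assignments K n. C h) = (\<Sum>h\<in>assignments K n. prob (C h))"
  proof (rule finite_measure_finite_Union[OF finite_assignments[OF K]])
    show "disjoint_family_on C (assignments K n)"
      unfolding disjoint_family_on_def
    proof (intro ballI impI)
      fix h h' assume h: "h \<in> assignments K n" "h' \<in> assignments K n" "h \<noteq> h'"
      have "\<not> (fills K v V n s h \<and> fills K v V n s h')" for s
      proof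
        assume "fills K v V n s h \<and> fills K v V n s h'"
        then have "h = h'" using h by (intro fills_unique[of h K n v V s h'] anti_v root) auto
        then show False using h by simp
      qed
      then show "C h \<inter> C h' = {}" by (auto simp: C_def)
    qed
  qed (use C_sets in auto)
  also have "\<dots> = (\<Sum>h\<in>assignments K n. (\<Prod>k\<in>K. P (v k)) * (1 - (\<Sum>r\<in>V. P r)) ^ (n - card K))"
    unfolding C_def by (intro sum.cong refl prob_fills(2)[OF K V _ anti])
  also have "\<dots> = falling n (card K) * (\<Prod>k\<in>K. P (v k)) * (1 - (\<Sum>r\<in>V. P r)) ^ (n - card K)"
    by (simp add: card_assignments[OF K])
  finally show "prob {\<omega> \<in> space M. \<exists>h\<in>assignments K n. fills K v V n (\<lambda>i. S i \<omega>) h}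
      = falling n (card K) * (\<Prod>k\<in>K. P (v k)) * (1 - (\<Sum>r\<in>V. P r)) ^ (n - card K)" unfolding eq .
qed

abbreviation Q :: "'a list set \<Rightarrow> real" where "Q \<equiv> shape_functional M S"

context
  fixes \<tau> :: nat and T :: "'a list set"
  assumes T: "motif \<tau> T"
begin

lemma motif_finite: "finite T" "card T = \<tau>" "\<tau> \<ge> 2"
  using T by (auto simp: motif_def)

lemma prob_occurrence_letters:
  shows occurrence_sets: "{\<omega> \<in> space M. occurrence T (\<lambda>i. S i \<omega>) n w} \<in> sets M"
    and "prob {\<omega> \<in> space M. occurrence T (\<lambda>i. S i \<omega>) n w}
      = falling n \<tau> * (\<Prod>W\<in>T. P (w @ W)) * (1 - P w) ^ (n - \<tau>)"
proof -
  have anti: "\<And>k k'. k \<in> T \<Longrightarrow> k' \<in> T \<Longrightarrow> prefix (w @ k) (w @ k') \<Longrightarrow> k = k'"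
    using motif_antichain[OF T] by auto
  show "{\<omega> \<in> space M. occurrence T (\<lambda>i. S i \<omega>) n w} \<in> sets M"
    unfolding occurrence_iff_fills[OF T]
    by (rule prob_exists_filling(1)[OF motif_finite(1) _ _ anti]) auto
  have "prob {\<omega> \<in> space M. \<exists>f\<in>assignments T n. fills T ((@) w) {w} n (\<lambda>i. S i \<omega>) f}
      = falling n (card T) * (\<Prod>W\<in>T. P (w @ W)) * (1 - (\<Sum>r\<in>{w}. P r)) ^ (n - card T)"
    by (rule prob_exists_filling(2)[OF motif_finite(1) _ _ anti]) auto
  then show "prob {\<omega> \<in> space M. occurrence T (\<lambda>i. S i \<omega>) n w}
      = falling n \<tau> * (\<Prod>W\<in>T. P (w @ W)) * (1 - P w) ^ (n - \<tau>)"
    unfolding occurrence_iff_fills[OF T] using motif_finite by simp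
qed

text \<open>
  With \<open>n = \<tau>\<close> strings and the empty word, an occurrence means that the whole trie has shape \<open>T\<close>.
\<close>

lemma shape_functional_eq: "Q T = fact \<tau> * (\<Prod>W\<in>T. P W)"
proof -
  have "Q T = prob {\<omega> \<in> space M. occurrence T (\<lambda>i. S i \<omega>) \<tau> []}"
    unfolding shape_functional_def occurrence_def Let_def
    using motif_finite by (intro arg_cong[where f = prob]) (auto simp: lessThan_def)
  then show ?thesis using prob_occurrence_letters(2)[of \<tau> "[]"] by (simp add: falling_self)
qed

lemma prob_occurrence:
  "prob {\<omega> \<in> space M. occurrence T (\<lambda>i. S i \<omega>) n w}
    = Q T * (falling n \<tau> * P w ^ \<tau> * (1 - P w) ^ (n - \<tau>) / fact \<tau>)"
  unfolding prob_occurrence_letters(2) shape_functional_eq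
  using motif_finite by (simp add: prod.distrib)

end

lemma prob_joint_occurrence:
  assumes T: "motif \<tau> T" and T': "motif \<tau>' T'" and inc: "\<not> prefix w w'" "\<not> prefix w' w"
  shows "prob {\<omega> \<in> space M. occurrence T (\<lambda>i. S i \<omega>) n w \<and> occurrence T' (\<lambda>i. S i \<omega>) n w'}
    = Q T * Q T' * (falling n (\<tau> + \<tau>') * P w ^ \<tau> * P w' ^ \<tau>' * (1 - P w - P w') ^ (n - (\<tau> + \<tau>')) / (fact \<tau> * fact \<tau>'))"
proof -
  let ?v = "case_sum ((@) w) ((@) w')"
  have fin: "finite (T <+> T')" and card: "card (T <+> T') = \<tau> + \<tau>'"
    using motif_finite[OF T] motif_finite[OF T'] by (auto simp: card_Plus)
  have no: "\<not> prefix (w @ u) (w' @ u')" "\<not> prefix (w' @ u') (w @ u)" for u u'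
    using inc by (metis append_prefixD prefix_append prefix_order.trans prefix_same_cases)+
  have neq: "w \<noteq> w'" using inc by auto
  have "prob {\<omega> \<in> space M. \<exists>h\<in>assignments (T <+> T') n. fills (T <+> T') ?v {w, w'} n (\<lambda>i. S i \<omega>) h}
      = falling n (card (T <+> T')) * (\<Prod>k\<in>T <+> T'. P (?v k)) * (1 - (\<Sum>r\<in>{w, w'}. P r)) ^ (n - card (T <+> T'))"
  proof (rule prob_exists_filling(2)[OF fin])
    show "r = r'" if "r \<in> {w, w'}" "r' \<in> {w, w'}" "prefix r r'" for r r' using that inc by auto
    show "k = k'" if "k \<in> T <+> T'" "k' \<in> T <+> T'" "prefix (?v k) (?v k')" for k k'
      using that no motif_antichain[OF T] motif_antichain[OF T'] by (cases k; cases k') auto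
    show "\<exists>r\<in>{w, w'}. prefix r (?v k)" for k by (cases k) auto
  qed simp
  also have "(\<Prod>k\<in>T <+> T'. P (?v k)) = (\<Prod>W\<in>T. P (w @ W)) * (\<Prod>W\<in>T'. P (w' @ W))"
    using motif_finite(1)[OF T] motif_finite(1)[OF T'] by (simp add: prod.Plus)
  also have "\<dots> = P w ^ \<tau> * P w' ^ \<tau>' * ((\<Prod>W\<in>T. P W) * (\<Prod>W\<in>T'. P W))"
    using motif_finite(2)[OF T] motif_finite(2)[OF T'] by (simp add: prod.distrib)
  also have "(\<Sum>r\<in>{w, w'}. P r) = P w + P w'" using neq by simp
  finally show ?thesis
    unfolding joint_occurrence_iff_fills[OF T T' inc] card shape_functional_eq[OF T] shape_functional_eq[OF T']
    by (simp add: algebra_simps)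
qed

text \<open>Moments are sums of probabilities over words and pairs of words; here the numbers of occurrences enter.\<close>

lemma motif_count_moments:
  assumes T: "motif \<tau> T" and T': "motif \<tau>' T'"
  shows integrable_motif_count: "integrable M (motif_count S T n)"
    and "((\<lambda>w. prob {\<omega> \<in> space M. occurrence T (\<lambda>i. S i \<omega>) n w}) has_sum expectation (motif_count S T n)) UNIV"
    and "integrable M (\<lambda>\<omega>. motif_count S T n \<omega> * motif_count S T' n \<omega>)"
    and "((\<lambda>(w, w'). prob {\<omega> \<in> space M. occurrence T (\<lambda>i. S i \<omega>) n w \<and> occurrence T' (\<lambda>i. S i \<omega>) n w'})
      has_sum expectation (\<lambda>\<omega>. motif_count S T n \<omega> * motif_count S T' n \<omega>)) UNIV"
proof -
  have le: "real (card {w. occurrence U (\<lambda>i. S i \<omega>) n w}) \<le> 2 ^ n" if "motif \<sigma> U" for \<sigma> U \<omega>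
    using card_occurrences_le[OF that, of "\<lambda>i. S i \<omega>" n] by (metis of_nat_le_iff of_nat_numeral of_nat_power)
  show "integrable M (motif_count S T n)"
    "((\<lambda>w. prob {\<omega> \<in> space M. occurrence T (\<lambda>i. S i \<omega>) n w}) has_sum expectation (motif_count S T n)) UNIV"
    unfolding motif_count_def[abs_def]
    using has_sum_measure_of_counting[of "\<lambda>n. {w. length w < n}" "\<lambda>w \<omega>. occurrence T (\<lambda>i. S i \<omega>) n w" "2 ^ n",
        OF finite_short_words short_words_mono short_words_exhaust occurrence_sets[OF T] finite_occurrences[OF T] le[OF T]]
    by auto
  define R where "R b \<omega> \<longleftrightarrow> occurrence T (\<lambda>i. S i \<omega>) n (fst b) \<and> occurrence T' (\<lambda>i. S i \<omega>) n (snd b)" for b \<omega>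
  have R_eq: "{b. R b \<omega>} = {w. occurrence T (\<lambda>i. S i \<omega>) n w} \<times> {w. occurrence T' (\<lambda>i. S i \<omega>) n w}" for \<omega>
    unfolding R_def by auto
  have R_card: "real (card {b. R b \<omega>}) = motif_count S T n \<omega> * motif_count S T' n \<omega>" for \<omega>
    unfolding R_eq motif_count_def by (simp add: card_cartesian_product)
  have R_sets: "{\<omega> \<in> space M. R b \<omega>} \<in> sets M" for b
  proof -
    have "{\<omega> \<in> space M. R b \<omega>} = {\<omega> \<in> space M. occurrence T (\<lambda>i. S i \<omega>) n (fst b)} \<inter> {\<omega> \<in> space M. occurrence T' (\<lambda>i. S i \<omega>) n (snd b)}"
      unfolding R_def by auto
    then show ?thesis using occurrence_sets[OF T] occurrence_sets[OF T'] by auto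
  qed
  have R_fin: "finite {b. R b \<omega>}" for \<omega>
    unfolding R_eq using finite_occurrences[OF T] finite_occurrences[OF T'] by auto
  have R_le: "real (card {b. R b \<omega>}) \<le> 2 ^ n * 2 ^ n" for \<omega>
    unfolding R_card motif_count_def using le[OF T] le[OF T'] by (intro mult_mono) auto
  have pairs_fin: "finite ({w :: 'a list. length w < n} \<times> {w :: 'a list. length w < n})" for n
    by (simp add: finite_short_words)
  have pairs_mono: "{w :: 'a list. length w < n} \<times> {w :: 'a list. length w < n} \<subseteq> {w. length w < m} \<times> {w. length w < m}" if "n \<le> m" for n m
    using that by auto
  have pairs_ex: "\<exists>n. b \<in> {w :: 'a list. length w < n} \<times> {w :: 'a list. length w < n}" for b
    by (cases b) (auto intro: exI[of _ "Suc (max (length (fst b)) (length (snd b)))"] simp: less_Suc_eq_le)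
  note R_moments = has_sum_measure_of_counting[of "\<lambda>n. {w. length w < n} \<times> {w. length w < n}" R,
      OF pairs_fin pairs_mono pairs_ex R_sets R_fin R_le]
  show "integrable M (\<lambda>\<omega>. motif_count S T n \<omega> * motif_count S T' n \<omega>)"
    using R_moments(1) unfolding R_card by blast
  show "((\<lambda>(w, w'). prob {\<omega> \<in> space M. occurrence T (\<lambda>i. S i \<omega>) n w \<and> occurrence T' (\<lambda>i. S i \<omega>) n w'})
      has_sum expectation (\<lambda>\<omega>. motif_count S T n \<omega> * motif_count S T' n \<omega>)) UNIV"
  proof -
    have "((\<lambda>b. prob {\<omega> \<in> space M. R b \<omega>}) has_sum expectation (\<lambda>\<omega>. motif_count S T n \<omega> * motif_count S T' n \<omega>)) UNIV"
      using R_moments(2) unfolding R_card by blast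
    then show ?thesis unfolding R_def case_prod_unfold .
  qed
qed

lemma covariance_has_sum:
  assumes T: "motif \<tau> T" and T': "motif \<tau>' T'"
  shows "((\<lambda>(w, w'). prob {\<omega> \<in> space M. occurrence T (\<lambda>i. S i \<omega>) n w \<and> occurrence T' (\<lambda>i. S i \<omega>) n w'}
      - prob {\<omega> \<in> space M. occurrence T (\<lambda>i. S i \<omega>) n w} * prob {\<omega> \<in> space M. occurrence T' (\<lambda>i. S i \<omega>) n w'})
    has_sum covariance M (motif_count S T n) (motif_count S T' n)) UNIV"
proof -
  let ?X = "motif_count S T n" and ?Y = "motif_count S T' n"
  have int: "integrable M ?X" "integrable M ?Y" "integrable M (\<lambda>\<omega>. ?X \<omega> * ?Y \<omega>)"
    using motif_count_moments(1,3)[OF T T'] motif_count_moments(1)[OF T' T] by auto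
  have "covariance M ?X ?Y = expectation (\<lambda>\<omega>. ?X \<omega> * ?Y \<omega> - expectation ?Y * ?X \<omega> - expectation ?X * ?Y \<omega> + expectation ?X * expectation ?Y)"
    unfolding covariance_def by (intro Bochner_Integration.integral_cong) (auto simp: algebra_simps)
  also have "\<dots> = expectation (\<lambda>\<omega>. ?X \<omega> * ?Y \<omega>) - expectation ?X * expectation ?Y"
    using int by (simp add: prob_space)
  finally have cov: "covariance M ?X ?Y = expectation (\<lambda>\<omega>. ?X \<omega> * ?Y \<omega>) - expectation ?X * expectation ?Y" .
  have "((\<lambda>b. (case b of (w, w') \<Rightarrow> prob {\<omega> \<in> space M. occurrence T (\<lambda>i. S i \<omega>) n w \<and> occurrence T' (\<lambda>i. S i \<omega>) n w'})
      + - (case b of (w, w') \<Rightarrow> prob {\<omega> \<in> space M. occurrence T (\<lambda>i. S i \<omega>) n w} * prob {\<omega> \<in> space M. occurrence T' (\<lambda>i. S i \<omega>) n w'}))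
    has_sum (expectation (\<lambda>\<omega>. ?X \<omega> * ?Y \<omega>) + - (expectation ?X * expectation ?Y))) UNIV"
    by (intro has_sum_add motif_count_moments(4)[OF T T'])
       (use has_sum_product[OF motif_count_moments(2)[OF T T', of n] motif_count_moments(2)[OF T' T, of n]] in \<open>simp add: has_sum_uminus\<close>)
  then show ?thesis unfolding cov by (simp add: case_prod_unfold)
qed

end

section \<open>Binomial probabilities compared with Poisson weights\<close>

definition bin :: "nat \<Rightarrow> nat \<Rightarrow> real \<Rightarrow> real" where
  "bin k n q = falling n k * q ^ k * (1 - q) ^ (n - k) / fact k"

definition bin2 :: "nat \<Rightarrow> nat \<Rightarrow> nat \<Rightarrow> real \<Rightarrow> real \<Rightarrow> real" where
  "bin2 k j n q r = falling n (k + j) * q ^ k * r ^ j * (1 - q - r) ^ (n - (k + j)) / (fact k * fact j)"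

lemma falling_Suc: "falling n (Suc k) = falling n k * real (n - k)"
  by (simp add: falling_def)

lemma falling_nonneg: "falling n k \<ge> 0"
  unfolding falling_def by (rule of_nat_0_le_iff)

lemma falling_le: "falling n k \<le> real n ^ k"
  by (induction k) (auto simp: falling_Suc falling_nonneg falling_def[of n 0] mult.commute[of "real n"] intro!: mult_mono)

lemma abs_ln_one_minus_le:
  fixes x :: real
  assumes "0 \<le> x" "x \<le> 1 / 2"
  shows "\<bar>ln (1 - x) + x\<bar> \<le> 2 * x\<^sup>2"
  using abs_ln_one_plus_x_minus_x_bound[of "- x"] assms by simp

text \<open>
  The logarithm of \<open>\<Prod>i<k. (1 - i / n)\<close> is \<open>- (\<Sum>i<k. i / n)\<close> up to an error of order \<open>1 / n\<^sup>2\<close>.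
\<close>

lemma ln_falling:
  assumes "n \<ge> 2 * k" "n > 0"
  shows "falling n k > 0 \<and> \<bar>ln (falling n k / real n ^ k) + real k * (real k - 1) / (2 * real n)\<bar> \<le> 2 * real k ^ 3 / real n ^ 2"
  using assms(1)
proof (induction k)
  case (Suc k)
  have k: "2 * k + 2 \<le> n" using Suc.prems by simp
  have IH: "falling n k > 0" "\<bar>ln (falling n k / real n ^ k) + real k * (real k - 1) / (2 * real n)\<bar> \<le> 2 * real k ^ 3 / real n ^ 2"
    using Suc.IH k by auto
  have n: "real n > 0" using assms by simp
  have nk: "real (n - k) > 0" using k by simp
  have e: "falling n (Suc k) / real n ^ Suc k = falling n k / real n ^ k * (1 - real k / real n)"
    using n k by (simp add: falling_Suc field_simps of_nat_diff)
  have x: "0 \<le> real k / real n" "real k / real n \<le> 1 / 2" using n k by (auto simp: field_simps)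
  have l: "\<bar>ln (1 - real k / real n) + real k / real n\<bar> \<le> 2 * (real k / real n)\<^sup>2"
    by (rule abs_ln_one_minus_le[OF x])
  have "ln (falling n (Suc k) / real n ^ Suc k) = ln (falling n k / real n ^ k) + ln (1 - real k / real n)"
    unfolding e using IH(1) n x by (intro ln_mult_pos) auto
  moreover have "real (Suc k) * (real (Suc k) - 1) / (2 * real n) = real k * (real k - 1) / (2 * real n) + real k / real n"
    using n by (simp add: field_simps)
  ultimately have "\<bar>ln (falling n (Suc k) / real n ^ Suc k) + real (Suc k) * (real (Suc k) - 1) / (2 * real n)\<bar>
      \<le> 2 * real k ^ 3 / real n ^ 2 + 2 * (real k / real n)\<^sup>2"
    using IH(2) l by linarith
  also have "\<dots> = 2 * (real k ^ 3 + real k ^ 2) / real n ^ 2" by (simp add: power_divide add_divide_distrib)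
  also have "\<dots> \<le> 2 * real (Suc k) ^ 3 / real n ^ 2"
    by (intro divide_right_mono mult_left_mono) (auto simp: power2_eq_square power3_eq_cube algebra_simps)
  finally show ?case using IH(1) nk by (simp add: falling_Suc)
qed (simp add: falling_def)

lemma exp_minus_one_le:
  fixes x :: real
  shows "\<bar>exp x - 1\<bar> \<le> \<bar>x\<bar> * (1 + exp x)"
    and "\<bar>exp x - 1 - x\<bar> \<le> x\<^sup>2 * (1 + exp x)"
proof -
  have d: "1 + x \<le> exp x" "1 - x \<le> exp (- x)" using exp_ge_add_one_self[of x] exp_ge_add_one_self[of "- x"] by simp_all
  have u: "exp x - 1 \<le> x * exp x"
    using mult_left_mono[OF d(2), of "exp x"] by (simp add: algebra_simps exp_minus)
  show a: "\<bar>exp x - 1\<bar> \<le> \<bar>x\<bar> * (1 + exp x)"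
  proof (cases "x \<ge> 0")
    case True
    then show ?thesis using u d by (simp add: algebra_simps)
  next
    case False
    then have "\<bar>exp x - 1\<bar> = 1 - exp x" by simp
    also have "\<dots> \<le> - x" using d by linarith
    also have "\<dots> \<le> - x * (1 + exp x)" using False by (simp add: algebra_simps mult_nonpos_nonneg)
    finally show ?thesis using False by simp
  qed
  have "exp x - 1 - x \<ge> 0" using d by linarith
  moreover have "exp x - 1 - x \<le> x * (exp x - 1)" using u by (simp add: algebra_simps)
  moreover have "x * (exp x - 1) \<le> \<bar>x\<bar> * (\<bar>x\<bar> * (1 + exp x))"
    using mult_left_mono[OF a, of "\<bar>x\<bar>"] abs_ge_self[of "x * (exp x - 1)"] by (simp add: abs_mult)
  ultimately show "\<bar>exp x - 1 - x\<bar> \<le> x\<^sup>2 * (1 + exp x)" by (simp add: power2_eq_square mult.assoc[symmetric])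
qed

text \<open>\<open>tail k t\<close> bounds the binomial and Poisson weights up to constants.\<close>

definition tail :: "nat \<Rightarrow> real \<Rightarrow> real" where
  "tail k t = t ^ k * exp (- t)"

lemma tail_nonneg: "t \<ge> 0 \<Longrightarrow> tail k t \<ge> 0"
  by (simp add: tail_def)

lemma pois_le_tail: "t \<ge> 0 \<Longrightarrow> pois k t \<le> tail k t"
  unfolding pois_def tail_def using divide_left_mono[of 1 "fact k" "t ^ k * exp (- t)"] by simp

lemma polynomial_tail_le_phi:
  assumes "k \<ge> 2"
  shows "\<exists>C\<ge>0. \<forall>t\<ge>0. (1 + t) ^ a * tail k t \<le> C * phi t"
proof (intro exI[of _ "2 ^ a * (fact (k - 2) * 2 ^ (k - 2) + fact (k + a - 2) * 2 ^ (k + a - 2))"] conjI allI impI)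
  fix t :: real assume t: "t \<ge> 0"
  have "(1 + t) ^ a \<le> (2 * max 1 t) ^ a" using t by (intro power_mono) auto
  also have "\<dots> \<le> 2 ^ a * (1 + t ^ a)"
    using t by (simp add: power_mult_distrib max_def)
  finally have "(1 + t) ^ a * tail k t \<le> 2 ^ a * (1 + t ^ a) * tail k t"
    using t tail_nonneg by (intro mult_right_mono) auto
  also have "\<dots> = 2 ^ a * (t ^ k * exp (- t) + t ^ (k + a) * exp (- t))"
    by (simp add: tail_def power_add algebra_simps)
  also have "\<dots> \<le> 2 ^ a * (fact (k - 2) * 2 ^ (k - 2) * phi t + fact (k + a - 2) * 2 ^ (k + a - 2) * phi t)"
    using power_exp_le_phi[OF t, of k] power_exp_le_phi[OF t, of "k + a"] assms
    by (intro mult_left_mono add_mono) auto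
  finally show "(1 + t) ^ a * tail k t \<le> 2 ^ a * (fact (k - 2) * 2 ^ (k - 2) + fact (k + a - 2) * 2 ^ (k + a - 2)) * phi t"
    by (simp add: algebra_simps)
qed simp

lemma one_minus_power_le_exp:
  fixes q :: real
  assumes "0 \<le> q" "q \<le> 1" "k \<le> n"
  shows "(1 - q) ^ (n - k) \<le> exp (real k) * exp (- (real n * q))"
proof -
  have "(1 - q) ^ (n - k) \<le> exp (- q) ^ (n - k)"
    using assms exp_ge_add_one_self[of "- q"] by (intro power_mono) auto
  also have "\<dots> = exp (real k * q - real n * q)"
    using assms by (simp add: exp_of_nat_mult[symmetric] of_nat_diff algebra_simps)
  also have "\<dots> \<le> exp (real k - real n * q)" using assms by (simp add: mult_left_le)
  finally show ?thesis by (simp add: exp_diff exp_minus divide_inverse)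
qed

lemma bin_nonneg: "0 \<le> q \<Longrightarrow> q \<le> 1 \<Longrightarrow> bin k n q \<ge> 0"
  unfolding bin_def by (auto intro!: divide_nonneg_nonneg mult_nonneg_nonneg falling_nonneg)

lemma bin_le_tail:
  assumes "0 \<le> q" "q \<le> 1" "k \<le> n"
  shows "bin k n q \<le> exp (real k) * tail k (real n * q)"
proof -
  have "bin k n q \<le> falling n k * q ^ k * (1 - q) ^ (n - k) / 1"
    unfolding bin_def using assms falling_nonneg by (intro divide_left_mono) auto
  also have "\<dots> \<le> real n ^ k * q ^ k * (exp (real k) * exp (- (real n * q))) / 1"
    unfolding div_by_1 using assms falling_le falling_nonneg one_minus_power_le_exp[OF assms]
    by (intro mult_mono) auto
  finally show ?thesis by (simp add: tail_def power_mult_distrib mult_ac)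
qed

lemma bin2_bounds:
  assumes "0 \<le> q" "0 \<le> r" "q + r \<le> 1" "k + j \<le> n"
  shows "bin2 k j n q r \<ge> 0" "bin2 k j n q r \<le> exp (real (k + j)) * (tail k (real n * q) * tail j (real n * r))"
proof -
  show "bin2 k j n q r \<ge> 0"
    unfolding bin2_def using assms by (auto intro!: divide_nonneg_nonneg mult_nonneg_nonneg falling_nonneg)
  have f: "1 \<le> (fact k * fact j :: real)" using mult_mono[of 1 "fact k :: real" 1 "fact j"] by simp
  have "bin2 k j n q r \<le> falling n (k + j) * q ^ k * r ^ j * (1 - (q + r)) ^ (n - (k + j)) / 1"
    unfolding bin2_def diff_diff_eq using assms f
    by (intro divide_left_mono mult_nonneg_nonneg falling_nonneg) auto
  also have "\<dots> \<le> real n ^ (k + j) * q ^ k * r ^ j * (exp (real (k + j)) * exp (- (real n * (q + r)))) / 1"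
    unfolding div_by_1 using assms falling_le falling_nonneg one_minus_power_le_exp[of "q + r" "k + j" n]
    by (intro mult_mono mult_nonneg_nonneg) auto
  also have "\<dots> = exp (real (k + j)) * (tail k (real n * q) * tail j (real n * r))"
    by (simp add: tail_def power_mult_distrib power_add distrib_left exp_add exp_diff exp_minus field_simps)
  finally show "bin2 k j n q r \<le> exp (real (k + j)) * (tail k (real n * q) * tail j (real n * r))" .
qed

text \<open>
  For \<open>q \<le> 1 / 2\<close> the two weights differ by a factor \<open>exp R\<close> with \<open>R\<close> of order \<open>(1 + x)\<^sup>2 / n\<close>,
  where \<open>x = n * q\<close>. For larger \<open>q\<close> the claim is trivial, since the right-hand side is then of the
  size of the weights themselves.
\<close>

lemma bin_minus_pois:
  "\<exists>C\<ge>0. \<forall>n q. 2 * k \<le> n \<longrightarrow> 0 < n \<longrightarrow> 0 < q \<longrightarrow> q \<le> 1 \<longrightarrow>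
     \<bar>bin k n q - pois k (real n * q)\<bar> \<le> C / real n * ((1 + real n * q) ^ 2 * tail k (real n * q))"
proof (intro exI[of _ "(real k ^ 2 + 2 * real k ^ 3 + real k + 4) * (1 + exp (real k))"] conjI allI impI)
  fix n :: nat and q :: real
  assume nk: "2 * k \<le> n" and n0: "0 < n" and q: "0 < q" "q \<le> 1"
  define x where "x = real n * q"
  define K where "K = real k ^ 2 + 2 * real k ^ 3 + real k + 4"
  have n: "real n \<ge> 1" using n0 by simp
  have x: "x > 0" unfolding x_def using n q by simp
  have K: "K \<ge> 4" unfolding K_def by simp
  have tail: "tail k x \<ge> 0" using x by (intro tail_nonneg) auto
  have sum_le: "bin k n q + pois k x \<le> (1 + exp (real k)) * tail k x"
    using bin_le_tail[of q k n] pois_le_tail[of x k] q nk x by (simp add: x_def algebra_simps)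
  have main: "\<bar>bin k n q - pois k x\<bar> \<le> K * (1 + x)\<^sup>2 / real n * (bin k n q + pois k x)"
  proof (cases "q \<le> 1 / 2")
    case False
    have "1 \<le> 2 * x / real n" unfolding x_def using False n by simp
    also have "\<dots> \<le> K * (1 + x)\<^sup>2 / real n"
    proof (intro divide_right_mono)
      have "2 * x \<le> 4 * (1 + x)\<^sup>2" using x by (simp add: power2_eq_square algebra_simps)
      also have "\<dots> \<le> K * (1 + x)\<^sup>2" using K by (intro mult_right_mono) auto
      finally show "2 * x \<le> K * (1 + x)\<^sup>2" .
    qed simp
    finally have "1 * (bin k n q + pois k x) \<le> K * (1 + x)\<^sup>2 / real n * (bin k n q + pois k x)"
      using bin_nonneg[of q k n] pois_nonneg[of x k] q x by (intro mult_right_mono) auto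
    then show ?thesis using bin_nonneg[of q k n] pois_nonneg[of x k] q x by (simp add: abs_le_iff)
  next
    case True
    define R where "R = ln (falling n k / real n ^ k) + x + real (n - k) * ln (1 - q)"
    have fp: "falling n k > 0" using ln_falling[OF nk n0] by blast
    have binR: "bin k n q = pois k x * exp R"
    proof -
      have "exp R = falling n k / real n ^ k * exp x * (1 - q) ^ (n - k)"
        unfolding R_def exp_add using fp n True q by (simp add: exp_of_nat_mult)
      then show ?thesis
        unfolding bin_def pois_def using n by (simp add: x_def power_mult_distrib exp_minus field_simps)
    qed
    have "\<bar>R\<bar> \<le> K * (1 + x)\<^sup>2 / real n"
    proof -
      have a: "\<bar>ln (falling n k / real n ^ k)\<bar> \<le> (real k ^ 2 + 2 * real k ^ 3) / real n"
      proof -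
        have l: "\<bar>ln (falling n k / real n ^ k) + real k * (real k - 1) / (2 * real n)\<bar> \<le> 2 * real k ^ 3 / real n ^ 2"
          using ln_falling[OF nk n0] by blast
        have "2 * real k ^ 3 / real n ^ 2 \<le> 2 * real k ^ 3 / real n"
          using n by (intro divide_left_mono) (auto simp: power2_eq_square)
        moreover have "\<bar>real k * (real k - 1) / (2 * real n)\<bar> \<le> real k ^ 2 / real n"
        proof -
          have "\<bar>real k * (real k - 1)\<bar> \<le> real k ^ 2"
            by (cases k) (auto simp: power2_eq_square algebra_simps)
          then have "\<bar>real k * (real k - 1)\<bar> / (2 * real n) \<le> real k ^ 2 / real n"
            using n by (intro frac_le) auto
          then show ?thesis by (simp add: abs_mult)
        qed
        ultimately show ?thesis using l unfolding add_divide_distrib by linarith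
      qed
      have b: "\<bar>x + real (n - k) * ln (1 - q)\<bar> \<le> (2 * x\<^sup>2 + real k * x) / real n"
      proof -
        have "\<bar>real (n - k) * (ln (1 - q) + q)\<bar> \<le> real n * (2 * q\<^sup>2)"
          unfolding abs_mult using abs_ln_one_minus_le[of q] q True by (intro mult_mono) auto
        moreover have e: "x + real (n - k) * ln (1 - q) = real (n - k) * (ln (1 - q) + q) + real k * q"
          using nk by (simp add: x_def of_nat_diff algebra_simps)
        moreover have "real n * (2 * q\<^sup>2) + real k * q = (2 * x\<^sup>2 + real k * x) / real n"
          using n by (simp add: x_def field_simps power2_eq_square)
        moreover have "\<bar>real k * q\<bar> = real k * q" using q by simp
        ultimately show ?thesis unfolding e using abs_triangle_ineq[of "real (n - k) * (ln (1 - q) + q)" "real k * q"] by simp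
      qed
      have "\<bar>R\<bar> \<le> (real k ^ 2 + 2 * real k ^ 3) / real n + (2 * x\<^sup>2 + real k * x) / real n"
        unfolding R_def using a b by linarith
      also have "\<dots> = (real k ^ 2 + 2 * real k ^ 3 + 2 * x\<^sup>2 + real k * x) / real n" by (simp add: add_divide_distrib)
      also have "\<dots> \<le> K * (1 + x)\<^sup>2 / real n"
      proof (intro divide_right_mono)
        have "1 \<le> (1 + x)\<^sup>2" "x\<^sup>2 \<le> (1 + x)\<^sup>2" "x \<le> (1 + x)\<^sup>2" using x by (auto simp: power2_eq_square algebra_simps)
        moreover have "(real k ^ 2 + 2 * real k ^ 3) * 1 \<le> (real k ^ 2 + 2 * real k ^ 3) * (1 + x)\<^sup>2"
          using calculation by (intro mult_left_mono) auto
        ultimately have "(real k ^ 2 + 2 * real k ^ 3) * 1 \<le> (real k ^ 2 + 2 * real k ^ 3) * (1 + x)\<^sup>2"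
          "2 * x\<^sup>2 \<le> 4 * (1 + x)\<^sup>2" "real k * x \<le> real k * (1 + x)\<^sup>2"
          by (auto intro!: mult_left_mono)
        then show "real k ^ 2 + 2 * real k ^ 3 + 2 * x\<^sup>2 + real k * x \<le> K * (1 + x)\<^sup>2"
          unfolding K_def by (simp add: algebra_simps)
      qed simp
      finally show ?thesis .
    qed
    then have "\<bar>exp R - 1\<bar> \<le> K * (1 + x)\<^sup>2 / real n * (1 + exp R)"
      using exp_minus_one_le(1)[of R] mult_right_mono[of "\<bar>R\<bar>" "K * (1 + x)\<^sup>2 / real n" "1 + exp R"]
      by (simp add: add_nonneg_nonneg)
    then have "pois k x * \<bar>exp R - 1\<bar> \<le> pois k x * (K * (1 + x)\<^sup>2 / real n * (1 + exp R))"
      using pois_nonneg[of x k] x by (intro mult_left_mono) auto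
    moreover have "\<bar>bin k n q - pois k x\<bar> = pois k x * \<bar>exp R - 1\<bar>"
      unfolding binR using pois_nonneg[of x k] x abs_mult[of "pois k x" "exp R - 1"] by (simp add: right_diff_distrib)
    ultimately show ?thesis unfolding binR by (simp add: algebra_simps)
  qed
  have "K * (1 + x)\<^sup>2 / real n * (bin k n q + pois k x) \<le> K * (1 + x)\<^sup>2 / real n * ((1 + exp (real k)) * tail k x)"
    using sum_le K n x by (intro mult_left_mono) auto
  then show "\<bar>bin k n q - pois k (real n * q)\<bar> \<le> (real k ^ 2 + 2 * real k ^ 3 + real k + 4) * (1 + exp (real k)) / real n * ((1 + real n * q) ^ 2 * tail k (real n * q))"
    using main unfolding x_def[symmetric] K_def[symmetric] by (simp add: mult_ac)
qed (simp add: add_nonneg_nonneg)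

lemma abs_sum_le:
  fixes A B C D :: real
  shows "E = A + B - C - D \<Longrightarrow> \<bar>A\<bar> \<le> a \<Longrightarrow> \<bar>B\<bar> \<le> b \<Longrightarrow> \<bar>C\<bar> \<le> c \<Longrightarrow> \<bar>D\<bar> \<le> d \<Longrightarrow> \<bar>E\<bar> \<le> a + b + c + d"
  by linarith

text \<open>
  The factor \<open>exp R\<close> is the dependence between the two counts. The factorial parts contribute
  \<open>- k * j / n\<close>. Since \<open>1 - q - r = (1 - q) * (1 - r) * (1 - \<theta>)\<close> with \<open>\<theta>\<close> close to \<open>q * r\<close>, the
  powers contribute \<open>- n * q * r = - x * y / n\<close>, and the mismatch of the exponents contributes
  \<open>j * q + k * r = (j * x + k * y) / n\<close>. Together this is \<open>- (k - x) * (j - y) / n\<close>.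
\<close>

lemma ln_bin2_ratio:
  fixes q r :: real
  assumes n: "2 * (k + j) \<le> n" "0 < n" and q: "0 < q" "q \<le> 1 / 4" and r: "0 < r" "r \<le> 1 / 4"
  defines "x \<equiv> real n * q" and "y \<equiv> real n * r"
  defines "U \<equiv> (1 + x) * (1 + y)"
  obtains R where "bin2 k j n q r = bin k n q * bin j n r * exp R"
    "\<bar>R + (real k - x) * (real j - y) / real n\<bar>
      \<le> (2 * (real (k + j) ^ 3 + real k ^ 3 + real j ^ 3) + 10 + 4 * real (k + j)) * U\<^sup>2 / (real n)\<^sup>2"
proof -
  define m where "m = n - (k + j)"
  define g where "g i = ln (falling n i / real n ^ i)" for i
  \<comment> \<open>This makes \<open>1 - q - r = (1 - q) * (1 - r) * (1 - \<theta>)\<close>.\<close>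
  define \<theta> where "\<theta> = q * r / ((1 - q) * (1 - r))"
  define R where "R = (g (k + j) - g k - g j) + real m * ln (1 - \<theta>) - real j * ln (1 - q) - real k * ln (1 - r)"
  have n1: "real n \<ge> 1" using n by simp
  have xy: "x > 0" "y > 0" unfolding x_def y_def using n1 q r by auto
  have U: "1 \<le> U" "x \<le> U" "y \<le> U" "x * y \<le> U" "x + y \<le> U"
    unfolding U_def using xy by (auto simp: algebra_simps mult_nonneg_nonneg)
  have U2: "1 \<le> U\<^sup>2" "x\<^sup>2 \<le> U\<^sup>2" "y\<^sup>2 \<le> U\<^sup>2" "x * y \<le> U\<^sup>2" "x\<^sup>2 * y\<^sup>2 \<le> U\<^sup>2" "x * y * (x + y) \<le> U\<^sup>2"
  proof -
    show "1 \<le> U\<^sup>2" using U by (simp add: one_le_power)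
    show "x\<^sup>2 \<le> U\<^sup>2" "y\<^sup>2 \<le> U\<^sup>2" using U xy by (auto intro!: power_mono)
    show "x\<^sup>2 * y\<^sup>2 \<le> U\<^sup>2" unfolding power_mult_distrib[symmetric] using U xy by (intro power_mono) auto
    show "x * y * (x + y) \<le> U\<^sup>2" unfolding power2_eq_square using U xy by (intro mult_mono) auto
    have "U \<le> U\<^sup>2" using U(1) by (simp add: power2_eq_square)
    then show "x * y \<le> U\<^sup>2" using U by linarith
  qed
  have fp: "falling n (k + j) > 0" "falling n k > 0" "falling n j > 0"
    using ln_falling[of "k + j" n] ln_falling[of k n] ln_falling[of j n] n by auto
  have qr: "1 - q > 0" "1 - r > 0" using q r by auto
  have prod: "(1 - q) * (1 - r) \<ge> 1 / 2"
    using mult_mono[of "3 / 4" "1 - q" "3 / 4" "1 - r"] q r by simp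
  have \<theta>0: "\<theta> \<ge> 0" unfolding \<theta>_def using q r by simp
  have \<theta>2: "\<theta> \<le> 2 * (q * r)"
  proof -
    have "\<theta> \<le> q * r / (1 / 2)" unfolding \<theta>_def using prod q r by (intro divide_left_mono) auto
    then show ?thesis by simp
  qed
  have "q * r \<le> 1 / 4 * (1 / 4)" using q r by (intro mult_mono) auto
  then have \<theta>half: "\<theta> \<le> 1 / 2" using \<theta>2 by simp
  have one_\<theta>: "1 - \<theta> = (1 - q - r) / ((1 - q) * (1 - r))"
  proof -
    have "1 - q - r = (1 - q) * (1 - r) - q * r" by (simp add: algebra_simps)
    then show ?thesis unfolding \<theta>_def using qr by (simp add: diff_divide_distrib)
  qed
  have \<theta>pos: "1 - \<theta> > 0" using \<theta>half by simp
  have "bin2 k j n q r = bin k n q * bin j n r * exp R"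
  proof -
    have e: "exp (g i) = falling n i / real n ^ i" if "falling n i > 0" for i
      unfolding g_def using that n1 by simp
    have "exp R = exp (g (k + j)) / (exp (g k) * exp (g j)) * (1 - \<theta>) ^ m / ((1 - q) ^ j * (1 - r) ^ k)"
      unfolding R_def exp_diff exp_add using \<theta>pos qr by (simp add: exp_of_nat_mult)
    also have "exp (g (k + j)) / (exp (g k) * exp (g j)) = falling n (k + j) / (falling n k * falling n j)"
      using fp n1 by (simp add: e power_add)
    finally have eR: "exp R = falling n (k + j) / (falling n k * falling n j) * (1 - \<theta>) ^ m / ((1 - q) ^ j * (1 - r) ^ k)" .
    have "n - k = m + j" "n - j = m + k" using n by (auto simp: m_def)
    then have pw: "(1 - q) ^ (n - k) = (1 - q) ^ m * (1 - q) ^ j" "(1 - r) ^ (n - j) = (1 - r) ^ m * (1 - r) ^ k"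
      by (simp_all add: power_add)
    have "(1 - \<theta>) ^ m * ((1 - q) ^ m * (1 - r) ^ m) = (1 - q - r) ^ m"
      unfolding one_\<theta> using qr by (simp add: power_divide power_mult_distrib)
    then show ?thesis
      unfolding bin2_def bin_def eR pw m_def[symmetric] using fp qr
      by (simp add: mult.assoc[symmetric]) (simp add: mult_ac)
  qed
  moreover have "\<bar>R + (real k - x) * (real j - y) / real n\<bar>
      \<le> (2 * (real (k + j) ^ 3 + real k ^ 3 + real j ^ 3) + 10 + 4 * real (k + j)) * U\<^sup>2 / (real n)\<^sup>2"
  proof -
    have g: "\<bar>g i + real i * (real i - 1) / (2 * real n)\<bar> \<le> 2 * real i ^ 3 / (real n)\<^sup>2" if "i \<le> k + j" for i
      using ln_falling[of i n] that n unfolding g_def by auto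
    have "real (k + j) * (real (k + j) - 1) / (2 * real n) - real k * (real k - 1) / (2 * real n) - real j * (real j - 1) / (2 * real n)
        = real k * real j / real n"
      using n1 by (simp add: field_simps)
    then have 1: "\<bar>g (k + j) - g k - g j + real k * real j / real n\<bar>
        \<le> 2 * real (k + j) ^ 3 / (real n)\<^sup>2 + 2 * real k ^ 3 / (real n)\<^sup>2 + 2 * real j ^ 3 / (real n)\<^sup>2"
      using g[of "k + j"] g[of k] g[of j] by simp
    have qx: "q = x / real n" and ry: "r = y / real n" using n1 by (auto simp: x_def y_def)
    have 2: "\<bar>real m * ln (1 - \<theta>) + x * y / real n\<bar> \<le> (8 * (x\<^sup>2 * y\<^sup>2) + 2 * real (k + j) * (x * y) + 2 * (x * y * (x + y))) / (real n)\<^sup>2"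
    proof -
      have "\<bar>real m * (ln (1 - \<theta>) + \<theta>)\<bar> \<le> real n * (2 * (2 * (q * r))\<^sup>2)"
        unfolding abs_mult
      proof (intro mult_mono)
        have "\<theta>\<^sup>2 \<le> (2 * (q * r))\<^sup>2" using \<theta>2 \<theta>0 by (intro power_mono) auto
        then show "\<bar>ln (1 - \<theta>) + \<theta>\<bar> \<le> 2 * (2 * (q * r))\<^sup>2" using abs_ln_one_minus_le[OF \<theta>0 \<theta>half] by simp
      qed (auto simp: m_def)
      also have "\<dots> = 8 * (x\<^sup>2 * y\<^sup>2) / real n ^ 3"
        unfolding qx ry using n1 by (simp add: field_simps power2_eq_square power3_eq_cube)
      also have "\<dots> \<le> 8 * (x\<^sup>2 * y\<^sup>2) / (real n)\<^sup>2"
        using n1 by (intro divide_left_mono power_increasing) auto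
      finally have a: "\<bar>real m * (ln (1 - \<theta>) + \<theta>)\<bar> \<le> 8 * (x\<^sup>2 * y\<^sup>2) / (real n)\<^sup>2" .
      have "q * r \<le> q" using mult_left_le[of r q] q r by simp
      then have qr_le: "0 \<le> q + r - q * r" "q * r \<le> q + r" using r by linarith+
      have "\<theta> * ((1 - q) * (1 - r)) = q * r" unfolding \<theta>_def using qr by simp
      then have diff: "\<theta> - q * r = \<theta> * (q + r - q * r)" by (simp add: algebra_simps)
      have "0 \<le> \<theta> - q * r" unfolding diff using \<theta>0 q r qr_le by (intro mult_nonneg_nonneg) auto
      moreover have "\<theta> - q * r \<le> 2 * (q * r) * (q + r)"
        unfolding diff using \<theta>2 \<theta>0 q r qr_le by (intro mult_mono) (auto simp: add_nonneg_nonneg)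
      ultimately have "\<bar>real n * (\<theta> - q * r)\<bar> \<le> real n * (2 * (q * r) * (q + r))"
        by (simp add: abs_mult mult_left_mono)
      also have "\<dots> = 2 * (x * y * (x + y)) / (real n)\<^sup>2"
        unfolding qx ry using n1 by (simp add: field_simps power2_eq_square)
      finally have b: "\<bar>real n * (\<theta> - q * r)\<bar> \<le> 2 * (x * y * (x + y)) / (real n)\<^sup>2" .
      have "\<bar>real (k + j) * \<theta>\<bar> \<le> real (k + j) * (2 * (q * r))"
        using \<theta>0 \<theta>2 by (simp only: abs_mult abs_of_nonneg of_nat_0_le_iff) (intro mult_left_mono, auto)
      also have "\<dots> = 2 * real (k + j) * (x * y) / (real n)\<^sup>2"
        unfolding qx ry using n1 by (simp add: power2_eq_square)
      finally have c: "\<bar>real (k + j) * \<theta>\<bar> \<le> 2 * real (k + j) * (x * y) / (real n)\<^sup>2" .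
      have m: "real m = real n - real (k + j)" using n by (simp add: m_def of_nat_diff)
      have "real m * ln (1 - \<theta>) + real n * (q * r) = real m * (ln (1 - \<theta>) + \<theta>) - real n * (\<theta> - q * r) + real (k + j) * \<theta>"
        unfolding m by (simp add: algebra_simps)
      moreover have "real n * (q * r) = x * y / real n" unfolding qx ry using n1 by simp
      ultimately show ?thesis using a b c unfolding add_divide_distrib by linarith
    qed
    have 3: "\<bar>real j * (ln (1 - q) + q)\<bar> \<le> 2 * real j * x\<^sup>2 / (real n)\<^sup>2"
    proof -
      have "\<bar>real j * (ln (1 - q) + q)\<bar> \<le> real j * (2 * q\<^sup>2)"
        unfolding abs_mult using abs_ln_one_minus_le[of q] q by (intro mult_mono) auto
      then show ?thesis unfolding qx by (simp add: power_divide mult_ac)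
    qed
    have 4: "\<bar>real k * (ln (1 - r) + r)\<bar> \<le> 2 * real k * y\<^sup>2 / (real n)\<^sup>2"
    proof -
      have "\<bar>real k * (ln (1 - r) + r)\<bar> \<le> real k * (2 * r\<^sup>2)"
        unfolding abs_mult using abs_ln_one_minus_le[of r] r by (intro mult_mono) auto
      then show ?thesis unfolding ry by (simp add: power_divide mult_ac)
    qed
    have "R + (real k - x) * (real j - y) / real n = (g (k + j) - g k - g j + real k * real j / real n)
        + (real m * ln (1 - \<theta>) + x * y / real n) - real j * (ln (1 - q) + q) - real k * (ln (1 - r) + r)"
      unfolding R_def using n1 by (simp add: qx ry field_simps)
    then have "\<bar>R + (real k - x) * (real j - y) / real n\<bar> \<le>
        2 * real (k + j) ^ 3 / (real n)\<^sup>2 + 2 * real k ^ 3 / (real n)\<^sup>2 + 2 * real j ^ 3 / (real n)\<^sup>2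
        + (8 * (x\<^sup>2 * y\<^sup>2) + 2 * real (k + j) * (x * y) + 2 * (x * y * (x + y))) / (real n)\<^sup>2
        + 2 * real j * x\<^sup>2 / (real n)\<^sup>2 + 2 * real k * y\<^sup>2 / (real n)\<^sup>2"
      using 1 2 3 4 by (rule abs_sum_le)
    also have "\<dots> = (2 * (real (k + j) ^ 3 + real k ^ 3 + real j ^ 3) + 8 * (x\<^sup>2 * y\<^sup>2) + 2 * real (k + j) * (x * y)
        + 2 * (x * y * (x + y)) + 2 * real j * x\<^sup>2 + 2 * real k * y\<^sup>2) / (real n)\<^sup>2"
      by (simp add: add_divide_distrib algebra_simps)
    also have "\<dots> \<le> (2 * (real (k + j) ^ 3 + real k ^ 3 + real j ^ 3) + 10 + 4 * real (k + j)) * U\<^sup>2 / (real n)\<^sup>2"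
    proof (intro divide_right_mono)
      have "2 * (real (k + j) ^ 3 + real k ^ 3 + real j ^ 3) * 1 \<le> 2 * (real (k + j) ^ 3 + real k ^ 3 + real j ^ 3) * U\<^sup>2"
        using U2 by (intro mult_left_mono) auto
      moreover have "2 * real (k + j) * (x * y) \<le> 2 * real (k + j) * U\<^sup>2" "2 * real j * x\<^sup>2 \<le> 2 * real j * U\<^sup>2"
        "2 * real k * y\<^sup>2 \<le> 2 * real k * U\<^sup>2"
        using U2 by (auto intro!: mult_left_mono)
      moreover have "(2 * (real (k + j) ^ 3 + real k ^ 3 + real j ^ 3) + 10 + 4 * real (k + j)) * U\<^sup>2
          = 2 * (real (k + j) ^ 3 + real k ^ 3 + real j ^ 3) * U\<^sup>2 + 8 * U\<^sup>2 + 2 * U\<^sup>2 + 2 * real (k + j) * U\<^sup>2 + 2 * real j * U\<^sup>2 + 2 * real k * U\<^sup>2"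
        by (simp add: algebra_simps)
      ultimately show "2 * (real (k + j) ^ 3 + real k ^ 3 + real j ^ 3) + 8 * (x\<^sup>2 * y\<^sup>2) + 2 * real (k + j) * (x * y)
        + 2 * (x * y * (x + y)) + 2 * real j * x\<^sup>2 + 2 * real k * y\<^sup>2
        \<le> (2 * (real (k + j) ^ 3 + real k ^ 3 + real j ^ 3) + 10 + 4 * real (k + j)) * U\<^sup>2"
        using U2 by linarith
    qed simp
    finally show ?thesis .
  qed
  ultimately show ?thesis by (rule that)
qed

text \<open>
  For small \<open>q\<close> and \<open>r\<close> this is \<open>exp R = 1 + R + O(R\<^sup>2)\<close> with \<open>R\<close> from \<open>ln_bin2_ratio\<close>, followed by the
  passage from binomial to Poisson weights in the term of order \<open>1 / n\<close>; by \<open>euler_pois_eq\<close>, the factor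
  \<open>k - x\<close> turns a Poisson weight into its Euler derivative. If \<open>q\<close> or \<open>r\<close> exceeds \<open>1 / 4\<close>, then
  \<open>(1 + x) * (1 + y)\<close> is of order \<open>n\<close> and every term is absorbed by the bound.
\<close>

lemma bin2_expansion:
  "\<exists>C\<ge>0. \<forall>n q r. 2 * (k + j) \<le> n \<longrightarrow> 0 < n \<longrightarrow> 0 < q \<longrightarrow> 0 < r \<longrightarrow> q + r \<le> 1 \<longrightarrow>
     \<bar>bin2 k j n q r - bin k n q * bin j n r + euler_pois k (real n * q) * euler_pois j (real n * r) / real n\<bar>
     \<le> C / (real n)\<^sup>2 * ((1 + real n * q) ^ 4 * tail k (real n * q) * ((1 + real n * r) ^ 4 * tail j (real n * r)))"
proof -
  obtain Ck where Ck: "Ck \<ge> 0" and bpk: "\<And>n q. 2 * k \<le> n \<Longrightarrow> 0 < n \<Longrightarrow> 0 < q \<Longrightarrow> q \<le> 1 \<Longrightarrow>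
     \<bar>bin k n q - pois k (real n * q)\<bar> \<le> Ck / real n * ((1 + real n * q) ^ 2 * tail k (real n * q))"
    using bin_minus_pois[of k] by blast
  obtain Cj where Cj: "Cj \<ge> 0" and bpj: "\<And>n q. 2 * j \<le> n \<Longrightarrow> 0 < n \<Longrightarrow> 0 < q \<Longrightarrow> q \<le> 1 \<Longrightarrow>
     \<bar>bin j n q - pois j (real n * q)\<bar> \<le> Cj / real n * ((1 + real n * q) ^ 2 * tail j (real n * q))"
    using bin_minus_pois[of j] by blast
  define cE where "cE = 2 * (real (k + j) ^ 3 + real k ^ 3 + real j ^ 3) + 10 + 4 * real (k + j)"
  define c0 where "c0 = (real k + 1) * (real j + 1)"
  define cA where "cA = (c0 + cE)\<^sup>2 + cE + 16 * (1 + c0)"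
  define C where "C = cA * (2 * exp (real (k + j))) + c0 * (Ck * exp (real j) + Cj)"
  have cE: "cE \<ge> 0" unfolding cE_def by simp
  have c0: "c0 \<ge> 0" unfolding c0_def by simp
  have cA: "cA \<ge> 0" unfolding cA_def using cE c0 by simp
  show ?thesis
  proof (intro exI[of _ C] conjI allI impI)
    show "C \<ge> 0" unfolding C_def using cA c0 Ck Cj by simp
    fix n :: nat and q r :: real
    assume nk: "2 * (k + j) \<le> n" and n0: "0 < n" and q: "0 < q" and r: "0 < r" and qr: "q + r \<le> 1"
    define x where "x = real n * q"
    define y where "y = real n * r"
    define U where "U = (1 + x) * (1 + y)"
    define T where "T = tail k x * tail j y"
    define R0 where "R0 = - ((real k - x) * (real j - y) / real n)"
    define B where "B = bin k n q * bin j n r"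
    have n1: "real n \<ge> 1" using n0 by simp
    have q1: "q \<le> 1" "r \<le> 1" using q r qr by auto
    have xy: "x > 0" "y > 0" unfolding x_def y_def using n1 q r by auto
    have U1: "1 \<le> U" "1 + x \<le> U" "1 + y \<le> U" unfolding U_def using xy by (auto simp: algebra_simps)
    have T: "T \<ge> 0" unfolding T_def using xy tail_nonneg by simp
    have Ua: "U ^ a \<le> U ^ b" if "a \<le> b" for a b using U1 that by (intro power_increasing) auto
    have B0: "B \<ge> 0" unfolding B_def using q r q1 by (simp add: bin_nonneg)
    have BT: "B \<le> exp (real (k + j)) * T"
    proof -
      have "B \<le> (exp (real k) * tail k x) * (exp (real j) * tail j y)"
        unfolding B_def x_def y_def using q r q1 nk n1 by (intro mult_mono bin_le_tail bin_nonneg mult_nonneg_nonneg tail_nonneg) auto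
      then show ?thesis by (simp add: T_def exp_add mult_ac)
    qed
    have b2: "bin2 k j n q r \<ge> 0" "bin2 k j n q r \<le> exp (real (k + j)) * T"
      using bin2_bounds[of q r k j n] q r qr nk unfolding T_def x_def y_def by auto
    have sumT: "B + bin2 k j n q r \<le> 2 * exp (real (k + j)) * T" using BT b2 by simp
    have R0: "\<bar>R0\<bar> \<le> c0 * U / real n"
    proof -
      have "\<bar>real k - x\<bar> \<le> (real k + 1) * (1 + x)" "\<bar>real j - y\<bar> \<le> (real j + 1) * (1 + y)"
        using xy by (auto simp: algebra_simps abs_le_iff mult_nonneg_nonneg add_nonneg_nonneg)
      then have "\<bar>real k - x\<bar> * \<bar>real j - y\<bar> \<le> ((real k + 1) * (1 + x)) * ((real j + 1) * (1 + y))"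
        using xy by (intro mult_mono) auto
      then have "\<bar>real k - x\<bar> * \<bar>real j - y\<bar> / real n \<le> c0 * U / real n"
        by (intro divide_right_mono) (auto simp: c0_def U_def mult_ac)
      then show ?thesis unfolding R0_def by (simp add: abs_mult)
    qed
    have A: "\<bar>bin2 k j n q r - B - R0 * B\<bar> \<le> cA * U ^ 4 / (real n)\<^sup>2 * (B + bin2 k j n q r)"
    proof (cases "q \<le> 1 / 4 \<and> r \<le> 1 / 4")
      case True
      obtain R where R: "bin2 k j n q r = B * exp R" "\<bar>R - R0\<bar> \<le> cE * U\<^sup>2 / (real n)\<^sup>2"
        using ln_bin2_ratio[OF nk n0 q _ r, of thesis] True unfolding B_def cE_def U_def x_def y_def R0_def by auto
      have "cE * U\<^sup>2 / (real n)\<^sup>2 \<le> cE * U\<^sup>2 / real n"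
        using n1 cE by (intro divide_left_mono mult_nonneg_nonneg) (auto simp: power2_eq_square)
      moreover have "c0 * U / real n \<le> c0 * U\<^sup>2 / real n"
        using c0 Ua[of 1 2] by (intro divide_right_mono mult_left_mono) auto
      ultimately have "\<bar>R\<bar> \<le> (c0 + cE) * U\<^sup>2 / real n"
        using R(2) R0 by (simp add: distrib_right add_divide_distrib)
      then have "\<bar>R\<bar>\<^sup>2 \<le> ((c0 + cE) * U\<^sup>2 / real n)\<^sup>2" by (intro power_mono) auto
      then have R2: "R\<^sup>2 \<le> (c0 + cE)\<^sup>2 * U ^ 4 / (real n)\<^sup>2"
        by (simp add: power_divide power_mult_distrib flip: power_mult)
      have "\<bar>exp R - 1 - R0\<bar> \<le> R\<^sup>2 * (1 + exp R) + \<bar>R - R0\<bar>"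
        using exp_minus_one_le(2)[of R] by linarith
      also have "\<dots> \<le> (c0 + cE)\<^sup>2 * U ^ 4 / (real n)\<^sup>2 * (1 + exp R) + cE * U ^ 4 / (real n)\<^sup>2 * (1 + exp R)"
      proof (intro add_mono mult_right_mono R2)
        have "cE * U\<^sup>2 / (real n)\<^sup>2 \<le> cE * U ^ 4 / (real n)\<^sup>2 * 1"
          using cE Ua[of 2 4] by (simp add: divide_right_mono mult_left_mono)
        also have "\<dots> \<le> cE * U ^ 4 / (real n)\<^sup>2 * (1 + exp R)"
          using cE U1 by (intro mult_left_mono) auto
        finally show "\<bar>R - R0\<bar> \<le> cE * U ^ 4 / (real n)\<^sup>2 * (1 + exp R)" using R(2) by linarith
      qed (simp add: add_nonneg_nonneg)
      also have "\<dots> \<le> cA * U ^ 4 / (real n)\<^sup>2 * (1 + exp R)"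
      proof -
        have "0 \<le> 16 * (1 + c0) * (U ^ 4 / (real n)\<^sup>2 * (1 + exp R))"
          using c0 U1 by (intro mult_nonneg_nonneg divide_nonneg_nonneg add_nonneg_nonneg) auto
        then show ?thesis unfolding cA_def by (simp add: algebra_simps add_divide_distrib)
      qed
      finally have "B * \<bar>exp R - 1 - R0\<bar> \<le> B * (cA * U ^ 4 / (real n)\<^sup>2 * (1 + exp R))"
        using B0 by (intro mult_left_mono)
      moreover have "\<bar>bin2 k j n q r - B - R0 * B\<bar> = B * \<bar>exp R - 1 - R0\<bar>"
        unfolding R(1) using B0 abs_mult[of B "exp R - 1 - R0"] by (simp add: algebra_simps)
      ultimately show ?thesis unfolding R(1) by (simp add: algebra_simps)
    next
      case False
      have big: "1 \<le> 16 * U\<^sup>2 / (real n)\<^sup>2"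
      proof -
        have "real n \<le> 4 * x \<or> real n \<le> 4 * y" unfolding x_def y_def using False n1 by auto
        then have "real n \<le> 4 * U" using U1 by linarith
        then have "(real n)\<^sup>2 \<le> (4 * U)\<^sup>2" by (intro power_mono) auto
        then show ?thesis using n1 by (simp add: power_mult_distrib)
      qed
      have R0U: "\<bar>R0\<bar> \<le> c0 * U" using R0 divide_left_mono[of 1 "real n" "c0 * U"] n1 c0 U1 by simp
      have "\<bar>bin2 k j n q r - B - R0 * B\<bar> \<le> bin2 k j n q r + B + \<bar>R0\<bar> * B"
        using b2 B0 abs_mult[of R0 B] by linarith
      also have "\<dots> \<le> (1 + \<bar>R0\<bar>) * (B + bin2 k j n q r)"
        using b2 mult_nonneg_nonneg[OF abs_ge_zero[of R0] b2(1)] by (simp add: algebra_simps)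
      also have "\<dots> \<le> ((1 + c0) * U) * (B + bin2 k j n q r)"
        using R0U U1 B0 b2 by (intro mult_right_mono) (auto simp: algebra_simps)
      also have "\<dots> \<le> ((1 + c0) * U) * (B + bin2 k j n q r) * (16 * U\<^sup>2 / (real n)\<^sup>2)"
        using big c0 U1 B0 b2 mult_left_mono[OF big, of "((1 + c0) * U) * (B + bin2 k j n q r)"] by simp
      also have "\<dots> = 16 * (1 + c0) * U ^ 3 / (real n)\<^sup>2 * (B + bin2 k j n q r)"
        by (simp add: power2_eq_square power3_eq_cube)
      also have "\<dots> \<le> cA * U ^ 4 / (real n)\<^sup>2 * (B + bin2 k j n q r)"
      proof (intro mult_right_mono divide_right_mono mult_mono)
        show "16 * (1 + c0) \<le> cA" unfolding cA_def using cE by simp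
      qed (use Ua[of 3 4] cA U1 B0 b2 in auto)
      finally show ?thesis .
    qed
    have A': "\<bar>bin2 k j n q r - B - R0 * B\<bar> \<le> cA * U ^ 4 / (real n)\<^sup>2 * (2 * exp (real (k + j)) * T)"
      using cA U1 sumT by (intro order_trans[OF A] mult_left_mono) auto
    have BP: "\<bar>B - pois k x * pois j y\<bar> \<le> (Ck * exp (real j) + Cj) / real n * (U\<^sup>2 * T)"
    proof -
      have "B - pois k x * pois j y = (bin k n q - pois k x) * bin j n r + pois k x * (bin j n r - pois j y)"
        by (simp add: B_def algebra_simps)
      also have "\<bar>\<dots>\<bar> \<le> \<bar>bin k n q - pois k x\<bar> * \<bar>bin j n r\<bar> + \<bar>pois k x\<bar> * \<bar>bin j n r - pois j y\<bar>"
        by (metis abs_mult abs_triangle_ineq)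
      also have "\<dots> \<le> (Ck / real n * ((1 + x)\<^sup>2 * tail k x)) * (exp (real j) * tail j y) + tail k x * (Cj / real n * ((1 + y)\<^sup>2 * tail j y))"
      proof (intro add_mono mult_mono)
        show "\<bar>bin k n q - pois k x\<bar> \<le> Ck / real n * ((1 + x)\<^sup>2 * tail k x)"
          unfolding x_def using bpk[of n q] nk n0 q q1 by simp
        show "\<bar>bin j n r - pois j y\<bar> \<le> Cj / real n * ((1 + y)\<^sup>2 * tail j y)"
          unfolding y_def using bpj[of n r] nk n0 r q1 by simp
        show "\<bar>bin j n r\<bar> \<le> exp (real j) * tail j y"
          unfolding y_def using bin_le_tail[of r j n] bin_nonneg[of r j n] r q1 nk by simp
        show "\<bar>pois k x\<bar> \<le> tail k x" using pois_le_tail[of x k] pois_nonneg[of x k] xy by simp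
      qed (use Ck tail_nonneg[of x k] tail_nonneg[of y j] xy n1 in auto)
      also have "\<dots> = (Ck * exp (real j)) / real n * ((1 + x)\<^sup>2 * T) + Cj / real n * ((1 + y)\<^sup>2 * T)"
        by (simp add: T_def mult_ac)
      also have "\<dots> \<le> (Ck * exp (real j)) / real n * (U\<^sup>2 * T) + Cj / real n * (U\<^sup>2 * T)"
        using U1 xy T Ck Cj n1 by (intro add_mono mult_left_mono mult_right_mono power_mono) auto
      finally show ?thesis by (simp add: add_divide_distrib distrib_right)
    qed
    have e: "euler_pois k x * euler_pois j y / real n = - (R0 * (pois k x * pois j y))"
      unfolding euler_pois_eq R0_def by simp
    have "\<bar>R0 * (B - pois k x * pois j y)\<bar> \<le> (c0 * U / real n) * ((Ck * exp (real j) + Cj) / real n * (U\<^sup>2 * T))"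
      unfolding abs_mult using R0 BP by (intro mult_mono) (use c0 U1 n1 in auto)
    also have "\<dots> = c0 * (Ck * exp (real j) + Cj) / (real n)\<^sup>2 * (U ^ 3 * T)"
      by (simp add: power2_eq_square power3_eq_cube)
    also have "\<dots> \<le> c0 * (Ck * exp (real j) + Cj) / (real n)\<^sup>2 * (U ^ 4 * T)"
      using Ua[of 3 4] T c0 Ck Cj by (intro mult_left_mono mult_right_mono divide_nonneg_nonneg mult_nonneg_nonneg add_nonneg_nonneg) auto
    finally have D: "\<bar>R0 * (B - pois k x * pois j y)\<bar> \<le> c0 * (Ck * exp (real j) + Cj) / (real n)\<^sup>2 * (U ^ 4 * T)" .
    have "bin2 k j n q r - B + euler_pois k x * euler_pois j y / real n
        = (bin2 k j n q r - B - R0 * B) + R0 * (B - pois k x * pois j y)"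
      unfolding e by (simp add: algebra_simps)
    then have "\<bar>bin2 k j n q r - B + euler_pois k x * euler_pois j y / real n\<bar>
        \<le> cA * U ^ 4 / (real n)\<^sup>2 * (2 * exp (real (k + j)) * T) + c0 * (Ck * exp (real j) + Cj) / (real n)\<^sup>2 * (U ^ 4 * T)"
      using A' D by linarith
    also have "\<dots> = C / (real n)\<^sup>2 * (U ^ 4 * T)"
      by (simp add: C_def add_divide_distrib distrib_right distrib_left mult_ac)
    also have "U ^ 4 * T = (1 + x) ^ 4 * tail k x * ((1 + y) ^ 4 * tail j y)"
      by (simp add: U_def T_def power_mult_distrib mult_ac)
    finally show "\<bar>bin2 k j n q r - bin k n q * bin j n r + euler_pois k (real n * q) * euler_pois j (real n * r) / real n\<bar>
     \<le> C / (real n)\<^sup>2 * ((1 + real n * q) ^ 4 * tail k (real n * q) * ((1 + real n * r) ^ 4 * tail j (real n * r)))"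
      unfolding B_def x_def y_def .
  qed
qed

lemma bin_phi_bounds:
  assumes k: "k \<ge> 2"
  shows "\<exists>C\<ge>0. \<forall>n q. 2 * k \<le> n \<longrightarrow> 0 < n \<longrightarrow> 0 < q \<longrightarrow> q \<le> 1 \<longrightarrow>
    bin k n q \<le> C * phi (real n * q) \<and> \<bar>bin k n q - pois k (real n * q)\<bar> \<le> C / real n * phi (real n * q)"
proof -
  obtain A where A: "A \<ge> 0" and bp: "\<And>n q. 2 * k \<le> n \<Longrightarrow> 0 < n \<Longrightarrow> 0 < q \<Longrightarrow> q \<le> 1 \<Longrightarrow>
     \<bar>bin k n q - pois k (real n * q)\<bar> \<le> A / real n * ((1 + real n * q) ^ 2 * tail k (real n * q))"
    using bin_minus_pois[of k] by blast
  obtain D where D: "D \<ge> 0" "\<And>t. t \<ge> 0 \<Longrightarrow> (1 + t) ^ 0 * tail k t \<le> D * phi t"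
    using polynomial_tail_le_phi[OF k, of 0] by blast
  obtain E where E: "E \<ge> 0" "\<And>t. t \<ge> 0 \<Longrightarrow> (1 + t) ^ 2 * tail k t \<le> E * phi t"
    using polynomial_tail_le_phi[OF k, of 2] by blast
  show ?thesis
  proof (intro exI[of _ "exp (real k) * D + A * E"] conjI allI impI)
    show "exp (real k) * D + A * E \<ge> 0" using A D E by simp
    fix n :: nat and q :: real
    assume n: "2 * k \<le> n" "0 < n" and q: "0 < q" "q \<le> 1"
    have x: "real n * q \<ge> 0" using q by simp
    have "bin k n q \<le> exp (real k) * tail k (real n * q)" using bin_le_tail[of q k n] n q by simp
    also have "\<dots> \<le> exp (real k) * (D * phi (real n * q))" using D(2)[OF x] by (intro mult_left_mono) auto
    also have "\<dots> \<le> (exp (real k) * D + A * E) * phi (real n * q)"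
      using A E phi_nonneg[of "real n * q"] by (simp add: distrib_right)
    finally show "bin k n q \<le> (exp (real k) * D + A * E) * phi (real n * q)" .
    have "\<bar>bin k n q - pois k (real n * q)\<bar> \<le> A / real n * ((1 + real n * q) ^ 2 * tail k (real n * q))"
      by (rule bp[OF n q])
    also have "\<dots> \<le> A / real n * (E * phi (real n * q))" using E(2)[OF x] A by (intro mult_left_mono) auto
    also have "\<dots> = A * E / real n * phi (real n * q)" by simp
    also have "\<dots> \<le> (exp (real k) * D + A * E) / real n * phi (real n * q)"
      using D phi_nonneg by (intro mult_right_mono divide_right_mono) auto
    finally show "\<bar>bin k n q - pois k (real n * q)\<bar> \<le> (exp (real k) * D + A * E) / real n * phi (real n * q)" .
  qed
qed

lemma bin2_phi_expansion:
  assumes k: "k \<ge> 2" and j: "j \<ge> 2"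
  shows "\<exists>C\<ge>0. \<forall>n q r. 2 * (k + j) \<le> n \<longrightarrow> 0 < n \<longrightarrow> 0 < q \<longrightarrow> 0 < r \<longrightarrow> q + r \<le> 1 \<longrightarrow>
     \<bar>bin2 k j n q r - bin k n q * bin j n r + euler_pois k (real n * q) * euler_pois j (real n * r) / real n\<bar>
     \<le> C / (real n)\<^sup>2 * (phi (real n * q) * phi (real n * r))"
proof -
  obtain A where A: "A \<ge> 0" and b: "\<And>n q r. 2 * (k + j) \<le> n \<Longrightarrow> 0 < n \<Longrightarrow> 0 < q \<Longrightarrow> 0 < r \<Longrightarrow> q + r \<le> 1 \<Longrightarrow>
     \<bar>bin2 k j n q r - bin k n q * bin j n r + euler_pois k (real n * q) * euler_pois j (real n * r) / real n\<bar>
     \<le> A / (real n)\<^sup>2 * ((1 + real n * q) ^ 4 * tail k (real n * q) * ((1 + real n * r) ^ 4 * tail j (real n * r)))"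
    using bin2_expansion[of k j] by blast
  obtain D where D: "D \<ge> 0" "\<And>t. t \<ge> 0 \<Longrightarrow> (1 + t) ^ 4 * tail k t \<le> D * phi t"
    using polynomial_tail_le_phi[OF k, of 4] by blast
  obtain E where E: "E \<ge> 0" "\<And>t. t \<ge> 0 \<Longrightarrow> (1 + t) ^ 4 * tail j t \<le> E * phi t"
    using polynomial_tail_le_phi[OF j, of 4] by blast
  show ?thesis
  proof (intro exI[of _ "A * (D * E)"] conjI allI impI)
    show "A * (D * E) \<ge> 0" using A D E by simp
    fix n :: nat and q r :: real
    assume n: "2 * (k + j) \<le> n" "0 < n" and q: "0 < q" and r: "0 < r" and qr: "q + r \<le> 1"
    have "(1 + real n * q) ^ 4 * tail k (real n * q) * ((1 + real n * r) ^ 4 * tail j (real n * r))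
        \<le> (D * phi (real n * q)) * (E * phi (real n * r))"
      by (rule mult_mono[OF D(2) E(2)]) (use q r D E tail_nonneg phi_nonneg in auto)
    then have "A / (real n)\<^sup>2 * ((1 + real n * q) ^ 4 * tail k (real n * q) * ((1 + real n * r) ^ 4 * tail j (real n * r)))
        \<le> A / (real n)\<^sup>2 * ((D * phi (real n * q)) * (E * phi (real n * r)))"
      using A by (intro mult_left_mono) auto
    with b[OF n q r qr] show "\<bar>bin2 k j n q r - bin k n q * bin j n r + euler_pois k (real n * q) * euler_pois j (real n * r) / real n\<bar>
     \<le> A * (D * E) / (real n)\<^sup>2 * (phi (real n * q) * phi (real n * r))"
      by (simp add: mult_ac)
  qed
qed

section \<open>The covariance as a word sum\<close>

lemma has_sum_extend_zero:
  assumes "(f has_sum s) A" "\<And>x. x \<notin> A \<Longrightarrow> f x = 0"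
  shows "(f has_sum s) UNIV"
  using has_sum_cong_neutral[of UNIV A f f s] assms by auto

lemma has_sum_diagonal:
  fixes f :: "'b \<Rightarrow> real"
  assumes "(f has_sum s) UNIV"
  shows "((\<lambda>(w, w'). if w = w' then f w else 0) has_sum s) UNIV"
proof -
  have "((\<lambda>(w, w'). if w = w' then f w else 0) has_sum s) (range (\<lambda>w. (w, w)))"
    using assms by (subst has_sum_reindex) (auto simp: inj_on_def o_def)
  then show ?thesis by (rule has_sum_extend_zero) auto
qed

lemma has_sum_uminusI:
  fixes f :: "'b \<Rightarrow> real"
  shows "(f has_sum s) A \<Longrightarrow> ((\<lambda>x. - f x) has_sum - s) A"
  by (simp add: has_sum_uminus)

context letter_probs
begin

text \<open>
  Summing over pairs \<open>(w, w @ u)\<close>, first over \<open>u\<close>, gives a word sum inside a word sum.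
\<close>

lemma has_sum_prefix_pairs:
  assumes f: "\<And>t. t > 0 \<Longrightarrow> f t \<ge> 0" and g: "\<And>t. t > 0 \<Longrightarrow> g t \<ge> 0"
    and gk: "\<And>t. t > 0 \<Longrightarrow> \<bar>g t\<bar> \<le> C * kappa t"
    and fk: "\<And>t. t > 0 \<Longrightarrow> \<bar>f t * F g t\<bar> \<le> D * kappa t" and x: "x > 0"
  shows "((\<lambda>(w, w'). if prefix w w' then f (x * P w) * g (x * P w') else 0) has_sum F (\<lambda>t. f t * F g t) x) UNIV"
proof -
  let ?h = "\<lambda>(w, w'). if prefix w w' then f (x * P w) * g (x * P w') else 0"
  have pos: "x * P w > 0" for w using x P_pos by simp
  have inner: "((\<lambda>u. f (x * P w) * g (x * P w * P u)) has_sum f (x * P w) * F g (x * P w)) UNIV" for w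
    unfolding word_sum_def by (intro has_sum_cmult_right has_sum_infsum summable_of_kappa_bound[OF gk pos])
  have outer: "((\<lambda>w. f (x * P w) * F g (x * P w)) has_sum F (\<lambda>t. f t * F g t) x) UNIV"
    unfolding word_sum_def[of p "\<lambda>t. f t * F g t"] by (intro has_sum_infsum summable_of_kappa_bound[OF fk x])
  have "(\<lambda>(w, u). f (x * P w) * g (x * P w * P u)) summable_on UNIV \<times> UNIV"
  proof (rule summable_on_SigmaI)
    show "((\<lambda>u. case (w, u) of (w, u) \<Rightarrow> f (x * P w) * g (x * P w * P u)) has_sum f (x * P w) * F g (x * P w)) UNIV" for w
      using inner[of w] by simp
    show "(\<lambda>w. f (x * P w) * F g (x * P w)) summable_on UNIV" using outer by (rule has_sum_imp_summable)
  qed (use pos f g P_pos in auto)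
  then have "((\<lambda>(w, u). f (x * P w) * g (x * P w * P u)) has_sum F (\<lambda>t. f t * F g t) x) (UNIV \<times> UNIV)"
    using inner outer by (intro has_sum_SigmaI[where g = "\<lambda>w. f (x * P w) * F g (x * P w)"]) auto
  then have "(?h has_sum F (\<lambda>t. f t * F g t) x) ((\<lambda>(w, u). (w, w @ u)) ` (UNIV \<times> UNIV))"
    by (subst has_sum_reindex) (auto simp: inj_on_def o_def case_prod_unfold mult.assoc)
  then show ?thesis by (rule has_sum_extend_zero) (auto simp: prefix_def image_iff)
qed

definition comparable :: "'a list \<Rightarrow> 'a list \<Rightarrow> bool" where
  "comparable w w' \<longleftrightarrow> prefix w w' \<or> prefix w' w"

lemma has_sum_comparable_pairs:
  assumes f: "\<And>t. t > 0 \<Longrightarrow> f t \<ge> 0" and g: "\<And>t. t > 0 \<Longrightarrow> g t \<ge> 0"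
    and tf: "tame phi A f" and tg: "tame phi B g" and x: "x > 0"
  shows "((\<lambda>(w, w'). if comparable w w' then f (x * P w) * g (x * P w') else 0) has_sum
    (F (\<lambda>t. f t * F g t) x + F (\<lambda>t. g t * F f t) x - F (\<lambda>t. f t * g t) x)) UNIV"
proof -
  have k: "tame kappa (66 * A) f" "tame kappa (66 * B) g" using tf tg tame_phi_kappa by auto
  have fk: "\<And>t. t > 0 \<Longrightarrow> \<bar>f t\<bar> \<le> 66 * A * kappa t" and gk: "\<And>t. t > 0 \<Longrightarrow> \<bar>g t\<bar> \<le> 66 * B * kappa t"
    using k by (auto simp: tame_def)
  have t1: "tame kappa (198 * (A * (66 * B / gap))) (\<lambda>t. f t * F g t)"
    using word_sum_linear_bound[OF gk _ tame_nonneg[OF k(2)]] word_sum_log_lipschitz[OF k(2) tame_nonneg[OF k(2)]]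
    by (intro tame_times[OF tf]) (auto simp: mult_ac)
  have t2: "tame kappa (198 * (B * (66 * A / gap))) (\<lambda>t. g t * F f t)"
    using word_sum_linear_bound[OF fk _ tame_nonneg[OF k(1)]] word_sum_log_lipschitz[OF k(1) tame_nonneg[OF k(1)]]
    by (intro tame_times[OF tg]) (auto simp: mult_ac)
  have t3: "tame kappa (198 * (A * (2 * B))) (\<lambda>t. f t * g t)"
    using tame_linear[OF tg] by (intro tame_times[OF tf]) auto
  have bound: "\<And>t. t > 0 \<Longrightarrow> \<bar>h t\<bar> \<le> E * kappa t" if "tame kappa E h" for E h using that by (auto simp: tame_def)
  have s1: "((\<lambda>(w, w'). if prefix w w' then f (x * P w) * g (x * P w') else 0) has_sum F (\<lambda>t. f t * F g t) x) UNIV"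
    by (rule has_sum_prefix_pairs[OF f g gk bound[OF t1] x])
  have "((\<lambda>(w, w'). if prefix w w' then g (x * P w) * f (x * P w') else 0) has_sum F (\<lambda>t. g t * F f t) x) (UNIV \<times> UNIV)"
    using has_sum_prefix_pairs[OF g f fk bound[OF t2] x] by simp
  then have s2: "((\<lambda>(w, w'). if prefix w' w then f (x * P w) * g (x * P w') else 0) has_sum F (\<lambda>t. g t * F f t) x) UNIV"
    by (subst (asm) has_sum_swap) (simp add: mult.commute cong: if_cong)
  have s3: "((\<lambda>(w, w'). if w = w' then f (x * P w) * g (x * P w) else 0) has_sum F (\<lambda>t. f t * g t) x) UNIV"
    unfolding word_sum_def by (intro has_sum_diagonal has_sum_infsum summable_of_kappa_bound[OF bound[OF t3] x])
  have "((\<lambda>b. (case b of (w, w') \<Rightarrow> if prefix w w' then f (x * P w) * g (x * P w') else 0)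
      + (case b of (w, w') \<Rightarrow> if prefix w' w then f (x * P w) * g (x * P w') else 0)
      + - (case b of (w, w') \<Rightarrow> if w = w' then f (x * P w) * g (x * P w) else 0)) has_sum
      (F (\<lambda>t. f t * F g t) x + F (\<lambda>t. g t * F f t) x + - F (\<lambda>t. f t * g t) x)) UNIV"
    by (intro has_sum_add s1 s2) (use s3 in \<open>simp add: has_sum_uminus\<close>)
  moreover have "(\<lambda>b. (case b of (w, w') \<Rightarrow> if prefix w w' then f (x * P w) * g (x * P w') else 0)
      + (case b of (w, w') \<Rightarrow> if prefix w' w then f (x * P w) * g (x * P w') else 0)
      + - (case b of (w, w') \<Rightarrow> if w = w' then f (x * P w) * g (x * P w) else 0))
      = (\<lambda>(w, w'). if comparable w w' then f (x * P w) * g (x * P w') else 0)"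
    by (auto simp: fun_eq_iff comparable_def)
  ultimately show ?thesis by simp
qed

lemma incomparable_P_le_1:
  assumes "\<not> comparable w w'"
  shows "P w + P w' \<le> 1"
proof -
  define D where "D = max (length w) (length w')"
  have fin: "finite {u :: 'a list. length u = D}" by (rule finite_subset[OF _ finite_short_words[of "Suc D"]]) auto
  have "P w + P w' = (\<Sum>u | length u = D \<and> prefix w u. P u) + (\<Sum>u | length u = D \<and> prefix w' u. P u)"
    by (simp add: sum_P_extensions D_def)
  also have "\<dots> = (\<Sum>u\<in>{u. length u = D \<and> prefix w u} \<union> {u. length u = D \<and> prefix w' u}. P u)"
  proof (rule sum.union_disjoint[symmetric])
    show "{u. length u = D \<and> prefix w u} \<inter> {u. length u = D \<and> prefix w' u} = {}"
      using assms prefix_same_cases unfolding comparable_def by blast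
  qed (auto intro: finite_subset[OF _ fin])
  also have "\<dots> \<le> (\<Sum>u | length u = D. P u)"
    using fin P_pos by (intro sum_mono2) (auto intro: less_imp_le)
  finally show ?thesis by (simp add: sum_P_length)
qed

text \<open>
  Both sums of the error terms, over single words and over comparable pairs, are of order \<open>x\<close>.
\<close>

lemma phi_word_sums:
  shows "\<exists>C\<ge>0. \<forall>x>0. ((\<lambda>w. phi (x * P w)) has_sum F phi x) UNIV \<and> 0 \<le> F phi x \<and> F phi x \<le> C * x \<and>
    (\<exists>s\<le>C * x. ((\<lambda>(w, w'). (if prefix w w' then phi (x * P w) * phi (x * P w') else 0)
        + (if prefix w' w then phi (x * P w) * phi (x * P w') else 0)) has_sum s) UNIV)"
proof -
  have k: "\<And>t. t > 0 \<Longrightarrow> \<bar>phi t\<bar> \<le> 66 * kappa t" using polynomial_phi_le_kappa(1) phi_nonneg by simp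
  have F0: "F phi t \<ge> 0" for t unfolding word_sum_def by (intro infsum_nonneg phi_nonneg)
  have Fl: "F phi t \<le> 66 / gap * t" if "t > 0" for t using word_sum_linear_bound[OF k that] by simp
  have k2: "\<bar>phi t * F phi t\<bar> \<le> 66 / gap * 66 * kappa t" if "t > 0" for t
  proof -
    have "phi t * F phi t \<le> phi t * (66 / gap * t)" using Fl[OF that] phi_nonneg by (intro mult_left_mono)
    also have "\<dots> = 66 / gap * (t * phi t)" by simp
    also have "\<dots> \<le> 66 / gap * (66 * kappa t)"
      using polynomial_phi_le_kappa(2)[OF that] gap_pos by (intro mult_left_mono) auto
    finally show ?thesis using phi_nonneg F0 by simp
  qed
  define C where "C = 66 / gap + 2 * (66 / gap * 66 / gap)"
  have C: "C \<ge> 66 / gap" "C \<ge> 2 * (66 / gap * 66 / gap)" "C \<ge> 0" unfolding C_def using gap_pos by (auto simp: add_nonneg_nonneg)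
  show ?thesis
  proof (rule exI[of _ C], intro conjI allI impI)
    fix x :: real assume x: "x > 0"
    show "((\<lambda>w. phi (x * P w)) has_sum F phi x) UNIV"
      unfolding word_sum_def by (intro has_sum_infsum summable_of_kappa_bound[OF k x])
    show "F phi x \<le> C * x" using Fl[OF x] C(1) x mult_right_mono[OF C(1), of x] by linarith
    have s1: "((\<lambda>(w, w'). if prefix w w' then phi (x * P w) * phi (x * P w') else 0) has_sum F (\<lambda>t. phi t * F phi t) x) UNIV"
      by (rule has_sum_prefix_pairs[OF phi_nonneg phi_nonneg k k2 x])
    then have "((\<lambda>(w, w'). if prefix w w' then phi (x * P w) * phi (x * P w') else 0) has_sum F (\<lambda>t. phi t * F phi t) x) (UNIV \<times> UNIV)"
      by simp
    then have s2: "((\<lambda>(w, w'). if prefix w' w then phi (x * P w) * phi (x * P w') else 0) has_sum F (\<lambda>t. phi t * F phi t) x) UNIV"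
      by (subst (asm) has_sum_swap) (simp add: mult.commute cong: if_cong)
    have "F (\<lambda>t. phi t * F phi t) x \<le> 66 / gap * 66 / gap * x"
      using word_sum_linear_bound[OF k2 x] gap_pos by simp
    then have "F (\<lambda>t. phi t * F phi t) x + F (\<lambda>t. phi t * F phi t) x \<le> C * x"
      using mult_right_mono[OF C(2), of x] x by (simp add: mult.assoc)
    then show "\<exists>s\<le>C * x. ((\<lambda>(w, w'). (if prefix w w' then phi (x * P w) * phi (x * P w') else 0)
        + (if prefix w' w then phi (x * P w) * phi (x * P w') else 0)) has_sum s) UNIV"
      using has_sum_add[OF s1 s2] by (auto simp: case_prod_unfold)
  qed (use F0 C in auto)
qed

end

context random_strings
begin

text \<open>
  Up to the factor \<open>Q T\<close> this is the Euler derivative of the Poisson weight at \<open>w\<close>, so that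
  \<open>F (drift T) n / n\<close> plays the role of the derivative with respect to \<open>n\<close> of the expected count.
\<close>

definition drift :: "'a list set \<Rightarrow> real \<Rightarrow> real" where
  "drift T t = Q T * euler_pois (card T) t"

text \<open>
  The contribution of the comparable pairs. The first term comes from \<open>w = w'\<close>; the remaining ones
  are the product of expectations at comparable words, where joint occurrences do not exist. Words below \<open>w\<close> and
  words above \<open>w\<close> each give one summand, and the last one corrects for \<open>w = w'\<close> being counted in both.
\<close>

definition spread :: "'a list set \<Rightarrow> 'a list set \<Rightarrow> real \<Rightarrow> real" where
  "spread T T' t = (if T = T' then Q T else 0) * pois (card T) t
     - Q T * Q T' * (pois (card T) t * F (pois (card T')) t + pois (card T') t * F (pois (card T)) t
         - pois (card T) t * pois (card T') t)"

lemma Q_bounds: "0 \<le> Q T" "Q T \<le> 1"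
  unfolding shape_functional_def by auto

text \<open>The Poisson approximation of the summand of the covariance that belongs to the words \<open>w\<close> and \<open>w'\<close>.\<close>

definition summand :: "'a list set \<Rightarrow> 'a list set \<Rightarrow> real \<Rightarrow> 'a list \<Rightarrow> 'a list \<Rightarrow> real" where
  "summand T T' x w w' = (if w = w' then (if T = T' then Q T else 0) * pois (card T) (x * P w) else 0)
     - Q T * Q T' * (if comparable w w' then pois (card T) (x * P w) * pois (card T') (x * P w') else 0)
     - drift T (x * P w) * drift T' (x * P w') / x"

lemma summand_has_sum:
  assumes T: "motif \<tau> T" and T': "motif \<tau>' T'" and x: "x > 0"
  shows "((\<lambda>(w, w'). summand T T' x w w') has_sum (F (spread T T') x - F (drift T) x * F (drift T') x / x)) UNIV"
proof -
  have c: "card T \<ge> 2" "card T' \<ge> 2" using motif_finite[OF T] motif_finite[OF T'] by auto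
  obtain A B where A: "tame phi A (pois (card T))" and B: "tame phi B (pois (card T'))"
    using pois_tame c by blast
  have ps: "(g has_sum F h x) UNIV" if "\<exists>C. tame kappa C h" "g = (\<lambda>w. h (x * P w))" for g h
    using that unfolding word_sum_def by (auto simp: tame_def intro!: has_sum_infsum summable_of_kappa_bound x)
  have sp: "((\<lambda>w. pois (card T) (x * P w)) has_sum F (pois (card T)) x) UNIV"
    by (rule ps[OF tame_kappa_pois[OF c(1)]]) simp
  have sd: "((\<lambda>w. drift U (x * P w)) has_sum F (drift U) x) UNIV" if "card U \<ge> 2" for U
  proof -
    obtain C where "tame kappa C (euler_pois (card U))" using tame_kappa_euler_pois \<open>card U \<ge> 2\<close> by blast
    then have "tame kappa (\<bar>Q U\<bar> * C) (drift U)" unfolding drift_def[abs_def] by (rule tame_cmult)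
    then show ?thesis by (intro ps) auto
  qed
  have nonneg: "\<And>t. t > 0 \<Longrightarrow> pois k t \<ge> 0" for k by (simp add: pois_nonneg)
  define q where "q = (if T = T' then Q T else 0)"
  define w1 where "w1 = F (\<lambda>t. pois (card T) t * F (pois (card T')) t) x"
  define w2 where "w2 = F (\<lambda>t. pois (card T') t * F (pois (card T)) t) x"
  define w3 where "w3 = F (\<lambda>t. pois (card T) t * pois (card T') t) x"
  have s1: "((\<lambda>(w, w'). if w = w' then q * pois (card T) (x * P w) else 0) has_sum q * F (pois (card T)) x) UNIV"
    by (intro has_sum_diagonal has_sum_cmult_right sp)
  have s2: "((\<lambda>b. Q T * Q T' * (case b of (w, w') \<Rightarrow> if comparable w w' then pois (card T) (x * P w) * pois (card T') (x * P w') else 0))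
      has_sum Q T * Q T' * (w1 + w2 - w3)) UNIV"
    unfolding w1_def w2_def w3_def
    by (intro has_sum_cmult_right has_sum_comparable_pairs[OF nonneg nonneg A B x])
  have s3: "((\<lambda>b. inverse x * (case b of (w, w') \<Rightarrow> drift T (x * P w) * drift T' (x * P w'))) has_sum inverse x * (F (drift T) x * F (drift T') x)) UNIV"
    by (intro has_sum_cmult_right has_sum_product sd c)
  have eq: "F (spread T T') x = q * F (pois (card T)) x - Q T * Q T' * (w1 + w2 - w3)"
  proof -
    have t3: "\<exists>C. tame kappa C (\<lambda>t. pois (card T) t * pois (card T') t)"
      using tame_times[OF A tame_linear[OF B]] by blast
    have "((\<lambda>w. q * pois (card T) (x * P w) + - (Q T * Q T' * (pois (card T) (x * P w) * F (pois (card T')) (x * P w)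
         + pois (card T') (x * P w) * F (pois (card T)) (x * P w) + - (pois (card T) (x * P w) * pois (card T') (x * P w)))))
        has_sum (q * F (pois (card T)) x + - (Q T * Q T' * (w1 + w2 + - w3)))) UNIV"
      unfolding w1_def w2_def w3_def
      by (intro has_sum_add has_sum_cmult_right has_sum_uminusI sp
          ps[OF tame_pois_times_word_sum[OF c]] ps[OF tame_pois_times_word_sum[OF c(2,1)]] ps[OF t3] refl)
    then show ?thesis unfolding word_sum_def[of p "spread T T'"] spread_def q_def[symmetric]
      by (intro infsumI) simp
  qed
  have "((\<lambda>b. (case b of (w, w') \<Rightarrow> if w = w' then q * pois (card T) (x * P w) else 0)
      + - (Q T * Q T' * (case b of (w, w') \<Rightarrow> if comparable w w' then pois (card T) (x * P w) * pois (card T') (x * P w') else 0))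
      + - (inverse x * (case b of (w, w') \<Rightarrow> drift T (x * P w) * drift T' (x * P w')))) has_sum
      (q * F (pois (card T)) x + - (Q T * Q T' * (w1 + w2 - w3)) + - (inverse x * (F (drift T) x * F (drift T') x)))) UNIV"
    by (intro has_sum_add has_sum_uminusI s1 s2 s3)
  moreover have "(\<lambda>b. (case b of (w, w') \<Rightarrow> if w = w' then q * pois (card T) (x * P w) else 0)
      + - (Q T * Q T' * (case b of (w, w') \<Rightarrow> if comparable w w' then pois (card T) (x * P w) * pois (card T') (x * P w') else 0))
      + - (inverse x * (case b of (w, w') \<Rightarrow> drift T (x * P w) * drift T' (x * P w')))) = (\<lambda>(w, w'). summand T T' x w w')"
    unfolding summand_def q_def[symmetric] by (auto simp: fun_eq_iff divide_inverse mult_ac)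
  ultimately show ?thesis unfolding eq by (simp add: divide_inverse mult_ac)
qed

text \<open>
  An error of order \<open>1 / n\<close>, as in the passage from binomial to Poisson weights, can be afforded at comparable
  words only, where the weights sum to \<open>O(n)\<close>. Over all pairs \<open>(w, w')\<close> they sum to \<open>O(n\<^sup>2)\<close>, and at
  incomparable words the error of order \<open>1 / n\<^sup>2\<close> from \<open>bin2_phi_expansion\<close> is needed. At comparable words the product of the drifts in \<open>summand\<close> is
  part of the error; it is there so that the sum over all pairs factorizes.
\<close>

lemma summand_error:
  assumes T: "motif \<tau> T" and T': "motif \<tau>' T'" and rel: "T = T' \<or> nonoverlapping T T'"
  shows "\<exists>C\<ge>0. \<forall>n\<ge>2 * (\<tau> + \<tau>'). \<forall>w w'.
    \<bar>prob {\<omega> \<in> space M. occurrence T (\<lambda>i. S i \<omega>) n w \<and> occurrence T' (\<lambda>i. S i \<omega>) n w'}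
      - prob {\<omega> \<in> space M. occurrence T (\<lambda>i. S i \<omega>) n w} * prob {\<omega> \<in> space M. occurrence T' (\<lambda>i. S i \<omega>) n w'}
      - summand T T' (real n) w w'\<bar>
    \<le> C / real n * (if w = w' then phi (real n * P w) else 0)
      + C / real n * ((if prefix w w' then phi (real n * P w) * phi (real n * P w') else 0)
        + (if prefix w' w then phi (real n * P w) * phi (real n * P w') else 0))
      + C / (real n)\<^sup>2 * (phi (real n * P w) * phi (real n * P w'))"
proof -
  have c: "card T = \<tau>" "card T' = \<tau>'" "\<tau> \<ge> 2" "\<tau>' \<ge> 2" using motif_finite[OF T] motif_finite[OF T'] by auto
  obtain A where A: "A \<ge> 0" "\<And>n q. 2 * \<tau> \<le> n \<Longrightarrow> 0 < n \<Longrightarrow> 0 < q \<Longrightarrow> q \<le> 1 \<Longrightarrow>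
      bin \<tau> n q \<le> A * phi (real n * q) \<and> \<bar>bin \<tau> n q - pois \<tau> (real n * q)\<bar> \<le> A / real n * phi (real n * q)"
    using bin_phi_bounds[OF c(3)] by blast
  obtain A' where A': "A' \<ge> 0" "\<And>n q. 2 * \<tau>' \<le> n \<Longrightarrow> 0 < n \<Longrightarrow> 0 < q \<Longrightarrow> q \<le> 1 \<Longrightarrow>
      bin \<tau>' n q \<le> A' * phi (real n * q) \<and> \<bar>bin \<tau>' n q - pois \<tau>' (real n * q)\<bar> \<le> A' / real n * phi (real n * q)"
    using bin_phi_bounds[OF c(4)] by blast
  obtain B where B: "B \<ge> 0" "\<And>n q r. 2 * (\<tau> + \<tau>') \<le> n \<Longrightarrow> 0 < n \<Longrightarrow> 0 < q \<Longrightarrow> 0 < r \<Longrightarrow> q + r \<le> 1 \<Longrightarrow>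
     \<bar>bin2 \<tau> \<tau>' n q r - bin \<tau> n q * bin \<tau>' n r + euler_pois \<tau> (real n * q) * euler_pois \<tau>' (real n * r) / real n\<bar>
     \<le> B / (real n)\<^sup>2 * (phi (real n * q) * phi (real n * r))"
    using bin2_phi_expansion[OF c(3,4)] by blast
  obtain G where G: "tame phi G (pois \<tau>)" using pois_tame c by blast
  obtain H where H: "tame phi H (euler_pois \<tau>)" using euler_pois_tame c by blast
  obtain H' where H': "tame phi H' (euler_pois \<tau>')" using euler_pois_tame c by blast
  have nn: "G \<ge> 0" "H \<ge> 0" "H' \<ge> 0" using G H H' tame_phi_nonneg by auto
  define C where "C = A + (A * A' + G * A' + H * H') + B"
  have C: "C \<ge> 0" "A \<le> C" "A * A' + G * A' + H * H' \<le> C" "B \<le> C"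
    unfolding C_def using A A' B nn by (auto simp: add_nonneg_nonneg)
  show ?thesis
  proof (intro exI[of _ C] conjI allI impI)
    show "C \<ge> 0" by (rule C)
    fix n :: nat and w w' :: "'a list"
    assume n: "n \<ge> 2 * (\<tau> + \<tau>')"
    define x y where "x = real n * P w" and "y = real n * P w'"
    have n0: "0 < n" "2 * \<tau> \<le> n" "2 * \<tau>' \<le> n" using n c by auto
    have pq: "0 < P w" "P w \<le> 1" "0 < P w'" "P w' \<le> 1" using P_pos P_le_1 by auto
    have xy: "x > 0" "y > 0" unfolding x_def y_def using n0 pq by auto
    have ph: "phi x \<ge> 0" "phi y \<ge> 0" by (rule phi_nonneg)+
    have QQ: "0 \<le> Q T * Q T'" "Q T * Q T' \<le> 1" using Q_bounds mult_le_one[OF Q_bounds(2) Q_bounds(1) Q_bounds(2), of T T'] by auto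
    have po: "prob {\<omega> \<in> space M. occurrence T (\<lambda>i. S i \<omega>) n w} = Q T * bin \<tau> n (P w)"
      "prob {\<omega> \<in> space M. occurrence T' (\<lambda>i. S i \<omega>) n w'} = Q T' * bin \<tau>' n (P w')"
      unfolding bin_def using prob_occurrence[OF T] prob_occurrence[OF T'] by auto
    have eul: "\<bar>euler_pois \<tau> x * euler_pois \<tau>' y\<bar> \<le> H * H' * (phi x * phi y)"
    proof -
      have "\<bar>euler_pois \<tau> x\<bar> * \<bar>euler_pois \<tau>' y\<bar> \<le> (H * phi x) * (H' * phi y)"
        using H H' xy nn ph by (intro mult_mono) (auto simp: tame_def)
      then show ?thesis by (simp add: abs_mult mult_ac)
    qed
    show "\<bar>prob {\<omega> \<in> space M. occurrence T (\<lambda>i. S i \<omega>) n w \<and> occurrence T' (\<lambda>i. S i \<omega>) n w'}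
      - prob {\<omega> \<in> space M. occurrence T (\<lambda>i. S i \<omega>) n w} * prob {\<omega> \<in> space M. occurrence T' (\<lambda>i. S i \<omega>) n w'}
      - summand T T' (real n) w w'\<bar>
    \<le> C / real n * (if w = w' then phi (real n * P w) else 0)
      + C / real n * ((if prefix w w' then phi (real n * P w) * phi (real n * P w') else 0)
        + (if prefix w' w then phi (real n * P w) * phi (real n * P w') else 0))
      + C / (real n)\<^sup>2 * (phi (real n * P w) * phi (real n * P w'))"
      (is "\<bar>?J - _ * _ - _\<bar> \<le> ?R")
    proof (cases "comparable w w'")
      case False
      then have inc: "\<not> prefix w w'" "\<not> prefix w' w" "w \<noteq> w'" by (auto simp: comparable_def)
      have J: "?J = Q T * Q T' * bin2 \<tau> \<tau>' n (P w) (P w')"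
        unfolding bin2_def using prob_joint_occurrence[OF T T' inc(1,2)] by simp
      have s: "summand T T' (real n) w w' = - (Q T * Q T' * (euler_pois \<tau> x * euler_pois \<tau>' y / real n))"
        unfolding summand_def drift_def c x_def y_def using False inc by simp
      have "?J - prob {\<omega> \<in> space M. occurrence T (\<lambda>i. S i \<omega>) n w} * prob {\<omega> \<in> space M. occurrence T' (\<lambda>i. S i \<omega>) n w'} - summand T T' (real n) w w'
          = Q T * Q T' * (bin2 \<tau> \<tau>' n (P w) (P w') - bin \<tau> n (P w) * bin \<tau>' n (P w') + euler_pois \<tau> x * euler_pois \<tau>' y / real n)"
        unfolding J po s by (simp add: algebra_simps)
      also have "\<bar>\<dots>\<bar> \<le> 1 * (B / (real n)\<^sup>2 * (phi x * phi y))"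
        unfolding abs_mult[of "Q T * Q T'"]
      proof (intro mult_mono)
        show "\<bar>bin2 \<tau> \<tau>' n (P w) (P w') - bin \<tau> n (P w) * bin \<tau>' n (P w') + euler_pois \<tau> x * euler_pois \<tau>' y / real n\<bar> \<le> B / (real n)\<^sup>2 * (phi x * phi y)"
          unfolding x_def y_def using incomparable_P_le_1[OF False] pq n n0 by (intro B(2)) auto
      qed (use QQ in auto)
      also have "\<dots> \<le> C / (real n)\<^sup>2 * (phi x * phi y)"
        unfolding mult_1 using C ph by (intro mult_right_mono divide_right_mono) auto
      finally show ?thesis using inc by (simp add: x_def y_def)
    next
      case True
      have J: "?J = (if w = w' then (if T = T' then Q T else 0) * bin \<tau> n (P w) else 0)"
      proof (cases "T = T' \<and> w = w'")
        case True
        then show ?thesis using po by simp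
      next
        case False
        have "{\<omega> \<in> space M. occurrence T (\<lambda>i. S i \<omega>) n w \<and> occurrence T' (\<lambda>i. S i \<omega>) n w'} = {}"
          using comparable_occurrences[OF T T' rel] \<open>comparable w w'\<close> False unfolding comparable_def by blast
        then have "?J = 0" by (simp only: measure_empty)
        then show ?thesis using False by simp
      qed
      define q where "q = (if T = T' then Q T else 0)"
      have q: "0 \<le> q" "q \<le> 1" unfolding q_def using Q_bounds by auto
      have d1: "\<bar>if w = w' then q * (bin \<tau> n (P w) - pois \<tau> x) else 0\<bar> \<le> C / real n * (if w = w' then phi x else 0)"
      proof (cases "w = w'")
        case True
        have "\<bar>q * (bin \<tau> n (P w) - pois \<tau> x)\<bar> \<le> 1 * (A / real n * phi x)"
          unfolding abs_mult using A(2)[OF n0(2,1) pq(1,2)] q by (intro mult_mono) (auto simp: x_def)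
        also have "\<dots> \<le> C / real n * phi x" unfolding mult_1 using C ph by (intro mult_right_mono divide_right_mono) auto
        finally show ?thesis using True by simp
      qed simp
      have "bin \<tau> n (P w) * bin \<tau>' n (P w') - pois \<tau> x * pois \<tau>' y
          = (bin \<tau> n (P w) - pois \<tau> x) * bin \<tau>' n (P w') + pois \<tau> x * (bin \<tau>' n (P w') - pois \<tau>' y)" by (simp add: algebra_simps)
      also have "\<bar>\<dots>\<bar> \<le> \<bar>bin \<tau> n (P w) - pois \<tau> x\<bar> * \<bar>bin \<tau>' n (P w')\<bar> + \<bar>pois \<tau> x\<bar> * \<bar>bin \<tau>' n (P w') - pois \<tau>' y\<bar>"
        by (metis abs_mult abs_triangle_ineq)
      also have "\<dots> \<le> (A / real n * phi x) * (A' * phi y) + (G * phi x) * (A' / real n * phi y)"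
        using A(2)[OF n0(2,1) pq(1,2)] A'(2)[OF n0(3,1) pq(3,4)] G xy A(1) A'(1) nn ph bin_nonneg[of "P w'" \<tau>' n] pq
        by (intro add_mono mult_mono) (auto simp: x_def y_def tame_def)
      also have "\<dots> = (A * A' + G * A') / real n * (phi x * phi y)" by (simp add: add_divide_distrib distrib_right distrib_left mult_ac)
      finally have d2: "\<bar>bin \<tau> n (P w) * bin \<tau>' n (P w') - pois \<tau> x * pois \<tau>' y\<bar> \<le> (A * A' + G * A') / real n * (phi x * phi y)" .
      have "\<bar>euler_pois \<tau> x * euler_pois \<tau>' y / real n\<bar> \<le> H * H' / real n * (phi x * phi y)"
        using divide_right_mono[OF eul, of "real n"] by simp
      with d2 have "\<bar>- (bin \<tau> n (P w) * bin \<tau>' n (P w') - pois \<tau> x * pois \<tau>' y) + euler_pois \<tau> x * euler_pois \<tau>' y / real n\<bar>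
          \<le> (A * A' + G * A' + H * H') / real n * (phi x * phi y)"
        unfolding add_divide_distrib distrib_right by linarith
      also have "\<dots> \<le> C / real n * (phi x * phi y)"
        using C ph by (intro mult_right_mono divide_right_mono) auto
      finally have d3: "\<bar>Q T * Q T' * (- (bin \<tau> n (P w) * bin \<tau>' n (P w') - pois \<tau> x * pois \<tau>' y) + euler_pois \<tau> x * euler_pois \<tau>' y / real n)\<bar>
          \<le> 1 * (C / real n * (phi x * phi y))"
        unfolding abs_mult[of "Q T * Q T'"] using QQ by (intro mult_mono) auto
      have "?J - prob {\<omega> \<in> space M. occurrence T (\<lambda>i. S i \<omega>) n w} * prob {\<omega> \<in> space M. occurrence T' (\<lambda>i. S i \<omega>) n w'} - summand T T' (real n) w w'
          = (if w = w' then q * (bin \<tau> n (P w) - pois \<tau> x) else 0)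
            + Q T * Q T' * (- (bin \<tau> n (P w) * bin \<tau>' n (P w') - pois \<tau> x * pois \<tau>' y) + euler_pois \<tau> x * euler_pois \<tau>' y / real n)"
        unfolding J po summand_def drift_def c x_def[symmetric] y_def[symmetric] q_def[symmetric] using True
        by (auto simp: algebra_simps)
      also have "\<bar>\<dots>\<bar> \<le> C / real n * (if w = w' then phi x else 0) + C / real n * (phi x * phi y)"
        using d1 d3 by linarith
      also have "\<dots> \<le> ?R"
      proof -
        have "phi x * phi y \<le> (if prefix w w' then phi x * phi y else 0) + (if prefix w' w then phi x * phi y else 0)"
          using True ph by (auto simp: comparable_def)
        then have "C / real n * (phi x * phi y) \<le> C / real n * ((if prefix w w' then phi x * phi y else 0) + (if prefix w' w then phi x * phi y else 0))"
          using C by (intro mult_left_mono) auto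
        moreover have "0 \<le> C / (real n)\<^sup>2 * (phi x * phi y)" using C ph by simp
        ultimately show ?thesis unfolding x_def y_def by linarith
      qed
      finally show ?thesis .
    qed
  qed
qed

text \<open>
  The three error terms of \<open>summand_error\<close> sum to \<open>O(1 / n) * O(n)\<close>, \<open>O(1 / n) * O(n)\<close> and
  \<open>O(1 / n\<^sup>2) * O(n\<^sup>2)\<close>.
\<close>

theorem covariance_approx:
  assumes T: "motif \<tau> T" and T': "motif \<tau>' T'" and rel: "T = T' \<or> nonoverlapping T T'"
  shows "\<exists>B\<ge>0. \<forall>n\<ge>2 * (\<tau> + \<tau>'). \<bar>covariance M (motif_count S T n) (motif_count S T' n)
    - (F (spread T T') (real n) - F (drift T) (real n) * F (drift T') (real n) / real n)\<bar> \<le> B"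
proof -
  obtain C where C: "C \<ge> 0" and err: "\<And>n w w'. n \<ge> 2 * (\<tau> + \<tau>') \<Longrightarrow>
    \<bar>prob {\<omega> \<in> space M. occurrence T (\<lambda>i. S i \<omega>) n w \<and> occurrence T' (\<lambda>i. S i \<omega>) n w'}
      - prob {\<omega> \<in> space M. occurrence T (\<lambda>i. S i \<omega>) n w} * prob {\<omega> \<in> space M. occurrence T' (\<lambda>i. S i \<omega>) n w'}
      - summand T T' (real n) w w'\<bar>
    \<le> C / real n * (if w = w' then phi (real n * P w) else 0)
      + C / real n * ((if prefix w w' then phi (real n * P w) * phi (real n * P w') else 0)
        + (if prefix w' w then phi (real n * P w) * phi (real n * P w') else 0))
      + C / (real n)\<^sup>2 * (phi (real n * P w) * phi (real n * P w'))"
    using summand_error[OF T T' rel] by blast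
  obtain D where D: "D \<ge> 0" and ph: "\<And>x. x > 0 \<Longrightarrow> ((\<lambda>w. phi (x * P w)) has_sum F phi x) UNIV \<and> 0 \<le> F phi x \<and> F phi x \<le> D * x \<and>
    (\<exists>s\<le>D * x. ((\<lambda>(w, w'). (if prefix w w' then phi (x * P w) * phi (x * P w') else 0)
        + (if prefix w' w then phi (x * P w) * phi (x * P w') else 0)) has_sum s) UNIV)"
    using phi_word_sums by blast
  show ?thesis
  proof (intro exI[of _ "C * D + C * D + C * D\<^sup>2"] conjI allI impI)
    show "C * D + C * D + C * D\<^sup>2 \<ge> 0" using C D by simp
    fix n assume n: "n \<ge> 2 * (\<tau> + \<tau>')"
    have "\<tau> \<ge> 2" using motif_finite[OF T] by simp
    then have n0: "real n > 0" using n by simp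
    obtain s where s: "s \<le> D * real n" and s2: "((\<lambda>(w, w'). (if prefix w w' then phi (real n * P w) * phi (real n * P w') else 0)
        + (if prefix w' w then phi (real n * P w) * phi (real n * P w') else 0)) has_sum s) UNIV"
      using ph[OF n0] by blast
    have s1: "((\<lambda>w. phi (real n * P w)) has_sum F phi (real n)) UNIV" and Fp: "0 \<le> F phi (real n)" "F phi (real n) \<le> D * real n"
      using ph[OF n0] by auto
    define E where "E b = C / real n * (case b of (w, w') \<Rightarrow> if w = w' then phi (real n * P w) else 0)
      + C / real n * (case b of (w, w') \<Rightarrow> (if prefix w w' then phi (real n * P w) * phi (real n * P w') else 0)
        + (if prefix w' w then phi (real n * P w) * phi (real n * P w') else 0))
      + C / (real n)\<^sup>2 * (case b of (w, w') \<Rightarrow> phi (real n * P w) * phi (real n * P w'))" for b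
    have sE: "(E has_sum (C / real n * F phi (real n) + C / real n * s + C / (real n)\<^sup>2 * (F phi (real n) * F phi (real n)))) UNIV"
      unfolding E_def[abs_def] by (intro has_sum_add has_sum_cmult_right has_sum_diagonal s1 s2 has_sum_product)
    let ?f = "\<lambda>b. (case b of (w, w') \<Rightarrow> prob {\<omega> \<in> space M. occurrence T (\<lambda>i. S i \<omega>) n w \<and> occurrence T' (\<lambda>i. S i \<omega>) n w'}
      - prob {\<omega> \<in> space M. occurrence T (\<lambda>i. S i \<omega>) n w} * prob {\<omega> \<in> space M. occurrence T' (\<lambda>i. S i \<omega>) n w'})
      + - (case b of (w, w') \<Rightarrow> summand T T' (real n) w w')"
    have sf: "(?f has_sum (covariance M (motif_count S T n) (motif_count S T' n)
        + - (F (spread T T') (real n) - F (drift T) (real n) * F (drift T') (real n) / real n))) UNIV"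
      by (intro has_sum_add has_sum_uminusI covariance_has_sum[OF T T'] summand_has_sum[OF T T' n0])
    have "norm (covariance M (motif_count S T n) (motif_count S T' n)
        + - (F (spread T T') (real n) - F (drift T) (real n) * F (drift T') (real n) / real n))
      \<le> C / real n * F phi (real n) + C / real n * s + C / (real n)\<^sup>2 * (F phi (real n) * F phi (real n))"
    proof (rule norm_infsum_le[OF sf sE])
      fix b :: "'a list \<times> 'a list"
      show "norm (?f b) \<le> E b" using err[OF n, of "fst b" "snd b"] unfolding E_def by (simp add: case_prod_unfold)
    qed
    also have "\<dots> \<le> C / real n * (D * real n) + C / real n * (D * real n) + C / (real n)\<^sup>2 * ((D * real n) * (D * real n))"
      using Fp s C D n0 by (intro add_mono mult_left_mono mult_mono) auto
    also have "\<dots> = C * D + C * D + C * D\<^sup>2" using n0 by (simp add: power2_eq_square)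
    finally show "\<bar>covariance M (motif_count S T n) (motif_count S T' n)
      - (F (spread T T') (real n) - F (drift T) (real n) * F (drift T') (real n) / real n)\<bar> \<le> C * D + C * D + C * D\<^sup>2"
      by simp
  qed
qed

end

section \<open>The limit profile and the constants\<close>

context letter_probs
begin

text \<open>
  A profile collects what is needed of both limit theorems: a continuous periodic function that is
  approached by \<open>F f x / x\<close> on a logarithmic scale.
\<close>

definition profile :: "real \<Rightarrow> (real \<Rightarrow> real) \<Rightarrow> (real \<Rightarrow> real) \<Rightarrow> bool" where
  "profile d f G \<longleftrightarrow> continuous_on UNIV G \<and> (\<forall>x. G (x + d) = G x) \<and>
     integral {0..d} G = d * (weight f / source_entropy p) \<and>
     (\<not> periodic_probs p \<longrightarrow> (\<forall>x. G x = weight f / source_entropy p)) \<and>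
     ((\<lambda>x. F f x / x - G (ln x)) \<longlongrightarrow> 0) at_top \<and>
     (periodic_probs p \<longrightarrow> (\<exists>\<epsilon> B. 0 < \<epsilon> \<and> \<epsilon> < 1 \<and> (\<forall>x\<ge>1. \<bar>F f x - x * G (ln x)\<bar> \<le> B * x powr (1 - \<epsilon>))))"

lemma profile_exists:
  obtains d where "d > 0" "\<And>f C. tame kappa C f \<Longrightarrow> \<exists>G. profile d f G"
proof (cases "periodic_probs p")
  case True
  obtain d where d: "d > 0"
    "\<And>f C. tame kappa C f \<Longrightarrow> \<exists>G \<epsilon> B. continuous_on UNIV G \<and> (\<forall>x. G (x + d) = G x) \<and>
       integral {0..d} G = d * weight f / source_entropy p \<and> 0 < \<epsilon> \<and> \<epsilon> < 1 \<and>
       (\<forall>x\<ge>1. \<bar>F f x - x * G (ln x)\<bar> \<le> B * x powr (1 - \<epsilon>))"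
    using word_sum_periodic[OF True] by blast
  show ?thesis
  proof (rule that[OF d(1)])
    fix f C assume "tame kappa C f"
    then obtain G \<epsilon> B where G: "continuous_on UNIV G" "\<forall>x. G (x + d) = G x"
      "integral {0..d} G = d * weight f / source_entropy p" "0 < \<epsilon>" "\<epsilon> < 1"
      and rate: "\<And>x. x \<ge> 1 \<Longrightarrow> \<bar>F f x - x * G (ln x)\<bar> \<le> B * x powr (1 - \<epsilon>)"
      using d(2) by blast
    have lim: "((\<lambda>x. B * x powr (- \<epsilon>)) \<longlongrightarrow> B * 0) at_top"
      using G(4) by (intro tendsto_mult tendsto_const tendsto_neg_powr filterlim_ident) auto
    have "eventually (\<lambda>x. norm (F f x / x - G (ln x)) \<le> B * x powr (- \<epsilon>)) at_top"
      using eventually_ge_at_top[of 1]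
    proof eventually_elim
      case (elim x)
      have "F f x / x - G (ln x) = (F f x - x * G (ln x)) / x" using elim by (simp add: diff_divide_distrib)
      then have "norm (F f x / x - G (ln x)) = \<bar>F f x - x * G (ln x)\<bar> / x" using elim by simp
      also have "\<dots> \<le> B * x powr (1 - \<epsilon>) / x" using rate[OF elim] elim by (intro divide_right_mono) auto
      also have "\<dots> = B * x powr (- \<epsilon>)" using elim by (simp add: powr_diff powr_minus field_simps)
      finally show ?case .
    qed
    then have "((\<lambda>x. F f x / x - G (ln x)) \<longlongrightarrow> 0) at_top"
      by (rule Lim_null_comparison) (use lim in simp)
    moreover have "\<exists>\<epsilon> B. 0 < \<epsilon> \<and> \<epsilon> < 1 \<and> (\<forall>x\<ge>1. \<bar>F f x - x * G (ln x)\<bar> \<le> B * x powr (1 - \<epsilon>))"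
      using G(4,5) rate by blast
    ultimately have "profile d f G" unfolding profile_def using G(1-3) True by simp
    then show "\<exists>G. profile d f G" by blast
  qed
next
  case False
  show ?thesis
  proof (rule that[of 1])
    fix f C assume "tame kappa C f"
    then have "((\<lambda>x. F f x / x - weight f / source_entropy p) \<longlongrightarrow> weight f / source_entropy p - weight f / source_entropy p) at_top"
      by (intro tendsto_diff word_sum_aperiodic[OF _ False] tendsto_const)
    then have "profile 1 f (\<lambda>_. weight f / source_entropy p)" unfolding profile_def using False by simp
    then show "\<exists>G. profile 1 f G" by blast
  qed simp
qed

lemma pair_weight_one:
  "pair_weight a b 1 = fact (a + b - 2) / (fact a * fact b * 2 ^ (a + b - 1))"
  by (simp add: pair_weight_def)

text \<open>
  The empty word contributes the first term, the nonempty words the series.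
\<close>

lemma pair_weight_total:
  assumes "a \<ge> 2" "b \<ge> 2"
  shows "weight (\<lambda>t. pois a t * F (pois b) t) = pair_weight a b 1 +
    (\<Sum>j. (- 1) ^ j * power_ratio p (b + j) * (fact (a + b + j - 2) / fact j)) / (fact a * fact b)"
proof -
  let ?g = "\<lambda>u. pair_weight a b (P u)"
  have s: "(?g has_sum weight (\<lambda>t. pois a t * F (pois b) t)) UNIV" by (rule weight_pois_times_word_sum[OF assms])
  have all: "insert [] (- {[]}) = (UNIV :: 'a list set)" by auto
  have "infsum ?g (insert [] (- {[]})) = ?g [] + infsum ?g (- {[]})"
    using summable_on_subset[OF has_sum_imp_summable[OF s], of "- {[]}"] by (intro infsum_insert) auto
  then have "weight (\<lambda>t. pois a t * F (pois b) t) = ?g [] + infsum ?g (- {[]})"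
    using infsumI[OF s] unfolding all by simp
  moreover have "(\<Sum>j. (- 1) ^ j * power_ratio p (b + j) * (fact (a + b + j - 2) / fact j)) = fact a * fact b * infsum ?g (- {[]})"
    using pair_weight_series[OF assms] by (rule sums_unique[symmetric])
  ultimately show ?thesis by simp
qed

end

context random_strings
begin

lemma drift_tame: "card T \<ge> 2 \<Longrightarrow> \<exists>C. tame kappa C (drift T)"
  unfolding drift_def[abs_def] using tame_kappa_euler_pois tame_cmult by blast

lemma weight_drift:
  assumes "motif \<tau> T"
  shows "weight (drift T) = Q T / (real \<tau> * (real \<tau> - 1))"
proof -
  have "card T = \<tau>" "\<tau> \<ge> 2" using motif_finite[OF assms] by auto
  then show ?thesis unfolding drift_def[abs_def] weight_cmult by (simp add: weight_euler_pois weight_pois)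
qed

lemma spread_tame_weight:
  assumes T: "motif \<tau> T" and T': "motif \<tau>' T'"
  shows spread_tame: "\<exists>C. tame kappa C (spread T T')"
    and weight_spread: "weight (spread T T') = (if T = T' then Q T else 0) / (real \<tau> * (real \<tau> - 1))
      - Q T * Q T' / (fact \<tau> * fact \<tau>') * (fact (\<tau> + \<tau>' - 2) / 2 ^ (\<tau> + \<tau>' - 1)
        + (\<Sum>j. (- 1) ^ j * (power_ratio p (\<tau> + j) + power_ratio p (\<tau>' + j)) * (fact (\<tau> + \<tau>' + j - 2) / fact j)))"
proof -
  have c: "card T = \<tau>" "card T' = \<tau>'" "\<tau> \<ge> 2" "\<tau>' \<ge> 2" using motif_finite[OF T] motif_finite[OF T'] by auto
  define q where "q = (if T = T' then Q T else 0)"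
  obtain A where A: "tame kappa A (pois \<tau>)" using tame_kappa_pois c by blast
  obtain B where B: "tame kappa B (\<lambda>t. pois \<tau> t * F (pois \<tau>') t)" using tame_pois_times_word_sum c by blast
  obtain B' where B': "tame kappa B' (\<lambda>t. pois \<tau>' t * F (pois \<tau>) t)" using tame_pois_times_word_sum c by blast
  obtain A1 A2 where A1: "tame phi A1 (pois \<tau>)" and A2: "tame phi A2 (pois \<tau>')" using pois_tame c by blast
  obtain D where D: "tame kappa D (\<lambda>t. pois \<tau> t * pois \<tau>' t)" using tame_times[OF A1 tame_linear[OF A2]] by blast
  note inner = tame_diff[OF tame_add[OF B B'] D]
  note parts = tame_cmult[OF A, of q] tame_cmult[OF inner, of "Q T * Q T'"]
  have eq: "spread T T' = (\<lambda>t. q * pois \<tau> t - Q T * Q T' * (pois \<tau> t * F (pois \<tau>') t + pois \<tau>' t * F (pois \<tau>) t - pois \<tau> t * pois \<tau>' t))"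
    unfolding spread_def[abs_def] c q_def by simp
  show "\<exists>C. tame kappa C (spread T T')" unfolding eq using tame_diff[OF parts] by blast
  have factor: "u * (v / (x * y * z) + s / (x * y)) = u / (x * y) * (v / z + s)" for u v x y z s :: real
    by (simp add: divide_inverse algebra_simps)
  define f where "f s j = (- 1) ^ j * power_ratio p (s + j) * (fact (\<tau> + \<tau>' + j - 2) / fact j)" for s j :: nat
  have f: "summable (f \<tau>)" "summable (f \<tau>')"
    using sums_summable[OF pair_weight_series[OF c(4,3)]] sums_summable[OF pair_weight_series[OF c(3,4)]]
    unfolding f_def by (simp_all add: add.commute[of \<tau>'])
  have w1: "weight (\<lambda>t. pois \<tau> t * F (pois \<tau>') t) = pair_weight \<tau> \<tau>' 1 + suminf (f \<tau>') / (fact \<tau> * fact \<tau>')"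
    using pair_weight_total[OF c(3,4)] unfolding f_def[abs_def] by simp
  have w2: "weight (\<lambda>t. pois \<tau>' t * F (pois \<tau>) t) = pair_weight \<tau> \<tau>' 1 + suminf (f \<tau>) / (fact \<tau> * fact \<tau>')"
    using pair_weight_total[OF c(4,3)] unfolding f_def[abs_def] pair_weight_one
    by (simp only: add.commute[of \<tau>' \<tau>] mult.commute[of "fact \<tau>'" "fact \<tau>"])
  have w3: "weight (\<lambda>t. pois \<tau> t * pois \<tau>' t) = pair_weight \<tau> \<tau>' 1"
    using weight_pois_times_pois[OF c(3,4), of 1] by simp
  have "weight (spread T T') = q * weight (pois \<tau>) - Q T * Q T' * (weight (\<lambda>t. pois \<tau> t * F (pois \<tau>') t)
      + weight (\<lambda>t. pois \<tau>' t * F (pois \<tau>) t) - weight (\<lambda>t. pois \<tau> t * pois \<tau>' t))"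
    unfolding eq weight_diff[OF parts] weight_cmult weight_diff[OF tame_add[OF B B'] D] weight_add[OF B B'] ..
  also have "\<dots> = q / (real \<tau> * (real \<tau> - 1))
      - Q T * Q T' * (pair_weight \<tau> \<tau>' 1 + (suminf (f \<tau>) + suminf (f \<tau>')) / (fact \<tau> * fact \<tau>'))"
    unfolding w1 w2 w3 using weight_pois[OF c(3)] by (simp add: add_divide_distrib)
  also have "suminf (f \<tau>) + suminf (f \<tau>') = (\<Sum>j. f \<tau> j + f \<tau>' j)" by (rule suminf_add[OF f])
  also have "\<dots> = (\<Sum>j. (- 1) ^ j * (power_ratio p (\<tau> + j) + power_ratio p (\<tau>' + j)) * (fact (\<tau> + \<tau>' + j - 2) / fact j))"
    by (simp add: f_def algebra_simps add_divide_distrib)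
  finally show "weight (spread T T') = (if T = T' then Q T else 0) / (real \<tau> * (real \<tau> - 1))
      - Q T * Q T' / (fact \<tau> * fact \<tau>') * (fact (\<tau> + \<tau>' - 2) / 2 ^ (\<tau> + \<tau>' - 1)
        + (\<Sum>j. (- 1) ^ j * (power_ratio p (\<tau> + j) + power_ratio p (\<tau>' + j)) * (fact (\<tau> + \<tau>' + j - 2) / fact j)))"
    unfolding q_def pair_weight_one
    by (simp only: factor)
qed

text \<open>
  With \<open>a\<close>, \<open>b\<close>, \<open>b'\<close> the differences between the three normalized word sums and their profiles, the error is
  \<open>n * O(\<bar>a\<bar> + \<bar>b\<bar> + \<bar>b'\<bar>) + O(1)\<close>. These differences tend to \<open>0\<close>, and in the periodic case they
  decay like a power of \<open>n\<close>.
\<close>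

lemma covariance_limit:
  assumes T: "motif \<tau> T" and T': "motif \<tau>' T'" and rel: "T = T' \<or> nonoverlapping T T'"
    and GS: "profile d (spread T T') GS" and G: "profile d (drift T) G" and G': "profile d (drift T') G'"
  defines "err \<equiv> (\<lambda>n. covariance M (motif_count S T n) (motif_count S T' n)
    - (GS (ln (real n)) - G (ln (real n)) * G' (ln (real n))) * real n)"
  shows covariance_smallo: "err \<in> o(\<lambda>n. real n)"
    and covariance_bigo: "periodic_probs p \<Longrightarrow> \<exists>\<epsilon>. 0 < \<epsilon> \<and> \<epsilon> < 1 \<and> err \<in> O(\<lambda>n. real n powr (1 - \<epsilon>))"
proof -
  obtain B where B: "B \<ge> 0" and cov: "\<And>n. n \<ge> 2 * (\<tau> + \<tau>') \<Longrightarrow> \<bar>covariance M (motif_count S T n) (motif_count S T' n)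
    - (F (spread T T') (real n) - F (drift T) (real n) * F (drift T') (real n) / real n)\<bar> \<le> B"
    using covariance_approx[OF T T' rel] by blast
  have c: "card T \<ge> 2" "card T' \<ge> 2" using motif_finite[OF T] motif_finite[OF T'] by auto
  obtain D where D: "tame kappa D (drift T)" using drift_tame c by blast
  obtain D' where D': "tame kappa D' (drift T')" using drift_tame c by blast
  define K where "K = max (D / gap) (D' / gap)"
  have F_le: "\<bar>F (drift T) x\<bar> \<le> K * x" "\<bar>F (drift T') x\<bar> \<le> K * x" if x: "x > 0" for x
  proof -
    have "\<bar>F (drift T) x\<bar> \<le> D / gap * x"
      by (rule word_sum_linear_bound[OF _ x tame_nonneg[OF D]]) (use D in \<open>simp add: tame_def\<close>)
    moreover have "\<bar>F (drift T') x\<bar> \<le> D' / gap * x"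
      by (rule word_sum_linear_bound[OF _ x tame_nonneg[OF D']]) (use D' in \<open>simp add: tame_def\<close>)
    moreover have "D / gap * x \<le> K * x" "D' / gap * x \<le> K * x"
      unfolding K_def using x
      by (rule mult_right_mono[OF max.cobounded1 less_imp_le], rule mult_right_mono[OF max.cobounded2 less_imp_le])
    ultimately show "\<bar>F (drift T) x\<bar> \<le> K * x" "\<bar>F (drift T') x\<bar> \<le> K * x" by (auto simp only: intro: order_trans)
  qed
  have K: "K \<ge> 0" using order_trans[OF abs_ge_zero F_le(1)[OF zero_less_one]] by simp
  define a where "a n = F (spread T T') (real n) / real n - GS (ln (real n))" for n
  define b where "b n = F (drift T) (real n) / real n - G (ln (real n))" for n
  define b' where "b' n = F (drift T') (real n) / real n - G' (ln (real n))" for n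
  have lim: "(\<lambda>n. F f (real n) / real n - H (ln (real n))) \<longlonglongrightarrow> 0" if "profile d f H" for f H
  proof -
    have "((\<lambda>x. F f x / x - H (ln x)) \<longlongrightarrow> 0) at_top" using that by (simp add: profile_def)
    from filterlim_compose[OF this filterlim_real_sequentially] show ?thesis .
  qed
  have lims: "a \<longlonglongrightarrow> 0" "b \<longlonglongrightarrow> 0" "b' \<longlonglongrightarrow> 0"
    unfolding a_def[abs_def] b_def[abs_def] b'_def[abs_def] by (rule lim[OF GS], rule lim[OF G], rule lim[OF G'])
  have G_le: "\<bar>G (ln (real n))\<bar> \<le> K + \<bar>b n\<bar>" if "n > 0" for n
  proof -
    have "\<bar>F (drift T) (real n) / real n\<bar> \<le> K" using F_le(1)[of "real n"] that by (simp add: pos_divide_le_eq)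
    then show ?thesis unfolding b_def by linarith
  qed
  have split: "c - (s - g * g') * r = (c - (x - y * z / r)) + (x / r - s - (y / r - g) * (z / r) - g * (z / r - g')) * r"
    if "r \<noteq> 0" for c s g g' r x y z :: real
    using that by (simp add: field_simps)
  have abs_add_scaled: "\<bar>u + v * r\<bar> \<le> B + \<bar>v\<bar> * r" if "\<bar>u\<bar> \<le> B" "r \<ge> 0" for u v r :: real
    using that abs_triangle_ineq[of u "v * r"] by (simp add: abs_mult)
  have abs_diff_diff: "\<bar>x - u - v\<bar> \<le> \<bar>x\<bar> + \<bar>u\<bar> + \<bar>v\<bar>" for x u v :: real
    by linarith
  have main: "\<bar>err n\<bar> \<le> B + (\<bar>a n\<bar> + K * \<bar>b n\<bar> + (K + \<bar>b n\<bar>) * \<bar>b' n\<bar>) * real n" if n: "n \<ge> 2 * (\<tau> + \<tau>')" for n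
  proof -
    have "\<tau> \<ge> 2" using motif_finite[OF T] by simp
    then have n0: "n > 0" using n by simp
    define v where "v = a n - b n * (F (drift T') (real n) / real n) - G (ln (real n)) * b' n"
    have eq: "err n = (covariance M (motif_count S T n) (motif_count S T' n)
        - (F (spread T T') (real n) - F (drift T) (real n) * F (drift T') (real n) / real n)) + v * real n"
      unfolding err_def v_def a_def b_def b'_def by (rule split) (use n0 in simp)
    have 1: "\<bar>err n\<bar> \<le> B + \<bar>v\<bar> * real n"
      unfolding eq by (rule abs_add_scaled[OF cov[OF n] of_nat_0_le_iff])
    have 2: "\<bar>v\<bar> \<le> \<bar>a n\<bar> + \<bar>b n\<bar> * \<bar>F (drift T') (real n) / real n\<bar> + \<bar>G (ln (real n))\<bar> * \<bar>b' n\<bar>"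
      unfolding v_def abs_mult[symmetric] by (rule abs_diff_diff)
    have 3: "\<bar>F (drift T') (real n) / real n\<bar> \<le> K" using F_le(2)[of "real n"] n0 by (simp add: pos_divide_le_eq)
    have "\<bar>a n\<bar> + \<bar>b n\<bar> * \<bar>F (drift T') (real n) / real n\<bar> + \<bar>G (ln (real n))\<bar> * \<bar>b' n\<bar>
        \<le> \<bar>a n\<bar> + K * \<bar>b n\<bar> + (K + \<bar>b n\<bar>) * \<bar>b' n\<bar>"
      unfolding mult.commute[of K]
      by (intro add_mono order_refl mult_left_mono[OF 3] mult_right_mono[OF G_le[OF n0]]) auto
    from order_trans[OF 2 this] have "\<bar>v\<bar> * real n \<le> (\<bar>a n\<bar> + K * \<bar>b n\<bar> + (K + \<bar>b n\<bar>) * \<bar>b' n\<bar>) * real n"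
      by (rule mult_right_mono) simp
    from order_trans[OF 1 add_left_mono[OF this]] show ?thesis .
  qed
  have ev: "eventually (\<lambda>n. n \<ge> 2 * (\<tau> + \<tau>') \<and> n > 0) sequentially"
    using eventually_ge_at_top[of "2 * (\<tau> + \<tau>')"] eventually_gt_at_top[of 0] by eventually_elim simp
  show "err \<in> o(\<lambda>n. real n)"
  proof (rule smalloI_tendsto)
    have L: "(\<lambda>n. B * inverse (real n) + (\<bar>a n\<bar> + K * \<bar>b n\<bar> + (K + \<bar>b n\<bar>) * \<bar>b' n\<bar>)) \<longlonglongrightarrow> B * 0 + (\<bar>0\<bar> + K * \<bar>0\<bar> + (K + \<bar>0\<bar>) * \<bar>0\<bar>)"
      by (intro tendsto_intros lims lim_inverse_n)
    have Ev: "eventually (\<lambda>n. norm (err n / real n) \<le> B * inverse (real n) + (\<bar>a n\<bar> + K * \<bar>b n\<bar> + (K + \<bar>b n\<bar>) * \<bar>b' n\<bar>)) sequentially"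
      using ev
    proof eventually_elim
      case (elim n)
      define X where "X = \<bar>a n\<bar> + K * \<bar>b n\<bar> + (K + \<bar>b n\<bar>) * \<bar>b' n\<bar>"
      have n: "real n > 0" using elim by simp
      have "norm (err n / real n) = \<bar>err n\<bar> / real n" by simp
      also have "\<dots> \<le> (B + X * real n) / real n"
        unfolding X_def by (rule divide_right_mono[OF main]) (use elim in auto)
      also have "\<dots> = B * inverse (real n) + X" using n by (simp add: add_divide_distrib inverse_eq_divide)
      finally show ?case unfolding X_def .
    qed
    show "(\<lambda>n. err n / real n) \<longlonglongrightarrow> 0"
      by (rule Lim_null_comparison[OF Ev]) (use L in simp)
    show "eventually (\<lambda>n. real n \<noteq> 0) sequentially" using eventually_gt_at_top[of 0] by eventually_elim simp
  qed
  assume per: "periodic_probs p"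
  have rate: "\<exists>\<epsilon> A. 0 < \<epsilon> \<and> \<epsilon> < 1 \<and> 0 \<le> A \<and> (\<forall>n>0. \<bar>F f (real n) / real n - H (ln (real n))\<bar> \<le> A * real n powr (- \<epsilon>))"
    if "profile d f H" for f H
  proof -
    obtain \<epsilon> A where e: "0 < \<epsilon>" "\<epsilon> < 1" "\<And>x. x \<ge> 1 \<Longrightarrow> \<bar>F f x - x * H (ln x)\<bar> \<le> A * x powr (1 - \<epsilon>)"
      using \<open>profile d f H\<close> per unfolding profile_def by blast
    have A: "A \<ge> 0" using e(3)[of 1] abs_ge_zero[of "F f 1 - 1 * H (ln 1)"] by simp
    have "\<bar>F f (real n) / real n - H (ln (real n))\<bar> \<le> A * real n powr (- \<epsilon>)" if n: "n > 0" for n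
    proof -
      have "F f (real n) / real n - H (ln (real n)) = (F f (real n) - real n * H (ln (real n))) / real n"
        using n by (simp add: diff_divide_distrib)
      then have "\<bar>F f (real n) / real n - H (ln (real n))\<bar> = \<bar>F f (real n) - real n * H (ln (real n))\<bar> / real n" by simp
      also have "\<dots> \<le> A * real n powr (1 - \<epsilon>) / real n" using e(3)[of "real n"] n by (intro divide_right_mono) auto
      also have "\<dots> = A * real n powr (- \<epsilon>)" using n by (simp add: powr_diff powr_minus field_simps)
      finally show ?thesis .
    qed
    then show ?thesis using e(1,2) A by blast
  qed
  obtain e1 A1 where 1: "0 < e1" "e1 < 1" "0 \<le> A1" "\<And>n. n > 0 \<Longrightarrow> \<bar>a n\<bar> \<le> A1 * real n powr (- e1)"
    using rate[OF GS, folded a_def] by blast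
  obtain e2 A2 where 2: "0 < e2" "e2 < 1" "0 \<le> A2" "\<And>n. n > 0 \<Longrightarrow> \<bar>b n\<bar> \<le> A2 * real n powr (- e2)"
    using rate[OF G, folded b_def] by blast
  obtain e3 A3 where 3: "0 < e3" "e3 < 1" "0 \<le> A3" "\<And>n. n > 0 \<Longrightarrow> \<bar>b' n\<bar> \<le> A3 * real n powr (- e3)"
    using rate[OF G', folded b'_def] by blast
  define \<epsilon> where "\<epsilon> = min e1 (min e2 e3)"
  have \<epsilon>: "0 < \<epsilon>" "\<epsilon> < 1" "\<epsilon> \<le> e1" "\<epsilon> \<le> e2" "\<epsilon> \<le> e3" using 1(1,2) 2(1) 3(1) by (simp_all add: \<epsilon>_def min_less_iff_disj)
  have up: "A * real n powr (- e) \<le> A * real n powr (- \<epsilon>)" if "n > 0" "\<epsilon> \<le> e" "A \<ge> 0" for n e A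
    using that by (intro mult_left_mono[OF _ that(3)] powr_mono) simp_all
  have "err \<in> O(\<lambda>n. real n powr (1 - \<epsilon>))"
  proof (rule bigoI)
    show "eventually (\<lambda>n. norm (err n) \<le> (B + (A1 + K * A2 + (K + A2) * A3)) * norm (real n powr (1 - \<epsilon>))) sequentially"
      using ev
    proof eventually_elim
      case (elim n)
      define r where "r = real n powr (- \<epsilon>)"
      have n1: "real n \<ge> 1" using elim by simp
      define Y where "Y = real n powr (1 - \<epsilon>)"
      define X where "X = \<bar>a n\<bar> + K * \<bar>b n\<bar> + (K + \<bar>b n\<bar>) * \<bar>b' n\<bar>"
      define A where "A = A1 + K * A2 + (K + A2) * A3"
      have r: "r \<ge> 0" by (simp add: r_def)
      have Y: "r * real n = Y" using n1 by (simp add: r_def Y_def powr_diff powr_minus field_simps)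
      have Y1: "1 \<le> Y" unfolding Y_def by (rule ge_one_powr_ge_zero[OF n1]) (use \<epsilon> in simp)
      have n0: "n > 0" using elim by simp
      have ab: "\<bar>a n\<bar> \<le> A1 * r" "\<bar>b n\<bar> \<le> A2 * r" "\<bar>b' n\<bar> \<le> A3 * r"
        unfolding r_def
        by (rule order_trans[OF 1(4)[OF n0] up[OF n0 \<epsilon>(3) 1(3)]], rule order_trans[OF 2(4)[OF n0] up[OF n0 \<epsilon>(4) 2(3)]],
            rule order_trans[OF 3(4)[OF n0] up[OF n0 \<epsilon>(5) 3(3)]])
      have "real n powr (- \<epsilon>) \<le> real n powr 0" by (rule powr_mono) (use n1 \<epsilon> in auto)
      then have "r \<le> 1" unfolding r_def using n0 by simp
      from order_trans[OF ab(2) mult_left_le[OF this 2(3)]] have b1: "\<bar>b n\<bar> \<le> A2" .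
      have "X \<le> A1 * r + K * (A2 * r) + (K + A2) * (A3 * r)"
        unfolding X_def
        by (intro add_mono ab(1) mult_left_mono[OF ab(2) K] mult_mono[OF add_left_mono[OF b1] ab(3)] add_nonneg_nonneg K 2(3) abs_ge_zero)
      then have "X \<le> A * r" unfolding A_def by (simp only: distrib_right mult.assoc)
      then have "X * real n \<le> A * r * real n" by (rule mult_right_mono) simp
      then have XY: "X * real n \<le> A * Y" unfolding Y[symmetric] mult.assoc .
      have BY: "B \<le> B * Y" using mult_left_mono[OF Y1 B] by simp
      have "\<bar>err n\<bar> \<le> B + X * real n" unfolding X_def by (rule main) (use elim in simp)
      from order_trans[OF this add_mono[OF BY XY]] have final: "\<bar>err n\<bar> \<le> (B + A) * Y" unfolding distrib_right .
      have "norm Y = Y" using Y1 by simp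
      with final show ?case unfolding A_def[symmetric] Y_def[symmetric] by (simp only: real_norm_def)
    qed
  qed
  then show "\<exists>\<epsilon>. 0 < \<epsilon> \<and> \<epsilon> < 1 \<and> err \<in> O(\<lambda>n. real n powr (1 - \<epsilon>))"
    by (intro exI[of _ \<epsilon>] conjI \<epsilon>(1,2))
qed

end

section \<open>The asymptotic variance and covariance\<close>

context random_strings
begin

lemma drift_constant:
  assumes "motif \<tau> T"
  shows "weight (drift T) / source_entropy p = Q T / (real \<tau> * (real \<tau> - 1) * source_entropy p)"
  unfolding weight_drift[OF assms] by simp

text \<open>
  The two series in \<open>weight_spread\<close> coincide, and \<open>fact (2 * \<tau> - 2)\<close> is rewritten by the central binomial coefficient.
\<close>

lemma spread_constant_self:
  assumes T: "motif \<tau> T"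
  shows "weight (spread T T) / source_entropy p = Q T / (real \<tau> * (real \<tau> - 1) * source_entropy p)
      - 2 * (Q T)\<^sup>2 / source_entropy p *
          (1 / 2 ^ (2 * \<tau>) / (2 * real \<tau> * (2 * real \<tau> - 1)) * real ((2 * \<tau>) choose \<tau>)
           + 1 / (fact \<tau>)\<^sup>2 * (\<Sum>j. (- 1) ^ j * power_ratio p (j + \<tau>) * (fact (j + 2 * \<tau> - 2) / fact j)))"
proof -
  define h where "h = source_entropy p"
  have \<tau>: "\<tau> \<ge> 2" using motif_finite[OF T] by simp
  define f where "f j = (- 1) ^ j * power_ratio p (j + \<tau>) * (fact (j + 2 * \<tau> - 2) / fact j)" for j
  have f: "f = (\<lambda>j. (- 1) ^ j * power_ratio p (\<tau> + j) * (fact (\<tau> + \<tau> + j - 2) / fact j))"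
    unfolding f_def[abs_def] mult_2 by (simp only: ac_simps)
  have "summable f" unfolding f using pair_weight_series[OF \<tau> \<tau>] by (rule sums_summable)
  then have "(\<Sum>j. 2 * f j) = 2 * suminf f" by (rule suminf_mult)
  moreover have double: "(\<lambda>j. (- 1) ^ j * (power_ratio p (\<tau> + j) + power_ratio p (\<tau> + j)) * (fact (\<tau> + \<tau> + j - 2) / fact j)) = (\<lambda>j. 2 * f j)"
    unfolding f mult_2[symmetric] by (simp only: ac_simps)
  ultimately have W: "weight (spread T T) = Q T / (real \<tau> * (real \<tau> - 1))
      - Q T * Q T / (fact \<tau> * fact \<tau>) * (fact (2 * \<tau> - 2) / 2 ^ (2 * \<tau> - 1) + 2 * suminf f)"
    using weight_spread[OF T T] unfolding double mult_2[of \<tau>] if_P[OF refl] by (simp only:)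
  have choose: "real ((2 * \<tau>) choose \<tau>) = fact (2 * \<tau>) / (fact \<tau> * fact \<tau>)"
    using binomial_fact[of \<tau> "2 * \<tau>", where 'a = real] by (simp add: mult_2)
  have "(fact (2 * \<tau>) :: real) = (2 * real \<tau>) * ((2 * real \<tau> - 1) * fact (2 * \<tau> - 2))"
    using \<tau> fact_reduce[of "2 * \<tau>", where 'a = real] fact_reduce[of "2 * \<tau> - 1", where 'a = real]
    by (simp add: of_nat_diff numeral_2_eq_2)
  moreover have "2 * real \<tau> > 0" "2 * real \<tau> - 1 > 0" using \<tau> by simp_all
  moreover have "(2::real) ^ (2 * \<tau>) = 2 * 2 ^ (2 * \<tau> - 1)" using \<tau> by (simp add: power_eq_if)
  ultimately have first: "1 / 2 ^ (2 * \<tau>) / (2 * real \<tau> * (2 * real \<tau> - 1)) * real ((2 * \<tau>) choose \<tau>)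
      = fact (2 * \<tau> - 2) / (2 * 2 ^ (2 * \<tau> - 1) * (fact \<tau> * fact \<tau>))"
    unfolding choose by simp
  have collect: "(q / x - q * q / (k * k) * (u / v + 2 * s)) / h = q / (x * h) - 2 * q\<^sup>2 / h * (u / (2 * v * (k * k)) + 1 / k\<^sup>2 * s)"
    for q x k u v s :: real
  proof -
    have "2 * q\<^sup>2 / h * (u / (2 * v * (k * k)) + 1 / k\<^sup>2 * s) = q * q / (k * k) * (u / v + 2 * s) / h"
      by (simp add: power2_eq_square distrib_left add_divide_distrib mult_ac)
    then show ?thesis by (simp add: diff_divide_distrib)
  qed
  show ?thesis unfolding first W h_def[symmetric] f_def[symmetric] by (rule collect)
qed

lemma spread_constant_distinct:
  assumes T: "motif \<tau> T" and T': "motif \<tau>' T'" and ne: "T \<noteq> T'"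
  shows "weight (spread T T') / source_entropy p = - (2 * Q T * Q T' / (fact \<tau> * fact \<tau>' * source_entropy p)) *
      (1 / 2 ^ (\<tau> + \<tau>') * fact (\<tau> + \<tau>' - 2)
       + 1 / 2 * (\<Sum>j. (- 1) ^ j * (power_ratio p (\<tau> + j) + power_ratio p (\<tau>' + j)) * (fact (\<tau> + \<tau>' + j - 2) / fact j)))"
proof -
  define h where "h = source_entropy p"
  have "\<tau> + \<tau>' > 0" using motif_finite[OF T] by simp
  then have half: "(2::real) ^ (\<tau> + \<tau>') = 2 * 2 ^ (\<tau> + \<tau>' - 1)" by (simp add: power_eq_if)
  have collect: "(0 / x - q / k * (u / v + s)) / h = - (2 * q / (k * h)) * (1 / (2 * v) * u + 1 / 2 * s)" for q k u v s x :: real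
    by (simp add: distrib_left add_divide_distrib diff_divide_distrib mult_ac)
  show ?thesis
    unfolding weight_spread[OF T T'] half h_def[symmetric] if_not_P[OF ne] mult.assoc[of 2 "Q T" "Q T'"] by (rule collect)
qed

end

theorem theorem1:
  fixes M :: "'w measure"
    and S :: "nat \<Rightarrow> 'w \<Rightarrow> 'a::finite stream"
    and p :: "'a \<Rightarrow> real"
  assumes alphabet: "CARD('a) \<ge> 2"
    and p_pos: "\<And>a. p a > 0"
    and p_sum: "(\<Sum>a\<in>UNIV. p a) = 1"
    and source: "memoryless_source M S p"
  shows "\<exists>(\<delta> :: 'a list set \<Rightarrow> real \<Rightarrow> real) (\<delta>h :: 'a list set \<Rightarrow> real \<Rightarrow> real)
          (\<delta>2 :: 'a list set \<Rightarrow> 'a list set \<Rightarrow> real \<Rightarrow> real)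
          (\<delta>h2 :: 'a list set \<Rightarrow> 'a list set \<Rightarrow> real \<Rightarrow> real).
    (let h = source_entropy p; Q = shape_functional M S; X = motif_count S in
      (\<forall>\<tau> T. motif \<tau> T \<longrightarrow>
        oscillating_mean_zero (\<delta> T) \<and> oscillating_mean_zero (\<delta>h T) \<and>
        (\<not> periodic_probs p \<longrightarrow> vanishing (\<delta> T) \<and> vanishing (\<delta>h T)) \<and>
        (let err = (\<lambda>n::nat. prob_space.variance M (X T n) -
            (Q T / (real \<tau> * (real \<tau> - 1) * h)
             - 2 * (Q T)\<^sup>2 / h *
                 (1 / 2 ^ (2 * \<tau>) / (2 * real \<tau> * (2 * real \<tau> - 1)) * real ((2 * \<tau>) choose \<tau>)
                  + 1 / (fact \<tau>)\<^sup>2 *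
                      (\<Sum>j. (-1) ^ j * power_ratio p (j + \<tau>) * (fact (j + 2 * \<tau> - 2) / fact j)))
             + \<delta> T (real n)
             - (Q T / (real \<tau> * (real \<tau> - 1) * h) + \<delta>h T (real n))\<^sup>2) * real n)
         in err \<in> o(\<lambda>n. real n) \<and>
            (periodic_probs p \<longrightarrow> (\<exists>\<epsilon>. 0 < \<epsilon> \<and> \<epsilon> < 1 \<and> err \<in> O(\<lambda>n. real n powr (1 - \<epsilon>)))))) \<and>
      (\<forall>\<tau> \<tau>' T T'. motif \<tau> T \<and> motif \<tau>' T' \<and> nonoverlapping T T' \<longrightarrow>
        oscillating (\<delta>2 T T') \<and> oscillating (\<delta>h2 T T') \<and>
        (\<not> periodic_probs p \<longrightarrow> vanishing (\<delta>2 T T') \<and> vanishing (\<delta>h2 T T')) \<and>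
        (\<lambda>n::nat. covariance M (X T n) (X T' n) -
            (- (2 * Q T * Q T' / (fact \<tau> * fact \<tau>' * h)) *
                 (1 / 2 ^ (\<tau> + \<tau>') * fact (\<tau> + \<tau>' - 2)
                  + 1 / 2 *
                      (\<Sum>j. (-1) ^ j * (power_ratio p (\<tau> + j) + power_ratio p (\<tau>' + j)) *
                           (fact (\<tau> + \<tau>' + j - 2) / fact j)))
             + 1 / 2 * (\<delta>2 T T' (real n) - \<delta> T (real n) - \<delta> T' (real n))
             - Q T * Q T' / (real \<tau> * (real \<tau> - 1) * real \<tau>' * (real \<tau>' - 1) * h\<^sup>2)
             + 1 / (2 * h) *
                 (Q T / (real \<tau> * (real \<tau> - 1)) * (\<delta>h T (real n) - \<delta>h2 T T' (real n))
                  + Q T' / (real \<tau>' * (real \<tau>' - 1)) * (\<delta>h T' (real n) - \<delta>h2 T T' (real n)))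
             - ((\<delta>h2 T T' (real n))\<^sup>2 - (\<delta>h T (real n))\<^sup>2 - (\<delta>h T' (real n))\<^sup>2)) * real n)
          \<in> o(\<lambda>n. real n)))"
proof -
  interpret letter_probs p by unfold_locales (rule p_pos, rule p_sum, rule alphabet)
  interpret prob_space M using source by (simp add: memoryless_source_def)
  interpret random_strings p M S
    by unfold_locales (use source in \<open>auto simp: memoryless_source_def\<close>)
  define h where "h = source_entropy p"
  obtain d where d: "d > 0" and ex: "\<And>f C. tame kappa C f \<Longrightarrow> \<exists>G. profile d f G" using profile_exists by blast
  define G where "G f = (SOME G. profile d f G)" for f
  have prof: "profile d f (G f)" if "tame kappa C f" for f C unfolding G_def using ex[OF that] by (rule someI_ex)
  have drift: "profile d (drift T) (G (drift T))" if "motif \<tau> T" for \<tau> T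
    using drift_tame motif_finite[OF that] prof by metis
  have spread: "profile d (spread T T') (G (spread T T'))" if "motif \<tau> T" "motif \<tau>' T'" for \<tau> \<tau>' T T'
    using spread_tame[OF that] prof by metis
  define c where "c f = weight f / h" for f
  define osc where "osc f y = G f y - c f" for f y
  define \<delta> where "\<delta> T x = osc (spread T T) (ln x)" for T and x :: real
  define \<delta>h where "\<delta>h T x = osc (drift T) (ln x)" for T and x :: real
  \<comment> \<open>Chosen so that the bracket of the covariance formula, with \<open>\<delta>h2 = 0\<close>, equals \<open>G (spread T T') - G (drift T) * G (drift T')\<close>.\<close>
  define P2 where "P2 T T' y = osc (spread T T) y + osc (spread T' T') y + 2 * (osc (spread T T') y
      - (G (drift T) y * G (drift T') y - c (drift T) * c (drift T'))
      - (c (drift T) * osc (drift T) y + c (drift T') * osc (drift T') y) / 2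
      - (osc (drift T) y)\<^sup>2 - (osc (drift T') y)\<^sup>2)" for T T' y
  define \<delta>2 where "\<delta>2 T T' x = P2 T T' (ln x)" for T T' and x :: real
  define \<delta>h2 :: "'a list set \<Rightarrow> 'a list set \<Rightarrow> real \<Rightarrow> real" where "\<delta>h2 = (\<lambda>_ _ _. 0)"
  have cont: "continuous_on UNIV (G f)" and period: "G f (x + d) = G f x" and aper: "\<not> periodic_probs p \<Longrightarrow> G f x = c f"
    if "profile d f (G f)" for f x
    using that unfolding profile_def c_def h_def by blast+
  have mean_zero: "oscillating_mean_zero (\<lambda>x. osc f (ln x))" if f: "profile d f (G f)" for f
  proof -
    have "G f integrable_on {0..d}"
      by (rule integrable_continuous_real[OF continuous_on_subset[OF cont[OF f]]]) simp
    then have "integral {0..d} (osc f) = integral {0..d} (G f) - integral {0..d} (\<lambda>_. c f)"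
      unfolding osc_def[abs_def] by (intro integral_diff) auto
    also have "\<dots> = 0" using f d by (simp add: profile_def c_def h_def)
    finally show ?thesis
      unfolding oscillating_mean_zero_def using d cont[OF f] period[OF f]
      by (intro exI[of _ "osc f"] exI[of _ d]) (auto simp: osc_def[abs_def] intro!: continuous_intros)
  qed
  have zero: "osc f y = 0" if "profile d f (G f)" "\<not> periodic_probs p" for f y
    using aper[OF that] by (simp add: osc_def)
  have c_drift: "c (drift T) = Q T / (real \<tau> * (real \<tau> - 1) * h)" if "motif \<tau> T" for \<tau> T
    unfolding c_def h_def by (rule drift_constant[OF that])
  have single: "oscillating_mean_zero (\<delta> T) \<and> oscillating_mean_zero (\<delta>h T) \<and>
        (\<not> periodic_probs p \<longrightarrow> vanishing (\<delta> T) \<and> vanishing (\<delta>h T)) \<and>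
        (let err = (\<lambda>n::nat. variance (motif_count S T n) -
            (Q T / (real \<tau> * (real \<tau> - 1) * h)
             - 2 * (Q T)\<^sup>2 / h *
                 (1 / 2 ^ (2 * \<tau>) / (2 * real \<tau> * (2 * real \<tau> - 1)) * real ((2 * \<tau>) choose \<tau>)
                  + 1 / (fact \<tau>)\<^sup>2 *
                      (\<Sum>j. (-1) ^ j * power_ratio p (j + \<tau>) * (fact (j + 2 * \<tau> - 2) / fact j)))
             + \<delta> T (real n)
             - (Q T / (real \<tau> * (real \<tau> - 1) * h) + \<delta>h T (real n))\<^sup>2) * real n)
         in err \<in> o(\<lambda>n. real n) \<and>
            (periodic_probs p \<longrightarrow> (\<exists>\<epsilon>. 0 < \<epsilon> \<and> \<epsilon> < 1 \<and> err \<in> O(\<lambda>n. real n powr (1 - \<epsilon>)))))"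
    if T: "motif \<tau> T" for \<tau> T
  proof -
    note profs = spread[OF T T] drift[OF T]
    have bracket: "(Q T / (real \<tau> * (real \<tau> - 1) * h)
             - 2 * (Q T)\<^sup>2 / h *
                 (1 / 2 ^ (2 * \<tau>) / (2 * real \<tau> * (2 * real \<tau> - 1)) * real ((2 * \<tau>) choose \<tau>)
                  + 1 / (fact \<tau>)\<^sup>2 *
                      (\<Sum>j. (-1) ^ j * power_ratio p (j + \<tau>) * (fact (j + 2 * \<tau> - 2) / fact j)))
             + \<delta> T x - (Q T / (real \<tau> * (real \<tau> - 1) * h) + \<delta>h T x)\<^sup>2)
          = G (spread T T) (ln x) - G (drift T) (ln x) * G (drift T) (ln x)" for x
      unfolding spread_constant_self[OF T, folded h_def, symmetric]
      unfolding c_drift[OF T, symmetric] \<delta>_def \<delta>h_def osc_def c_def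
      by (simp add: power2_eq_square)
    have var: "variance X = covariance M X X" for X by (simp add: covariance_def power2_eq_square)
    note lim = covariance_limit[OF T T disjI1[OF refl] profs(1) profs(2) profs(2)]
    show ?thesis
      unfolding Let_def bracket var
      using lim mean_zero[OF profs(1)] mean_zero[OF profs(2)] zero[OF profs(1)] zero[OF profs(2)]
      by (auto simp: \<delta>_def[abs_def] \<delta>h_def[abs_def] vanishing_def)
  qed
  have pair: "oscillating (\<delta>2 T T') \<and> oscillating (\<delta>h2 T T') \<and>
        (\<not> periodic_probs p \<longrightarrow> vanishing (\<delta>2 T T') \<and> vanishing (\<delta>h2 T T')) \<and>
        (\<lambda>n::nat. covariance M (motif_count S T n) (motif_count S T' n) -
            (- (2 * Q T * Q T' / (fact \<tau> * fact \<tau>' * h)) *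
                 (1 / 2 ^ (\<tau> + \<tau>') * fact (\<tau> + \<tau>' - 2)
                  + 1 / 2 *
                      (\<Sum>j. (-1) ^ j * (power_ratio p (\<tau> + j) + power_ratio p (\<tau>' + j)) *
                           (fact (\<tau> + \<tau>' + j - 2) / fact j)))
             + 1 / 2 * (\<delta>2 T T' (real n) - \<delta> T (real n) - \<delta> T' (real n))
             - Q T * Q T' / (real \<tau> * (real \<tau> - 1) * real \<tau>' * (real \<tau>' - 1) * h\<^sup>2)
             + 1 / (2 * h) *
                 (Q T / (real \<tau> * (real \<tau> - 1)) * (\<delta>h T (real n) - \<delta>h2 T T' (real n))
                  + Q T' / (real \<tau>' * (real \<tau>' - 1)) * (\<delta>h T' (real n) - \<delta>h2 T T' (real n)))
             - ((\<delta>h2 T T' (real n))\<^sup>2 - (\<delta>h T (real n))\<^sup>2 - (\<delta>h T' (real n))\<^sup>2)) * real n)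
          \<in> o(\<lambda>n. real n)"
    if T: "motif \<tau> T" and T': "motif \<tau>' T'" and no: "nonoverlapping T T'" for \<tau> \<tau>' T T'
  proof -
    have "appears_as_subtree T T" unfolding appears_as_subtree_def by (intro exI[of _ "[]"]) simp
    then have ne: "T \<noteq> T'" using no by (auto simp: nonoverlapping_def)
    note profs = spread[OF T T] spread[OF T' T'] spread[OF T T'] drift[OF T] drift[OF T']
    have const: "Q T * Q T' / (real \<tau> * (real \<tau> - 1) * real \<tau>' * (real \<tau>' - 1) * h\<^sup>2) = c (drift T) * c (drift T')"
      unfolding c_drift[OF T] c_drift[OF T'] by (simp add: power2_eq_square mult_ac)
    have distribute: "1 / (2 * h) * (q / x * (u - 0) + q' / x' * (u' - 0)) = (q / (x * h) * u + q' / (x' * h) * u') / 2" for q q' x x' u u'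
      by (simp add: distrib_left add_divide_distrib mult_ac)
    have half: "1 / 2 * (a + b + 2 * r - a - b) = r" for a b r :: real by simp
    have cancel: "m + (s - m - (w - k) - e - u - v) - k + e - (0\<^sup>2 - u - v) = s - w" for m s w k e u v :: real
      by simp
    have bracket: "- (2 * Q T * Q T' / (fact \<tau> * fact \<tau>' * h)) *
                 (1 / 2 ^ (\<tau> + \<tau>') * fact (\<tau> + \<tau>' - 2)
                  + 1 / 2 *
                      (\<Sum>j. (-1) ^ j * (power_ratio p (\<tau> + j) + power_ratio p (\<tau>' + j)) *
                           (fact (\<tau> + \<tau>' + j - 2) / fact j)))
             + 1 / 2 * (\<delta>2 T T' x - \<delta> T x - \<delta> T' x)
             - Q T * Q T' / (real \<tau> * (real \<tau> - 1) * real \<tau>' * (real \<tau>' - 1) * h\<^sup>2)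
             + 1 / (2 * h) *
                 (Q T / (real \<tau> * (real \<tau> - 1)) * (\<delta>h T x - 0)
                  + Q T' / (real \<tau>' * (real \<tau>' - 1)) * (\<delta>h T' x - 0))
             - (0\<^sup>2 - (\<delta>h T x)\<^sup>2 - (\<delta>h T' x)\<^sup>2)
          = G (spread T T') (ln x) - G (drift T) (ln x) * G (drift T') (ln x)" for x
      unfolding spread_constant_distinct[OF T T' ne, folded h_def, symmetric] const distribute
      unfolding c_drift[OF T, symmetric] c_drift[OF T', symmetric] \<delta>2_def P2_def \<delta>_def \<delta>h_def c_def[symmetric] half
      unfolding osc_def[of "spread T T'"] by (rule cancel)
    have "continuous_on UNIV (P2 T T')"
      unfolding P2_def[abs_def] osc_def by (intro continuous_intros cont[OF profs(1)] cont[OF profs(2)] cont[OF profs(3)] cont[OF profs(4)] cont[OF profs(5)]) auto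
    moreover have "P2 T T' (x + d) = P2 T T' x" for x
      unfolding P2_def osc_def period[OF profs(1)] period[OF profs(2)] period[OF profs(3)] period[OF profs(4)] period[OF profs(5)] ..
    ultimately have 1: "oscillating (\<delta>2 T T')"
      unfolding oscillating_def \<delta>2_def[abs_def] using d by blast
    have 2: "oscillating (\<delta>h2 T T')"
      unfolding oscillating_def \<delta>h2_def by (intro exI[of _ "\<lambda>_. 0"] exI[of _ 1]) simp
    have "P2 T T' y = 0" if "\<not> periodic_probs p" for y
      unfolding P2_def zero[OF profs(1) that] zero[OF profs(2) that] zero[OF profs(3) that] zero[OF profs(4) that] zero[OF profs(5) that]
        aper[OF profs(4) that] aper[OF profs(5) that] by simp
    then have 3: "\<not> periodic_probs p \<longrightarrow> vanishing (\<delta>2 T T') \<and> vanishing (\<delta>h2 T T')"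
      by (simp add: vanishing_def \<delta>2_def \<delta>h2_def)
    show ?thesis
      using 1 2 3 covariance_smallo[OF T T' disjI2[OF no] profs(3) profs(4) profs(5)]
      unfolding \<delta>h2_def bracket by blast
  qed
  show ?thesis
    unfolding Let_def h_def[symmetric]
    by (intro exI[of _ \<delta>] exI[of _ \<delta>h] exI[of _ \<delta>2] exI[of _ \<delta>h2] conjI allI impI; (use single[unfolded Let_def] pair in blast))
qed

end
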